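(* Let $\mathbf B(\alpha):(b,a^{(1)},\dots,a^{(m)})\mapsto(d,c^{(1)},\dots,c^{(m)})$ be the (invertible) change of variables $d_k=\frac{b_k}{1-\alpha b_k}$, $c_k^{(j)}=a_k^{(j)}\big/\prod_{i=0}^j(1-\alpha b_{k+i})$. Then: (i) the push-forward under $\mathbf B(\alpha)$ of the bracket $\{\cdot,\cdot\}_1^{(-\alpha)}-\alpha\{\cdot,\cdot\}_2$ equals $\{\cdot,\cdot\}_{2\alpha}$; (ii) the push-forward $\{\cdot,\cdot\}_{3\alpha}$ under $\mathbf B(\alpha)$ of $\{\cdot,\cdot\}_1^{(-\alpha)}$ is a Poisson bracket compatible with $\{\cdot,\cdot\}_{2\alpha}$; (iii) the system $\dot d_k=(1+\alpha d_k)(c_k^{(1)}-c_{k-1}^{(1)})$, $\dot c_k^{(j)}=c_k^{(j)}(d_{k+j}-d_k+\alpha c_{k+j}^{(1)}-\alpha c_{k-1}^{(1)})+(c_k^{(j+1)}-c_{k-1}^{(j+1)})$ ($1\le j\le m$, with $c^{(m+1)}=0$) is Hamiltonian with respect to $\{\cdot,\cdot\}_{3\alpha}$.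
   Context: $N\ge2m+2$, $m\ge1$, $\alpha\neq0$ real, subscripts modulo $N$, defined where $1-\alpha b_k\neq0$. Conventions: $a_k^{(0)}=b_k$, $a_k^{(p)}=0$ and $c_k^{(p)}=0$ for $p<0$ or $p>m$ (except $a^{(0)}=b$). All indices $1\le i,j\le m$. $\{\cdot,\cdot\}_1^{(-\alpha)}$ on $\mathbb R^{(m+1)N}(b,a)$: $\{b_k,b_{k+1}\}=-\alpha a_k^{(1)}$; $\{b_k,a_k^{(j)}\}=-a_k^{(j)}$, $\{a_k^{(j)},b_{k+j}\}=-a_k^{(j)}$; $\{b_k,a_{k+1}^{(j)}\}=-\alpha a_k^{(j+1)}$, $\{a_k^{(j)},b_{k+j+1}\}=-\alpha a_k^{(j+1)}$; $\{a_k^{(i)},a_{k+i}^{(j)}\}=-a_k^{(i+j)}$; $\{a_k^{(i)},a_{k+i+1}^{(j)}\}=-\alpha a_k^{(i+j+1)}$; all other coordinate brackets zero. $\{\cdot,\cdot\}_2$ on $\mathbb R^{(m+1)N}(b,a)$: $\{b_k,b_{k+1}\}=-a_k^{(1)}$; $\{b_k,a_{k+1}^{(j)}\}=-a_k^{(j+1)}$, $\{a_k^{(j)},b_{k+j+1}\}=-a_k^{(j+1)}$; $\{b_k,a_k^{(j)}\}=-b_ka_k^{(j)}$, $\{a_k^{(j)},b_{k+j}\}=-a_k^{(j)}b_{k+j}$; $\{a_k^{(i)},a_{k+i+1}^{(j)}\}=-a_k^{(i+j+1)}$; for $i<j$: $\{a_k^{(i)},a_k^{(j)}\}=-a_k^{(i)}a_k^{(j)}$,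 $\{a_k^{(j)},a_{k+j-i}^{(i)}\}=-a_k^{(j)}a_{k+j-i}^{(i)}$; for $i\le j$, $1\le\ell\le i$: $\{a_k^{(i)},a_{k+\ell}^{(j)}\}=-a_k^{(i)}a_{k+\ell}^{(j)}-a_k^{(j+\ell)}a_{k+\ell}^{(i-\ell)}$; for $i\le j$, $j-i+1\le\ell\le j$: $\{a_k^{(j)},a_{k+\ell}^{(i)}\}=-a_k^{(j)}a_{k+\ell}^{(i)}-a_k^{(i+\ell)}a_{k+\ell}^{(j-\ell)}$; all other coordinate brackets zero. $\{\cdot,\cdot\}_{2\alpha}$ on $\mathbb R^{(m+1)N}(d,c)$: $\{d_k,d_l\}=0$; $\{d_k,c_k^{(j)}\}=-c_k^{(j)}(1+\alpha d_k)$, $\{c_k^{(j)},d_{k+j}\}=-c_k^{(j)}(1+\alpha d_{k+j})$; $\{c_k^{(i)},c_{k+i}^{(j)}\}=-c_k^{(i+j)}-\alpha c_k^{(i)}c_{k+i}^{(j)}$; for $i\le j$, $1\le\ell\le i-1$: $\{c_k^{(i)},c_{k+\ell}^{(j)}\}=-\alpha c_k^{(i)}c_{k+\ell}^{(j)}+\alpha c_k^{(j+\ell)}c_{k+\ell}^{(i-\ell)}$; for $i\le j$, $j-i+1\le\ell\le j-1$: $\{c_k^{(j)},c_{k+\ell}^{(i)}\}=-\alpha c_k^{(j)}c_{k+\ell}^{(i)}+\alpha c_k^{(i+\ell)}c_{k+\ell}^{(j-\ell)}$; all other coordinate brackets zero. Two Poisson brackets are compatible if every linear combination of them is a Poisson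 bracket. "Hamiltonian" means $\dot x=\{H,x\}$ for some function $H$. *)

theory Defs
  imports "HOL-Analysis.Analysis"
begin

text \<open>A point of R^((m+1)N) is a function on coordinate labels (p,k), p in {0..m}, k in {0..<N}.
  Label (0,k) is b_k (resp. d_k), label (j,k), 1 <= j <= m, is a_k^(j) (resp. c_k^(j)).
  Points are required to vanish outside the index set (extensional representation).\<close>

type_synonym pt = "nat \<times> nat \<Rightarrow> real"
type_synonym bivec = "pt \<Rightarrow> nat \<times> nat \<Rightarrow> nat \<times> nat \<Rightarrow> real"

definition idx :: "nat \<Rightarrow> nat \<Rightarrow> (nat \<times> nat) set" where
  "idx m N = {0..m} \<times> {0..<N}"

definition off :: "nat \<Rightarrow> nat \<Rightarrow> nat \<Rightarrow> nat" where
  "off N k l = (l + N - k) mod N"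

definition co :: "nat \<Rightarrow> nat \<Rightarrow> pt \<Rightarrow> nat \<Rightarrow> nat \<Rightarrow> real" where
  "co m N x p k = (if p \<le> m then x (p, k mod N) else 0)"

definition pd :: "(pt \<Rightarrow> real) \<Rightarrow> nat \<times> nat \<Rightarrow> pt \<Rightarrow> real" where
  "pd F u x = deriv (\<lambda>t. F (x(u := t))) (x u)"

text \<open>From the listed brackets {x_u, x_v} = value (Some value) build the full skew structure matrix:
  reversed pairs get the negative, all other coordinate brackets are zero.\<close>
definition skewify :: "(pt \<Rightarrow> nat \<times> nat \<Rightarrow> nat \<times> nat \<Rightarrow> real option) \<Rightarrow> bivec" where
  "skewify r x u v = (case r x u v of Some c \<Rightarrow> c
      | None \<Rightarrow> (case r x v u of Some c \<Rightarrow> - c | None \<Rightarrow> 0))"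

fun rule1 :: "real \<Rightarrow> nat \<Rightarrow> nat \<Rightarrow> pt \<Rightarrow> nat \<times> nat \<Rightarrow> nat \<times> nat \<Rightarrow> real option" where
  "rule1 \<alpha> m N x (p, k) (q, l) =
    (let d = off N k l; a = co m N x in
     if p = 0 \<and> q = 0 \<and> d = 1 then Some (- \<alpha> * a 1 k)
     else if p = 0 \<and> q \<ge> 1 \<and> d = 0 then Some (- a q k)
     else if p \<ge> 1 \<and> q = 0 \<and> d = p then Some (- a p k)
     else if p = 0 \<and> q \<ge> 1 \<and> d = 1 then Some (- \<alpha> * a (q + 1) k)
     else if p \<ge> 1 \<and> q = 0 \<and> d = p + 1 then Some (- \<alpha> * a (p + 1) k)
     else if p \<ge> 1 \<and> q \<ge> 1 \<and> d = p then Some (- a (p + q) k)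
     else if p \<ge> 1 \<and> q \<ge> 1 \<and> d = p + 1 then Some (- \<alpha> * a (p + q + 1) k)
     else None)"

fun rule2 :: "nat \<Rightarrow> nat \<Rightarrow> pt \<Rightarrow> nat \<times> nat \<Rightarrow> nat \<times> nat \<Rightarrow> real option" where
  "rule2 m N x (p, k) (q, l) =
    (let d = off N k l; a = co m N x in
     if p = 0 \<and> q = 0 \<and> d = 1 then Some (- a 1 k)
     else if p = 0 \<and> q \<ge> 1 \<and> d = 1 then Some (- a (q + 1) k)
     else if p \<ge> 1 \<and> q = 0 \<and> d = p + 1 then Some (- a (p + 1) k)
     else if p = 0 \<and> q \<ge> 1 \<and> d = 0 then Some (- a 0 k * a q k)
     else if p \<ge> 1 \<and> q = 0 \<and> d = p then Some (- a p k * a 0 l)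
     else if p \<ge> 1 \<and> q \<ge> 1 \<and> d = p + 1 then Some (- a (p + q + 1) k)
     else if 1 \<le> p \<and> p < q \<and> d = 0 then Some (- a p k * a q k)
     else if 1 \<le> q \<and> q < p \<and> d = p - q then Some (- a p k * a q l)
     else if 1 \<le> p \<and> p \<le> q \<and> 1 \<le> d \<and> d \<le> p
       then Some (- a p k * a q l - a (q + d) k * a (p - d) l)
     else if 1 \<le> q \<and> q \<le> p \<and> p - q + 1 \<le> d \<and> d \<le> p
       then Some (- a p k * a q l - a (q + d) k * a (p - d) l)
     else None)"

fun rule2a :: "real \<Rightarrow> nat \<Rightarrow> nat \<Rightarrow> pt \<Rightarrow> nat \<times> nat \<Rightarrow> nat \<times> nat \<Rightarrow> real option" where
  "rule2a \<alpha> m N y (p, k) (q, l) =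
    (let d = off N k l; c = co m N y in
     if p = 0 \<and> q \<ge> 1 \<and> d = 0 then Some (- c q k * (1 + \<alpha> * c 0 k))
     else if p \<ge> 1 \<and> q = 0 \<and> d = p then Some (- c p k * (1 + \<alpha> * c 0 l))
     else if p \<ge> 1 \<and> q \<ge> 1 \<and> d = p then Some (- c (p + q) k - \<alpha> * c p k * c q l)
     else if 1 \<le> p \<and> p \<le> q \<and> 1 \<le> d \<and> d + 1 \<le> p
       then Some (- \<alpha> * c p k * c q l + \<alpha> * c (q + d) k * c (p - d) l)
     else if 1 \<le> q \<and> q \<le> p \<and> p - q + 1 \<le> d \<and> d + 1 \<le> p
       then Some (- \<alpha> * c p k * c q l + \<alpha> * c (q + d) k * c (p - d) l)
     else None)"

definition PB1 :: "real \<Rightarrow> nat \<Rightarrow> nat \<Rightarrow> bivec" where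
  "PB1 \<alpha> m N = skewify (rule1 \<alpha> m N)"

definition PB2 :: "nat \<Rightarrow> nat \<Rightarrow> bivec" where
  "PB2 m N = skewify (rule2 m N)"

definition PB2a :: "real \<Rightarrow> nat \<Rightarrow> nat \<Rightarrow> bivec" where
  "PB2a \<alpha> m N = skewify (rule2a \<alpha> m N)"

definition Bmap :: "real \<Rightarrow> nat \<Rightarrow> nat \<Rightarrow> pt \<Rightarrow> pt" where
  "Bmap \<alpha> m N x = (\<lambda>(p, k).
     if p = 0 \<and> k < N then x (0, k) / (1 - \<alpha> * x (0, k))
     else if 1 \<le> p \<and> p \<le> m \<and> k < N
       then x (p, k) / (\<Prod>i\<in>{0..p}. (1 - \<alpha> * x (0, (k + i) mod N)))
     else 0)"

definition Dom :: "real \<Rightarrow> nat \<Rightarrow> nat \<Rightarrow> pt set" where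
  "Dom \<alpha> m N = {x. (\<forall>u. u \<notin> idx m N \<longrightarrow> x u = 0) \<and> (\<forall>k<N. 1 - \<alpha> * x (0, k) \<noteq> 0)}"

definition pushfwd :: "(nat \<times> nat) set \<Rightarrow> pt set \<Rightarrow> (pt \<Rightarrow> pt) \<Rightarrow> bivec \<Rightarrow> bivec" where
  "pushfwd I D B P y u v =
     (let x = the_inv_into D B y in
      \<Sum>w\<in>I. \<Sum>z\<in>I. pd (\<lambda>x. B x u) w x * pd (\<lambda>x. B x v) z x * P x w z)"

definition PB3 :: "real \<Rightarrow> nat \<Rightarrow> nat \<Rightarrow> bivec" where
  "PB3 \<alpha> m N = pushfwd (idx m N) (Dom \<alpha> m N) (Bmap \<alpha> m N) (PB1 \<alpha> m N)"

definition poisson :: "(nat \<times> nat) set \<Rightarrow> pt set \<Rightarrow> bivec \<Rightarrow> bool" where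
  "poisson I U P \<longleftrightarrow>
     (\<forall>y\<in>U. \<forall>u\<in>I. \<forall>v\<in>I. P y u v = - P y v u) \<and>
     (\<forall>y\<in>U. \<forall>u\<in>I. \<forall>v\<in>I. \<forall>z\<in>I. (\<lambda>t. P (y(z := t)) u v) differentiable (at (y z))) \<and>
     (\<forall>y\<in>U. \<forall>u\<in>I. \<forall>v\<in>I. \<forall>w\<in>I.
        (\<Sum>z\<in>I. P y u z * pd (\<lambda>y'. P y' v w) z y + P y v z * pd (\<lambda>y'. P y' w u) z y
               + P y w z * pd (\<lambda>y'. P y' u v) z y) = 0)"

definition compatible :: "(nat \<times> nat) set \<Rightarrow> pt set \<Rightarrow> bivec \<Rightarrow> bivec \<Rightarrow> bool" where
  "compatible I U P Q \<longleftrightarrow>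
     (\<forall>s t :: real. poisson I U (\<lambda>y u v. s * P y u v + t * Q y u v))"

text \<open>x' = {H, x}: X_u(y) = sum_z P_{z u}(y) dH/dy_z\<close>
definition hamiltonian :: "(nat \<times> nat) set \<Rightarrow> pt set \<Rightarrow> bivec \<Rightarrow> (pt \<Rightarrow> pt) \<Rightarrow> bool" where
  "hamiltonian I U P X \<longleftrightarrow>
     (\<exists>H :: pt \<Rightarrow> real.
        (\<forall>y\<in>U. \<forall>z\<in>I. (\<lambda>t. H (y(z := t))) differentiable (at (y z))) \<and>
        (\<forall>y\<in>U. \<forall>u\<in>I. X y u = (\<Sum>z\<in>I. P y z u * pd H z y)))"

definition Xfield :: "real \<Rightarrow> nat \<Rightarrow> nat \<Rightarrow> pt \<Rightarrow> pt" where
  "Xfield \<alpha> m N y = (\<lambda>(p, k).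
     let c = co m N y; km = (k + N - 1) mod N in
     if p = 0 then (1 + \<alpha> * c 0 k) * (c 1 k - c 1 km)
     else c p k * (c 0 (k + p) - c 0 k + \<alpha> * c 1 (k + p) - \<alpha> * c 1 km)
          + (c (p + 1) k - c (p + 1) km))"

end

(*
  For an arbitrary infinite matrix L the quadratic bracket
    {L_ab, L_cd} = (s + [b < c] - [d < a]) L_ab L_cd + s L_ad L_cb,  s = (sgn (a - c) + sgn (b - d)) / 2,
  satisfies the Jacobi identity: the only monomials whose coefficients do not cancel outright are the two
  3-cycles, and their coefficient is the difference of two instances of the cyclic sign identity.  Summing over
  translates gives a Poisson bracket on N-periodic matrices.  Writing a_k^(j) = L_(k,k+j), the bracket is tangent
  to the band -1 <= j <= m with constant lower diagonal, and there {,}_2 + g {,}_1 is this bracket with the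
  diagonal shifted by g and lower diagonal 1 + g alpha.  Since the Jacobiator is quadratic in the coefficients,
  all linear combinations of {,}_1 and {,}_2 are Poisson; g = - 1 / alpha makes the lower diagonal vanish and the
  diagonal a multiple of 1 - alpha b_k, which is why B(alpha) simplifies that member of the pencil to {,}_2alpha.
  Push-forward along a birational map preserves the Jacobi identity, which gives (ii), and (iii) has the
  Hamiltonian alpha^(-2) sum_k ln |1 + alpha d_k|.
*)
theory Submission
  imports Defs "HOL-Library.Groups_Big_Fun"
begin

section \<open>The quadratic bracket on infinite matrices\<close>

text \<open>The sign part of the coefficients does not decay with distance, so a sum over translates
  of it alone would have infinite support. The two indicators in \<open>dgn\<close> repair this: the
  product term vanishes as soon as the index intervals of the two entries lie apart. The same
  indicators make the bracket of a band coordinate with a lower diagonal entry vanish, so that this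
  diagonal may be kept constant. Why B(\<alpha>) works: it multiplies the entry (k, k + j) by one
  factor for each index k, ..., k + j. Two entries, and the two obtained from them by exchanging
  column indices, carry the same factors, so without a lower diagonal the bracket scales
  homogeneously. The diagonal becomes the constant - 1 / \<alpha>, which is the origin of the linear
  terms of the target. What remains are the brackets of the factors with the entries; they change
  only the coefficient of the product of the two entries, and they reverse the sign of its
  \<open>dgn\<close> part. Only partial derivatives are available, and a push-forward is meaningful
  only on the image; all functions are therefore treated as rational functions on a given
  set.\<close>

definition swp :: "int \<Rightarrow> int \<Rightarrow> int \<Rightarrow> int \<Rightarrow> real" where
  "swp a b c d = sgn (real_of_int (a - c)) / 2 + sgn (real_of_int (b - d)) / 2"

definition dgn :: "int \<Rightarrow> int \<Rightarrow> int \<Rightarrow> int \<Rightarrow> real" where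
  "dgn a b c d = swp a b c d + of_bool (b < c) - of_bool (d < a)"

definition ker :: "(int \<Rightarrow> int \<Rightarrow> real) \<Rightarrow> int \<times> int \<Rightarrow> int \<times> int \<Rightarrow> real" where
  "ker L = (\<lambda>(a, b) (c, d). dgn a b c d * L a b * L c d + swp a b c d * L a d * L c b)"

text \<open>The derivative of \<open>ker L v w\<close> when \<open>L\<close> moves with velocity \<open>X\<close>.\<close>

definition dker :: "(int \<Rightarrow> int \<Rightarrow> real) \<Rightarrow> (int \<times> int \<Rightarrow> real) \<Rightarrow> int \<times> int \<Rightarrow> int \<times> int \<Rightarrow> real" where
  "dker L X = (\<lambda>(c, d) (e, f). dgn c d e f * (X (c, d) * L e f + L c d * X (e, f))
     + swp c d e f * (X (c, f) * L e d + L c f * X (e, d)))"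

text \<open>The three differences add up to 0. If none vanishes, two share a sign and the third
  opposes them; if exactly one vanishes, the other two are opposite.\<close>

lemma sgn_cyclic:
  fixes x y z :: real
  assumes "\<not> (x = y \<and> y = z)"
  shows "sgn (x - y) * sgn (y - z) + sgn (y - z) * sgn (z - x) + sgn (z - x) * sgn (x - y) = - 1"
  using assms by (auto simp: sgn_if)

lemma sgn_flip: "sgn (real_of_int (x - y)) = - sgn (real_of_int (y - x))"
  by (auto simp: sgn_if)

text \<open>Against a fixed third entry, \<open>dgn\<close> is a term in the row index plus a term
  in the column index of its partner, so its total over two partners does not change when these
  exchange column indices. This cancels all products of a \<open>dgn\<close> with a
  \<open>swp\<close> coefficient; products of two \<open>dgn\<close> coefficients cancel by skew
  symmetry. Two exchanges in succession leave the 3-cycles.\<close>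

lemma ker_jacobi:
  "dker L (ker L u) v w + dker L (ker L v) w u + dker L (ker L w) u v = 0"
proof -
  obtain a b c d e f where uvw: "u = (a, b)" "v = (c, d)" "w = (e, f)"
    by (metis surj_pair)
  define s1 s2 s3 t1 t2 t3 where st:
    "s1 = sgn (real_of_int (a - c)) / 2" "s2 = sgn (real_of_int (c - e)) / 2" "s3 = sgn (real_of_int (e - a)) / 2"
    "t1 = sgn (real_of_int (b - d)) / 2" "t2 = sgn (real_of_int (d - f)) / 2" "t3 = sgn (real_of_int (f - b)) / 2"
  have st': "sgn (real_of_int (c - a)) / 2 = - s1" "sgn (real_of_int (e - c)) / 2 = - s2" "sgn (real_of_int (a - e)) / 2 = - s3"
    "sgn (real_of_int (d - b)) / 2 = - t1" "sgn (real_of_int (f - d)) / 2 = - t2" "sgn (real_of_int (b - f)) / 2 = - t3"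
    unfolding st by (auto simp: sgn_if)
  have "dker L (ker L u) v w + dker L (ker L v) w u + dker L (ker L w) u v
    = ((s1 * s2 + s2 * s3 + s3 * s1) - (t1 * t2 + t2 * t3 + t3 * t1)) *
      (L a f * L c b * L e d - L a d * L c f * L e b)"
    unfolding uvw dker_def ker_def case_prod_conv dgn_def swp_def st(1-6)[symmetric] st'
    by (simp add: algebra_simps)
  also have "\<dots> = 0"
  \<comment> \<open>If all rows or all columns agree, \<open>sgn_cyclic\<close> does not apply, but
    the two 3-cycles are then the same monomial.\<close>
  proof (cases "a = c \<and> c = e \<or> b = d \<and> d = f")
    case True
    then show ?thesis by auto
  next
    case False
    then show ?thesis
      using sgn_cyclic[of "real_of_int a" "real_of_int c" "real_of_int e"]
        sgn_cyclic[of "real_of_int b" "real_of_int d" "real_of_int f"]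
      by (auto simp: st)
  qed
  finally show ?thesis .
qed

section \<open>Periodic band matrices\<close>

lemma swp_skew: "swp c d a b = - swp a b c d"
  using sgn_flip[of a c] sgn_flip[of b d] by (simp add: swp_def)

lemma ker_skew: "ker L v u = - ker L u v"
proof -
  obtain a b c d where uv: "u = (a, b)" "v = (c, d)" by (metis surj_pair)
  show ?thesis
    unfolding uv ker_def case_prod_conv dgn_def swp_skew[of c d a b] by (simp add: algebra_simps)
qed

locale band =
  fixes L :: "int \<Rightarrow> int \<Rightarrow> real" and N m :: int
  assumes N_pos: "N > 0" and m_nonneg: "m \<ge> 0"
    and periodic: "L (a + n * N) (b + n * N) = L a b"
    and outside: "b < a - 1 \<or> a + m < b \<Longrightarrow> L a b = 0"
begin

definition trl :: "int \<Rightarrow> int \<times> int \<Rightarrow> int \<times> int" where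
  "trl n = (\<lambda>(a, b). (a + n * N, b + n * N))"

text \<open>The diagonal b = a - 1 is left out although \<open>L\<close> may be nonzero there: it is
  a constant and not a coordinate.\<close>

definition in_band :: "int \<times> int \<Rightarrow> bool" where
  "in_band = (\<lambda>(a, b). a \<le> b \<and> b \<le> a + m)"

text \<open>An entry of a periodic matrix stands for all its translates, so their brackets are added
  up. \<open>Sum_any\<close> is 0 on infinite support; \<open>finite_support\<close> excludes that
  case when u is a coordinate.\<close>

definition pker :: "int \<times> int \<Rightarrow> int \<times> int \<Rightarrow> real" where
  "pker u v = Sum_any (\<lambda>n. ker L u (trl n v))"

lemma trl_trl [simp]: "trl i (trl j v) = trl (i + j) v"
  by (cases v) (simp add: trl_def algebra_simps)

lemma trl_0 [simp]: "trl 0 v = v"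
  by (cases v) (simp add: trl_def)

lemma in_band_trl [simp]: "in_band (trl n v) = in_band v"
  by (cases v) (simp add: trl_def in_band_def)

lemma ker_trl [simp]: "ker L (trl n u) (trl n v) = ker L u v"
  by (cases u; cases v)
    (simp add: trl_def ker_def dgn_def swp_def periodic)

lemma ker_trl_left: "ker L (trl n u) v = ker L u (trl (- n) v)"
  using ker_trl[of n u "trl (- n) v"] by simp

lemma dker_trl: "dker L (\<lambda>w. X (trl n w)) v w = dker L X (trl n v) (trl n w)"
  by (cases v; cases w) (simp add: trl_def dker_def dgn_def swp_def periodic)

text \<open>Outside the band \<open>L c d\<close> vanishes and, where both exchanged entries
  survive, the two signs in \<open>swp\<close> are opposite. So the bracket with a coordinate never
  leaves the band (tangency) and never reaches far (locality).\<close>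

lemma ker_in_band_nonzero:
  assumes "in_band u" "ker L u v \<noteq> 0"
  shows "in_band v" "\<bar>fst u - fst v\<bar> \<le> m + 1"
proof -
  obtain a b c d where uv: "u = (a, b)" "v = (c, d)" by (metis surj_pair)
  have ab: "a \<le> b" "b \<le> a + m" using assms by (auto simp: in_band_def uv)
  have nz: "dgn a b c d * L a b * L c d + swp a b c d * L a d * L c b \<noteq> 0"
    using assms by (auto simp: ker_def uv)
  have cd: "c - 1 \<le> d" "d \<le> c + m"
  proof -
    show "c - 1 \<le> d"
    proof (rule ccontr)
      assume h: "\<not> c - 1 \<le> d"
      then have "L c d = 0" by (simp add: outside)
      with nz have *: "L a d \<noteq> 0" "L c b \<noteq> 0" "swp a b c d \<noteq> 0" by auto
      then have "a - 1 \<le> d" "c - 1 \<le> b" using outside by force+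
      then show False using * h by (auto simp: swp_def sgn_if split: if_splits)
    qed
    show "d \<le> c + m"
    proof (rule ccontr)
      assume h: "\<not> d \<le> c + m"
      then have "L c d = 0" by (simp add: outside)
      with nz have *: "L a d \<noteq> 0" "L c b \<noteq> 0" "swp a b c d \<noteq> 0" by auto
      then have "d \<le> a + m" "b \<le> c + m" using outside by force+
      then show False using * h by (auto simp: swp_def sgn_if split: if_splits)
    qed
  qed
  \<comment> \<open>For d = c - 1 the two monomials either coincide, with coefficients adding up to
    0 (a = c or b = c - 1), or vanish separately. This is what keeps the lower diagonal
    constant.\<close>
  have "c \<le> d"
  proof (rule ccontr)
    assume "\<not> c \<le> d"
    with cd have d: "d = c - 1" by auto
    have "L a d = 0 \<or> a \<le> c" "L c b = 0 \<or> c - 1 \<le> b"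
      using outside d by force+
    then show False
      using nz ab unfolding d
      by (cases a c rule: linorder_cases; cases b "c - 1" rule: linorder_cases) (auto simp: swp_def dgn_def sgn_if)
  qed
  then show "in_band v" using cd by (simp add: uv in_band_def)
  \<comment> \<open>Beyond this distance the intervals are disjoint: the indicator in
    \<open>dgn\<close> compensates the signs, and the exchanged entry lies below the band.\<close>
  have "c \<le> a + m + 1"
  proof (rule ccontr)
    assume h: "\<not> c \<le> a + m + 1"
    then have "L c b = 0" using ab by (intro outside) auto
    moreover have "dgn a b c d = 0"
      using h ab \<open>c \<le> d\<close> by (simp add: dgn_def swp_def sgn_if)
    ultimately show False using nz by simp
  qed
  moreover have "a \<le> c + m + 1"
  proof (rule ccontr)
    assume h: "\<not> a \<le> c + m + 1"
    then have "L a d = 0" using cd by (intro outside) auto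
    moreover have "dgn a b c d = 0"
      using h ab cd by (simp add: dgn_def swp_def sgn_if)
    ultimately show False using nz by simp
  qed
  ultimately show "\<bar>fst u - fst v\<bar> \<le> m + 1" by (simp add: uv)
qed

lemma near_bound: "\<bar>a - (c + n * N)\<bar> \<le> r \<Longrightarrow> \<bar>n\<bar> \<le> \<bar>a - c\<bar> + r"
proof -
  assume "\<bar>a - (c + n * N)\<bar> \<le> r"
  moreover have "\<bar>n\<bar> * 1 \<le> \<bar>n\<bar> * N" using N_pos by (intro mult_left_mono) auto
  moreover have "\<bar>n * N\<bar> = \<bar>n\<bar> * N" using N_pos by (simp add: abs_mult)
  ultimately show ?thesis by linarith
qed

lemma finite_support:
  assumes "in_band u"
  shows "finite {n. ker L u (trl n v) \<noteq> 0}"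
proof (rule finite_subset)
  show "{n. ker L u (trl n v) \<noteq> 0} \<subseteq> {- (\<bar>fst u - fst v\<bar> + (m + 1)) .. \<bar>fst u - fst v\<bar> + (m + 1)}"
    using ker_in_band_nonzero(2)[OF assms] near_bound
    by (cases v) (fastforce simp: trl_def)
qed simp

lemma pker_trl [simp]: "pker u (trl n v) = pker u v"
  unfolding pker_def
proof (rule Sum_any.reindex_cong[symmetric])
  show "bij (\<lambda>i. i + n)"
    by (rule bij_betw_byWitness[where f' = "\<lambda>i. i - n"]) auto
qed auto

lemma pker_not_in_band: "in_band u \<Longrightarrow> \<not> in_band v \<Longrightarrow> pker u v = 0"
proof -
  assume "in_band u" "\<not> in_band v"
  then have "ker L u (trl n v) = 0" for n
    using ker_in_band_nonzero(1)[of u "trl n v"] by auto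
  then show ?thesis by (simp add: pker_def)
qed

section \<open>The Jacobi identity for the sum over translates\<close>

lemma dker_Sum_any:
  assumes "\<And>w. finite {i. F i w \<noteq> 0}"
  shows "dker L (\<lambda>w. Sum_any (\<lambda>i. F i w)) v w = Sum_any (\<lambda>i. dker L (F i) v w)"
proof -
  obtain c d e f where vw: "v = (c, d)" "w = (e, f)" by (metis surj_pair)
  define S where "S = {i. F i (c, d) \<noteq> 0} \<union> {i. F i (e, f) \<noteq> 0} \<union>
    {i. F i (c, f) \<noteq> 0} \<union> {i. F i (e, d) \<noteq> 0}"
  have S: "finite S" unfolding S_def using assms by auto
  have "Sum_any (\<lambda>i. F i x) = (\<Sum>i\<in>S. F i x)" if "x \<in> {(c, d), (e, f), (c, f), (e, d)}" for x
    using that by (intro Sum_any.expand_superset S) (auto simp: S_def)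
  moreover have "Sum_any (\<lambda>i. dker L (F i) v w) = (\<Sum>i\<in>S. dker L (F i) v w)"
    by (intro Sum_any.expand_superset S) (auto simp: S_def dker_def vw)
  ultimately show ?thesis
    by (simp add: vw dker_def sum.distrib sum_distrib_left sum_distrib_right distrib_left)
qed

text \<open>The Jacobi terms of u with translates of v and w, both counted from u: a double series
  in which the three cyclic contributions can be matched term by term.\<close>

definition lift2 :: "int \<times> int \<Rightarrow> int \<times> int \<Rightarrow> int \<times> int \<Rightarrow> int \<times> int \<Rightarrow> real" where
  "lift2 u v w = (\<lambda>(i, j). dker L (ker L u) (trl i v) (trl j w))"

text \<open>Either v or w is within reach of u, and v and w are within reach of each other. The
  constant is generous; it serves only to make the support of \<open>lift2\<close> finite.\<close>

lemma dker_nonzero: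
  assumes "in_band u" "in_band v" "in_band w" "dker L (ker L u) v w \<noteq> 0"
  shows "\<bar>fst u - fst v\<bar> \<le> 3 * m + 2" "\<bar>fst u - fst w\<bar> \<le> 3 * m + 2"
proof -
  obtain c d e f where vw: "v = (c, d)" "w = (e, f)" by (metis surj_pair)
  have in_v: "c \<le> d" "d \<le> c + m" and in_w: "e \<le> f" "f \<le> e + m"
    using assms by (auto simp: in_band_def vw)
  note K = ker_in_band_nonzero[OF assms(1)]
  consider "dgn c d e f \<noteq> 0" "ker L u (c, d) \<noteq> 0 \<or> ker L u (e, f) \<noteq> 0"
    | "ker L u (c, f) \<noteq> 0" "L e d \<noteq> 0" | "ker L u (e, d) \<noteq> 0" "L c f \<noteq> 0"
    using assms(4) unfolding dker_def vw case_prod_conv by (metis add_0 mult_eq_0_iff)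
  then have "\<bar>fst u - c\<bar> \<le> 3 * m + 2 \<and> \<bar>fst u - e\<bar> \<le> 3 * m + 2"
  proof cases
    case 1
    have "e \<le> d"
      using 1(1) in_v in_w by (auto simp: dgn_def swp_def sgn_if split: if_splits)
    moreover have "c \<le> f"
      using 1(1) in_v in_w by (auto simp: dgn_def swp_def sgn_if split: if_splits)
    moreover have "\<bar>fst u - c\<bar> \<le> m + 1 \<or> \<bar>fst u - e\<bar> \<le> m + 1"
      using 1(2) K(2)[of "(c, d)"] K(2)[of "(e, f)"] by auto
    ultimately show ?thesis using in_v in_w m_nonneg by linarith
  next
    case 2
    have "e - 1 \<le> d" "d \<le> e + m" using 2(2) outside by force+
    moreover have "\<bar>fst u - c\<bar> \<le> m + 1" using K(2)[OF 2(1)] by simp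
    ultimately show ?thesis using in_v in_w m_nonneg by linarith
  next
    case 3
    have "c - 1 \<le> f" "f \<le> c + m" using 3(2) outside by force+
    moreover have "\<bar>fst u - e\<bar> \<le> m + 1" using K(2)[OF 3(1)] by simp
    ultimately show ?thesis using in_v in_w m_nonneg by linarith
  qed
  then show "\<bar>fst u - fst v\<bar> \<le> 3 * m + 2" "\<bar>fst u - fst w\<bar> \<le> 3 * m + 2"
    by (auto simp: vw)
qed

lemma lift2_support:
  assumes "in_band u" "in_band v" "in_band w"
  obtains R where "\<And>i j. lift2 u v w (i, j) \<noteq> 0 \<Longrightarrow> \<bar>i\<bar> \<le> R \<and> \<bar>j\<bar> \<le> R"
proof (rule that)
  fix i j assume "lift2 u v w (i, j) \<noteq> 0"
  then have nz: "dker L (ker L u) (trl i v) (trl j w) \<noteq> 0" by (simp add: lift2_def)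
  have "\<bar>i\<bar> \<le> \<bar>fst u - fst v\<bar> + (3 * m + 2)" "\<bar>j\<bar> \<le> \<bar>fst u - fst w\<bar> + (3 * m + 2)"
    using dker_nonzero[OF _ _ _ nz] assms near_bound
    by (cases v; cases w; force simp: trl_def in_band_def)+
  then show "\<bar>i\<bar> \<le> \<bar>fst u - fst v\<bar> + \<bar>fst u - fst w\<bar> + (3 * m + 2) \<and>
    \<bar>j\<bar> \<le> \<bar>fst u - fst v\<bar> + \<bar>fst u - fst w\<bar> + (3 * m + 2)" by linarith
qed

lemma lift2_finite:
  assumes "in_band u" "in_band v" "in_band w"
  shows "finite {p. lift2 u v w p \<noteq> 0}"
proof -
  obtain R where R: "\<And>i j. lift2 u v w (i, j) \<noteq> 0 \<Longrightarrow> \<bar>i\<bar> \<le> R \<and> \<bar>j\<bar> \<le> R"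
    using lift2_support[OF assms] by blast
  show ?thesis
    by (rule finite_subset[of _ "{- R..R} \<times> {- R..R}"]) (use R in force)+
qed

text \<open>On the left j counts the translate of w from v, and the index i hidden in
  \<open>pker u\<close> moves both. The bijection (j, i) to (i, i + j) counts both translates from u
  instead.\<close>

lemma Sum_dker_pker:
  assumes "in_band u" "in_band v" "in_band w"
  shows "Sum_any (\<lambda>j. dker L (pker u) v (trl j w)) = Sum_any (lift2 u v w)"
proof -
  obtain R where R: "\<And>i j. lift2 u v w (i, j) \<noteq> 0 \<Longrightarrow> \<bar>i\<bar> \<le> R \<and> \<bar>j\<bar> \<le> R"
    using lift2_support[OF assms] by blast
  define g where "g j i = lift2 u v w (i, i + j)" for i j
  have "dker L (pker u) v (trl j w) = Sum_any (\<lambda>i. g j i)" for j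
  proof -
    have "dker L (pker u) v (trl j w) = Sum_any (\<lambda>i. dker L (\<lambda>x. ker L u (trl i x)) v (trl j w))"
      unfolding pker_def by (rule dker_Sum_any) (rule finite_support[OF assms(1)])
    also have "\<dots> = Sum_any (\<lambda>i. g j i)"
      unfolding g_def lift2_def by (simp add: dker_trl)
    finally show ?thesis .
  qed
  then have "Sum_any (\<lambda>j. dker L (pker u) v (trl j w)) = Sum_any (\<lambda>j. Sum_any (\<lambda>i. g j i))" by simp
  also have "\<dots> = Sum_any (\<lambda>(j, i). g j i)"
  proof (rule Sum_any.cartesian_product)
    have "\<bar>i\<bar> \<le> R \<and> \<bar>j\<bar> \<le> 2 * R" if "g j i \<noteq> 0" for i j
      using R[of i "i + j"] that unfolding g_def by linarith
    then show "{j. \<exists>i. g j i \<noteq> 0} \<times> {i. \<exists>j. g j i \<noteq> 0} \<subseteq> {- (2 * R)..2 * R} \<times> {- R..R}"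
      by force
  qed simp
  also have "\<dots> = Sum_any (lift2 u v w)"
  proof (rule Sum_any.reindex_cong[symmetric])
    show "bij (\<lambda>(j :: int, i). (i, i + j))"
      by (rule bij_betw_byWitness[where f' = "\<lambda>(i, j). (j - i, i)"]) auto
  qed (auto simp: g_def)
  finally show ?thesis .
qed

text \<open>Translating all three entries by - j changes nothing and brings u back to its own
  position.\<close>

lemma lift2_cyclic:
  "lift2 v w u (i, j) = dker L (ker L (trl (- j) v)) (trl (i - j) w) u"
proof -
  have "ker L (trl (- j) v) = (\<lambda>x. ker L v (trl j x))"
    by (rule ext) (simp add: ker_trl_left)
  then show ?thesis
    using dker_trl[of "ker L v" j "trl (i - j) w" u] by (simp add: lift2_def)
qed

text \<open>After reindexing, all three series run over the same triples u, \<open>trl i v\<close>,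
  \<open>trl j w\<close>, and \<open>ker_jacobi\<close> holds for each triple.\<close>

theorem pker_jacobi:
  assumes "in_band u" "in_band v" "in_band w"
  shows "Sum_any (\<lambda>j. dker L (pker u) v (trl j w)) + Sum_any (\<lambda>j. dker L (pker v) w (trl j u))
    + Sum_any (\<lambda>j. dker L (pker w) u (trl j v)) = 0"
proof -
  have 2: "Sum_any (lift2 v w u) = Sum_any (\<lambda>(i, j). dker L (ker L (trl i v)) (trl j w) u)"
  proof (rule Sum_any.reindex_cong)
    show "bij (\<lambda>(i :: int, j). (j - i, - i))"
      by (rule bij_betw_byWitness[where f' = "\<lambda>(i, j). (- j, i - j)"]) auto
    show "lift2 v w u \<circ> (\<lambda>(i, j). (j - i, - i)) = (\<lambda>(i, j). dker L (ker L (trl i v)) (trl j w) u)"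
      by (auto simp: lift2_cyclic)
  qed
  have 3: "Sum_any (lift2 w u v) = Sum_any (\<lambda>(i, j). dker L (ker L (trl j w)) u (trl i v))"
  proof (rule Sum_any.reindex_cong)
    show "bij (\<lambda>(i :: int, j). (- j, i - j))"
      by (rule bij_betw_byWitness[where f' = "\<lambda>(i, j). (j - i, - i)"]) auto
    show "lift2 w u v \<circ> (\<lambda>(i, j). (- j, i - j)) = (\<lambda>(i, j). dker L (ker L (trl j w)) u (trl i v))"
    proof (rule ext, clarify)
      fix i j
      have "ker L (trl j w) = (\<lambda>x. ker L w (trl (- j) x))"
        by (rule ext) (simp add: ker_trl_left)
      then have "dker L (ker L (trl j w)) u (trl i v) = dker L (ker L w) (trl (- j) u) (trl (- j) (trl i v))"
        by (simp add: dker_trl del: trl_trl)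
      then show "(lift2 w u v \<circ> (\<lambda>(i, j). (- j, i - j))) (i, j) = dker L (ker L (trl j w)) u (trl i v)"
        by (simp add: lift2_def)
    qed
  qed
  have f2: "finite {p. (case p of (i, j) \<Rightarrow> dker L (ker L (trl i v)) (trl j w) u) \<noteq> 0}"
  proof (rule finite_subset)
    show "{p. (case p of (i, j) \<Rightarrow> dker L (ker L (trl i v)) (trl j w) u) \<noteq> 0}
        \<subseteq> (\<lambda>(i, j). (- j, i - j)) ` {p. lift2 v w u p \<noteq> 0}"
    proof clarify
      fix i j assume "dker L (ker L (trl i v)) (trl j w) u \<noteq> 0"
      then show "(i, j) \<in> (\<lambda>(i, j). (- j, i - j)) ` {p. lift2 v w u p \<noteq> 0}"
        by (intro image_eqI[of _ _ "(j - i, - i)"]) (auto simp: lift2_cyclic)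
    qed
  qed (use lift2_finite assms in blast)
  \<comment> \<open>With the third term alone on the right, additivity of \<open>Sum_any\<close> is
    applied to just two families of finite support.\<close>
  have J: "lift2 u v w p + (case p of (i, j) \<Rightarrow> dker L (ker L (trl i v)) (trl j w) u)
      = - (case p of (i, j) \<Rightarrow> dker L (ker L (trl j w)) u (trl i v))" for p
    using ker_jacobi[of L u "trl (fst p) v" "trl (snd p) w"] by (cases p) (simp add: lift2_def)
  have "Sum_any (lift2 u v w) + Sum_any (lift2 v w u)
      = Sum_any (\<lambda>p. lift2 u v w p + (case p of (i, j) \<Rightarrow> dker L (ker L (trl i v)) (trl j w) u))"
    unfolding 2 by (rule Sum_any.distrib[symmetric]) (use lift2_finite assms f2 in auto)
  also have "\<dots> = Sum_any (\<lambda>p. - (case p of (i, j) \<Rightarrow> dker L (ker L (trl j w)) u (trl i v)))"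
    by (simp only: J)
  also have "\<dots> = - Sum_any (lift2 w u v)"
    unfolding 3 by (simp add: Sum_any.expand_set sum_negf)
  finally show ?thesis by (simp add: Sum_dker_pker assms)
qed

end

section \<open>The coordinate brackets as periodic sums\<close>

lemma off_less: "N > 0 \<Longrightarrow> off N k l < N"
  by (simp add: off_def)

lemma off_cases:
  assumes "k < N" "l < N"
  shows "off N k l = (if k \<le> l then l - k else l + N - k)"
proof (cases "k \<le> l")
  case True
  then have "(l + N - k) mod N = (l - k + N) mod N" by simp
  then show ?thesis using assms True by (simp only: off_def mod_add_self2) simp
next
  case False
  then show ?thesis using assms by (simp add: off_def)
qed

lemma off_swap:
  assumes "k < N" "l < N" "off N k l > 0"
  shows "off N l k = N - off N k l"
  using assms by (auto simp: off_cases split: if_splits)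

text \<open>\<open>swp\<close> for the entries (k, k + p) and (k + d, k + d + q) with d \<ge> 0. In
  \<open>dgf\<close> the second indicator of \<open>dgn\<close> has disappeared, because k + d + q
  is never below k.\<close>

definition swf :: "nat \<Rightarrow> nat \<Rightarrow> nat \<Rightarrow> real" where
  "swf p q d = (if d = 0 then 0 else - 1 / 2) + (if p < d + q then - 1 / 2 else if p = d + q then 0 else 1 / 2)"

definition dgf :: "nat \<Rightarrow> nat \<Rightarrow> nat \<Rightarrow> real" where
  "dgf p q d = swf p q d + of_bool (p < d)"

text \<open>\<open>ker\<close> for such a pair. The exchanged entry (k + d, k + p) has order p - d;
  at d = p + 1 it lies on the lower diagonal and has the constant value \<beta>, and beyond that it
  is 0.\<close>

definition fwd :: "(nat \<Rightarrow> nat \<Rightarrow> real) \<Rightarrow> real \<Rightarrow> nat \<Rightarrow> nat \<times> nat \<Rightarrow> nat \<times> nat \<Rightarrow> real" where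
  "fwd A \<beta> N = (\<lambda>(p, k) (q, l). let d = off N k l in
     dgf p q d * A p k * A q l
     + swf p q d * A (q + d) k * (if d \<le> p then A (p - d) l else if d = Suc p then \<beta> else 0))"

text \<open>The rules list a bracket only in the direction of the nonnegative offset; at offset 0 both
  directions qualify, and only the one with \<open>p < q\<close> is listed.\<close>

definition hfwd :: "(nat \<Rightarrow> nat \<Rightarrow> real) \<Rightarrow> real \<Rightarrow> nat \<Rightarrow> nat \<times> nat \<Rightarrow> nat \<times> nat \<Rightarrow> real" where
  "hfwd A \<beta> N = (\<lambda>(p, k) (q, l). if off N k l = 0 \<and> q \<le> p then 0 else fwd A \<beta> N (p, k) (q, l))"

definition lat :: "(nat \<Rightarrow> nat \<Rightarrow> real) \<Rightarrow> real \<Rightarrow> nat \<Rightarrow> nat \<Rightarrow> int \<Rightarrow> int \<Rightarrow> real" where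
  "lat A \<beta> m N a b = (if b = a - 1 then \<beta>
     else if a \<le> b \<and> b \<le> a + int m then A (nat (b - a)) (nat (a mod int N)) else 0)"

definition lft :: "nat \<times> nat \<Rightarrow> int \<times> int" where
  "lft = (\<lambda>(p, k). (int k, int k + int p))"

lemma band_lat: "N > 0 \<Longrightarrow> band (lat A \<beta> m N) (int N) (int m)"
  by unfold_locales (auto simp: lat_def)

lemma ker_lat:
  assumes "\<And>j k. j > m \<Longrightarrow> A j k = 0" "p \<le> m" "q \<le> m" "k < N" "l < N"
    and "d = off N k l"
  shows "ker (lat A \<beta> m N) (int k, int k + int p) (int k + int d, int k + int d + int q)
    = fwd A \<beta> N (p, k) (q, l)"
proof -
  let ?L = "lat A \<beta> m N"
  have kd: "(int k + int d) mod int N = int l"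
    using assms(4-6) by (auto simp: off_cases of_nat_diff)
  have 1: "?L (int k) (int k + int p) = A p k" "?L (int k + int d) (int k + int d + int q) = A q l"
    using assms kd by (auto simp: lat_def)
  \<comment> \<open>The order q + d may exceed m; \<open>A\<close> vanishes there, as
    \<open>lat\<close> does above the band.\<close>
  have 2: "?L (int k) (int k + int d + int q) = A (q + d) k"
    using assms by (auto simp: lat_def nat_add_distrib add.commute)
  have 3: "?L (int k + int d) (int k + int p) = (if d \<le> p then A (p - d) l else if d = Suc p then \<beta> else 0)"
    using assms(1-3) kd by (auto simp: lat_def nat_diff_distrib)
  have 4: "swp (int k) (int k + int p) (int k + int d) (int k + int d + int q) = swf p q d"
    by (auto simp: swp_def swf_def sgn_if)
  have 5: "dgn (int k) (int k + int p) (int k + int d) (int k + int d + int q) = dgf p q d"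
    unfolding dgn_def 4 dgf_def by auto
  show ?thesis
    unfolding ker_def case_prod_conv 1 2 3 4 5 fwd_def Let_def assms(6)[symmetric] by simp
qed

text \<open>At most two translates of the second entry lie within the reach m + 1 < N of the first:
  the one at offset d to the right and, for d > 0, the one at offset N - d to the left. By skew
  symmetry the latter is the forward term of the reversed pair.\<close>

lemma pker_lat:
  assumes A: "\<And>j k. j > m \<Longrightarrow> A j k = 0" and "p \<le> m" "q \<le> m" "k < N" "l < N" "N \<ge> 2 * m + 2"
  shows "band.pker (lat A \<beta> m N) (int N) (lft (p, k)) (lft (q, l))
    = hfwd A \<beta> N (p, k) (q, l) - hfwd A \<beta> N (q, l) (p, k)"
proof -
  interpret band "lat A \<beta> m N" "int N" "int m"
    using assms by (intro band_lat) auto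
  let ?L = "lat A \<beta> m N"
  define d where "d = off N k l"
  have dN: "d < N" unfolding d_def using assms by (intro off_less) auto
  \<comment> \<open>The number of periods that carries l to its representative at distance d to the
    right of k.\<close>
  define n0 :: int where "n0 = (if k \<le> l then 0 else 1)"
  have n0: "int k + int d = int l + n0 * int N"
    using assms by (auto simp: n0_def d_def off_cases of_nat_diff)
  have in_band: "in_band (lft (p, k))" "in_band (lft (q, l))"
    using assms by (auto simp: in_band_def lft_def)
  have first: "ker ?L (lft (p, k)) (trl n0 (lft (q, l))) = fwd A \<beta> N (p, k) (q, l)"
  proof -
    have "trl n0 (lft (q, l)) = (int k + int d, int k + int d + int q)"
      using n0 by (simp add: trl_def lft_def)
    then show ?thesis
      using ker_lat[of m A p q k N l d \<beta>, OF A assms(2-5) d_def] by (simp add: lft_def)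
  qed
  have zero: "ker ?L (lft (p, k)) (trl n (lft (q, l))) = 0" if "n \<noteq> n0" "n \<noteq> n0 - 1 \<or> d = 0" for n
  proof (rule ccontr)
    assume "ker ?L (lft (p, k)) (trl n (lft (q, l))) \<noteq> 0"
    then have "\<bar>int k - (int l + n * int N)\<bar> \<le> int m + 1"
      using ker_in_band_nonzero(2)[OF in_band(1), of "trl n (lft (q, l))"] by (simp add: trl_def lft_def)
    then have "\<bar>int d + (n - n0) * int N\<bar> < int N" using n0 assms(6) by (simp add: algebra_simps)
    moreover have "(n - n0) * int N \<ge> 1 * int N \<or> (n - n0) * int N \<le> (- 2) * int N
        \<or> d = 0 \<and> (n - n0) * int N \<le> (- 1) * int N"
    proof -
      have "n - n0 \<ge> 1 \<or> n - n0 \<le> - 2 \<or> d = 0 \<and> n - n0 \<le> - 1"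
        using that by arith
      then consider "n - n0 \<ge> 1" | "n - n0 \<le> - 2" | "d = 0" "n - n0 \<le> - 1"
        by blast
      then show ?thesis
        by cases (use mult_right_mono[of 1 "n - n0" "int N"] mult_right_mono[of "n - n0" "- 2" "int N"]
          mult_right_mono[of "n - n0" "- 1" "int N"] in auto)
    qed
    ultimately show False using dN by linarith
  qed
  have second: "ker ?L (lft (p, k)) (trl (n0 - 1) (lft (q, l))) = - fwd A \<beta> N (q, l) (p, k)" if "d > 0"
  proof -
    have "ker ?L (lft (p, k)) (trl (n0 - 1) (lft (q, l)))
        = - ker ?L (lft (q, l)) (trl (1 - n0) (lft (p, k)))"
      by (subst ker_skew) (simp add: ker_trl_left)
    moreover have "int l + int (off N l k) = int k + (1 - n0) * int N"
      using off_swap[of k N l] that n0 dN assms by (simp add: d_def of_nat_diff algebra_simps)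
    then have "trl (1 - n0) (lft (p, k)) = (int l + int (off N l k), int l + int (off N l k) + int p)"
      by (simp add: trl_def lft_def)
    ultimately show ?thesis
      using ker_lat[of m A q p l N k _ \<beta>, OF A assms(3,2,5,4) refl] by (simp add: lft_def)
  qed
  have "pker (lft (p, k)) (lft (q, l))
      = (\<Sum>n\<in>{n0, n0 - 1}. ker ?L (lft (p, k)) (trl n (lft (q, l))))"
    unfolding pker_def using zero by (intro Sum_any.expand_superset) auto
  also have "\<dots> = fwd A \<beta> N (p, k) (q, l) + (if d = 0 then 0 else - fwd A \<beta> N (q, l) (p, k))"
    using zero[of "n0 - 1"] first second by simp
  also have "\<dots> = hfwd A \<beta> N (p, k) (q, l) - hfwd A \<beta> N (q, l) (p, k)"
  proof (cases "d = 0")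
    case False
    then have "off N l k \<noteq> 0" using off_swap[of k N l] assms dN by (simp add: d_def)
    then show ?thesis using False by (simp add: hfwd_def d_def)
  next
    case True
    then have kl: "k = l" using assms by (auto simp: d_def off_cases split: if_splits)
    have off0: "off N l l = 0" using assms by (simp add: off_cases)
    \<comment> \<open>For entries with a common left end the forward formula is itself skew, so
      keeping only p < q in \<open>hfwd\<close> counts the single translate exactly once.\<close>
    have "fwd A \<beta> N (q, l) (p, l) = - fwd A \<beta> N (p, l) (q, l)"
      by (auto simp: fwd_def off0 dgf_def swf_def)
    moreover from this have "p = q \<Longrightarrow> fwd A \<beta> N (p, l) (q, l) = 0" by simp
    ultimately show ?thesis using True by (auto simp: hfwd_def kl off0)
  qed
  finally show ?thesis .
qed

definition oval :: "real option \<Rightarrow> real" where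
  "oval z = (case z of Some c \<Rightarrow> c | None \<Rightarrow> 0)"

lemma oval_simps [simp]: "oval None = 0" "oval (Some c) = c"
  by (simp_all add: oval_def)

lemma skewify_oval:
  assumes "r x u v = None \<or> r x v u = None \<or> oval (r x u v) = 0 \<and> oval (r x v u) = 0"
  shows "skewify r x u v = oval (r x u v) - oval (r x v u)"
  using assms by (auto simp: skewify_def oval_def split: option.splits)

lemma rule_far:
  assumes "d = off N k l" "p \<le> m" "q \<le> m"
  shows "rule1 \<alpha> m N x (p, k) (q, l) \<noteq> None \<Longrightarrow> d \<le> Suc p \<and> (d = Suc m \<longrightarrow> oval (rule1 \<alpha> m N x (p, k) (q, l)) = 0)"
    and "rule2 m N x (p, k) (q, l) \<noteq> None \<Longrightarrow> d \<le> Suc p \<and> (d = Suc m \<longrightarrow> oval (rule2 m N x (p, k) (q, l)) = 0)"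
    and "rule2a \<alpha> m N x (p, k) (q, l) \<noteq> None \<Longrightarrow> d \<le> p"
  using assms(2,3) unfolding rule1.simps rule2.simps rule2a.simps Let_def assms(1)[symmetric]
  by (auto simp: co_def split: if_splits)

lemma rule_same:
  assumes "off N k l = 0" "off N l k = 0"
  shows "rule1 \<alpha> m N x (p, k) (q, l) = None \<or> rule1 \<alpha> m N x (q, l) (p, k) = None"
    and "rule2 m N x (p, k) (q, l) = None \<or> rule2 m N x (q, l) (p, k) = None"
    and "rule2a \<alpha> m N x (p, k) (q, l) = None \<or> rule2a \<alpha> m N x (q, l) (p, k) = None"
  unfolding rule1.simps rule2.simps rule2a.simps Let_def assms
  by (auto split: if_splits)

text \<open>A rule reaches no offset beyond m + 1. For distinct positions the two offsets add up to
  N \<ge> 2 * m + 2, so both directions can be listed only if both offsets equal m + 1, and there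
  the listed values contain a coordinate of order above m and are 0.\<close>

lemma PB_oval:
  assumes "p \<le> m" "q \<le> m" "k < N" "l < N" "N \<ge> 2 * m + 2"
  shows "PB1 \<alpha> m N x (p, k) (q, l) = oval (rule1 \<alpha> m N x (p, k) (q, l)) - oval (rule1 \<alpha> m N x (q, l) (p, k))"
    and "PB2 m N x (p, k) (q, l) = oval (rule2 m N x (p, k) (q, l)) - oval (rule2 m N x (q, l) (p, k))"
    and "PB2a \<alpha> m N x (p, k) (q, l) = oval (rule2a \<alpha> m N x (p, k) (q, l)) - oval (rule2a \<alpha> m N x (q, l) (p, k))"
proof -
  have *: "off N k l = 0 \<and> off N l k = 0 \<or> off N k l + off N l k \<ge> 2 * m + 2"
  proof (cases "k = l")
    case True
    then show ?thesis using assms by (simp add: off_cases)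
  next
    case False
    then have "off N k l + off N l k = N" using assms by (auto simp: off_cases)
    then show ?thesis using assms by simp
  qed
  show "PB1 \<alpha> m N x (p, k) (q, l) = oval (rule1 \<alpha> m N x (p, k) (q, l)) - oval (rule1 \<alpha> m N x (q, l) (p, k))"
    unfolding PB1_def using * rule_same(1)[of N k l \<alpha> m x p q]
      rule_far(1)[OF refl assms(1,2), of \<alpha> N x k l] rule_far(1)[OF refl assms(2,1), of \<alpha> N x l k] assms(1,2)
    by (intro skewify_oval) linarith
  show "PB2 m N x (p, k) (q, l) = oval (rule2 m N x (p, k) (q, l)) - oval (rule2 m N x (q, l) (p, k))"
    unfolding PB2_def using * rule_same(2)[of N k l m x p q]
      rule_far(2)[OF refl assms(1,2), of N x k l] rule_far(2)[OF refl assms(2,1), of N x l k] assms(1,2)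
    by (intro skewify_oval) linarith
  show "PB2a \<alpha> m N x (p, k) (q, l) = oval (rule2a \<alpha> m N x (p, k) (q, l)) - oval (rule2a \<alpha> m N x (q, l) (p, k))"
    unfolding PB2a_def using * rule_same(3)[of N k l \<alpha> m x p q]
      rule_far(3)[OF refl assms(1,2), of \<alpha> N x k l] rule_far(3)[OF refl assms(2,1), of \<alpha> N x l k] assms(1,2)
    by (intro skewify_oval) linarith
qed

definition shifted :: "nat \<Rightarrow> nat \<Rightarrow> real \<Rightarrow> pt \<Rightarrow> nat \<Rightarrow> nat \<Rightarrow> real" where
  "shifted m N \<gamma> x p k = co m N x p k + (if p = 0 then \<gamma> else 0)"

lemma shifted_simps:
  "p > 0 \<Longrightarrow> shifted m N \<gamma> x p k = co m N x p k"
  "shifted m N \<gamma> x 0 k = co m N x 0 k + \<gamma>"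
  by (auto simp: shifted_def)

text \<open>The positions of the intervals [k, k + p] and [k + d, k + d + q]: second one strictly
  inside, common right end, overlapping, second one beyond the first, common left end.\<close>

lemma swf_dgf_cases:
  "0 < d \<Longrightarrow> d + q < p \<Longrightarrow> swf p q d = 0 \<and> dgf p q d = 0"
  "0 < d \<Longrightarrow> d + q = p \<Longrightarrow> swf p q d = - 1 / 2 \<and> dgf p q d = - 1 / 2"
  "0 < d \<Longrightarrow> d + q > p \<Longrightarrow> d \<le> p \<Longrightarrow> swf p q d = - 1 \<and> dgf p q d = - 1"
  "d > p \<Longrightarrow> swf p q d = - 1 \<and> dgf p q d = 0"
  "p < q \<Longrightarrow> swf p q 0 = - 1 / 2 \<and> dgf p q 0 = - 1 / 2"
  by (auto simp: dgf_def swf_def)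

text \<open>The shift \<gamma> enters wherever a direct or exchanged entry is diagonal, and yields
  the terms of the first bracket without \<alpha>. Its terms with \<alpha> sit at d = p + 1, where
  the lower diagonal 1 + \<gamma> * \<alpha> joins them to those of the second bracket.\<close>

lemma rule_hfwd:
  assumes "p \<le> m" "q \<le> m" "k < N" "l < N"
  shows "oval (rule2 m N x (p, k) (q, l)) + \<gamma> * oval (rule1 \<alpha> m N x (p, k) (q, l))
    = hfwd (shifted m N \<gamma> x) (1 + \<gamma> * \<alpha>) N (p, k) (q, l)"
proof -
  define d where "d = off N k l"
  note unf = rule1.simps rule2.simps Let_def d_def[symmetric] hfwd_def fwd_def case_prod_conv
  consider "d = 0" "q \<le> p" | "d = 0" "p < q" | "0 < d" "d + q < p" | "0 < d" "d + q = p"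
    | "0 < d" "d \<le> p" "d + q > p" | "d = Suc p" | "d > Suc p"
    by linarith
  then show ?thesis
  proof cases
    case 1
    then show ?thesis unfolding unf by simp
  next
    case 2
    then have "k = l" using assms by (auto simp: d_def off_cases split: if_splits)
    then show ?thesis using 2 swf_dgf_cases(5)[of p q] unfolding unf
      by (simp add: shifted_simps algebra_simps)
  next
    case 3
    then have "\<not> p - q + 1 \<le> d" "d \<noteq> p - q" by auto
    then show ?thesis using 3 swf_dgf_cases(1)[of d q p] unfolding unf by simp
  next
    case 4
    then have p: "p = d + q" by simp
    show ?thesis using 4(1) swf_dgf_cases(2)[of d q "d + q"] unfolding unf unfolding p
      by (cases "q = 0") (simp_all add: shifted_simps algebra_simps)
  next
    case 5
    then have "p - q + 1 \<le> d" by auto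
    then show ?thesis using 5 swf_dgf_cases(3)[of d p q] unfolding unf
      by (cases "p \<le> q"; cases "d = p") (simp_all add: shifted_simps algebra_simps)
  next
    case 6
    then show ?thesis using swf_dgf_cases(4)[of p d q] unfolding unf
      by (cases "p = 0"; cases "q = 0") (simp_all add: shifted_simps algebra_simps)
  next
    case 7
    then have "d \<noteq> p - q" by auto
    then show ?thesis using 7 swf_dgf_cases(4)[of p d q] unfolding unf
      by simp
  qed
qed

text \<open>The constant diagonal of \<open>C\<close> supplies the linear term at d = p. The summand
  with \<open>dgf\<close> reverses the sign of the product term; it is the contribution expected
  from the brackets of the scaling factors.\<close>

lemma rule2a_hfwd:
  assumes "1 \<le> p" "1 \<le> q" "p \<le> m" "q \<le> m" "k < N" "l < N" "\<alpha> \<noteq> 0"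
    and C: "C = (\<lambda>j k. if j = 0 then - 1 / \<alpha> else co m N y j k)" and d: "d = off N k l"
  shows "oval (rule2a \<alpha> m N y (p, k) (q, l))
    = (if d = 0 then 0 else 2 * \<alpha> * dgf p q d * C p k * C q l - \<alpha> * hfwd C 0 N (p, k) (q, l))"
proof -
  note unf = rule2a.simps Let_def d[symmetric] hfwd_def fwd_def case_prod_conv
  consider "d = 0" | "0 < d" "d + q < p" | "0 < d" "d + q = p"
    | "0 < d" "d \<le> p" "d + q > p" | "d > p"
    by linarith
  then show ?thesis
  proof cases
    case 1
    then show ?thesis unfolding unf using assms by simp
  next
    case 2
    then have "\<not> p - q + 1 \<le> d" by auto
    then show ?thesis unfolding unf using 2 swf_dgf_cases(1)[of d q p] assms(1,2) by simp
  next
    case 3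
    then have p: "p = d + q" by simp
    show ?thesis unfolding unf unfolding p using 3(1) swf_dgf_cases(2)[of d q "d + q"] assms(1,2)
      by (simp add: C add.commute)
  next
    case 4
    then have "p - q + 1 \<le> d" by auto
    then show ?thesis unfolding unf using 4 swf_dgf_cases(3)[of d p q] assms(1,2,7)
      by (cases "p \<le> q"; cases "d = p") (simp_all add: C algebra_simps)
  next
    case 5
    then show ?thesis unfolding unf using swf_dgf_cases(4)[of p d q] assms(1,2)
      by simp_all
  qed
qed

lemma PB_pencil_hfwd:
  assumes "p \<le> m" "q \<le> m" "k < N" "l < N" "N \<ge> 2 * m + 2"
  shows "PB2 m N x (p, k) (q, l) + \<gamma> * PB1 \<alpha> m N x (p, k) (q, l)
    = hfwd (shifted m N \<gamma> x) (1 + \<gamma> * \<alpha>) N (p, k) (q, l)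
      - hfwd (shifted m N \<gamma> x) (1 + \<gamma> * \<alpha>) N (q, l) (p, k)"
  unfolding PB_oval[OF assms] rule_hfwd[OF assms(1-4), symmetric] rule_hfwd[OF assms(2,1,4,3), symmetric]
  by (simp add: algebra_simps)

section \<open>Poisson brackets of rational functions\<close>

text \<open>Openness along coordinate lines is all that partial derivatives see. The domain is not
  open in the function space, because all labels outside the index set are pinned to 0.\<close>

definition copen :: "(nat \<times> nat) set \<Rightarrow> pt set \<Rightarrow> bool" where
  "copen I D \<longleftrightarrow> (\<forall>x\<in>D. \<forall>z\<in>I. \<forall>\<^sub>F t in nhds (x z). x(z := t) \<in> D)"

text \<open>Functions count only up to their values on \<open>D\<close>, because a push-forward is junk outside the
  image of the map.  Closure under \<open>pd\<close> lets the Jacobi identity spread from the coordinates by the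
  Leibniz rule, without second derivatives.\<close>

inductive_set ratfun :: "(nat \<times> nat) set \<Rightarrow> pt set \<Rightarrow> (pt \<Rightarrow> real) set"
  for I D where
  const: "(\<lambda>x. c) \<in> ratfun I D"
| coord: "u \<in> I \<Longrightarrow> (\<lambda>x. x u) \<in> ratfun I D"
| add: "F \<in> ratfun I D \<Longrightarrow> G \<in> ratfun I D \<Longrightarrow> (\<lambda>x. F x + G x) \<in> ratfun I D"
| mult: "F \<in> ratfun I D \<Longrightarrow> G \<in> ratfun I D \<Longrightarrow> (\<lambda>x. F x * G x) \<in> ratfun I D"
| inverse: "F \<in> ratfun I D \<Longrightarrow> (\<And>x. x \<in> D \<Longrightarrow> F x \<noteq> 0) \<Longrightarrow> (\<lambda>x. inverse (F x)) \<in> ratfun I D"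
| cong: "F \<in> ratfun I D \<Longrightarrow> (\<And>x. x \<in> D \<Longrightarrow> G x = F x) \<Longrightarrow> G \<in> ratfun I D"

lemma ratfun_uminus: "F \<in> ratfun I D \<Longrightarrow> (\<lambda>x. - F x) \<in> ratfun I D"
  using ratfun.mult[OF ratfun.const[of "- 1"], of F I D] by simp

lemma ratfun_diff: "F \<in> ratfun I D \<Longrightarrow> G \<in> ratfun I D \<Longrightarrow> (\<lambda>x. F x - G x) \<in> ratfun I D"
  using ratfun.add[OF _ ratfun_uminus, of F I D G] by simp

lemma ratfun_divide:
  "F \<in> ratfun I D \<Longrightarrow> G \<in> ratfun I D \<Longrightarrow> (\<And>x. x \<in> D \<Longrightarrow> G x \<noteq> 0) \<Longrightarrow> (\<lambda>x. F x / G x) \<in> ratfun I D"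
  using ratfun.mult[OF _ ratfun.inverse, of F I D G] by (simp add: divide_inverse)

lemma ratfun_sum: "(\<And>i. i \<in> S \<Longrightarrow> F i \<in> ratfun I D) \<Longrightarrow> (\<lambda>x. \<Sum>i\<in>S. F i x) \<in> ratfun I D"
  by (induction S rule: infinite_finite_induct) (auto intro: ratfun.intros(1,3))

lemma ratfun_prod: "(\<And>i. i \<in> S \<Longrightarrow> F i \<in> ratfun I D) \<Longrightarrow> (\<lambda>x. \<Prod>i\<in>S. F i x) \<in> ratfun I D"
  by (induction S rule: infinite_finite_induct) (auto intro: ratfun.intros(1,4))

lemma ratfun_compose:
  assumes "F \<in> ratfun I D'" "\<And>u. u \<in> I \<Longrightarrow> (\<lambda>x. B x u) \<in> ratfun I D" "\<And>x. x \<in> D \<Longrightarrow> B x \<in> D'"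
  shows "(\<lambda>x. F (B x)) \<in> ratfun I D"
  using assms(1)
proof induction
  case (cong F G)
  then show ?case using assms(3) by (auto intro: ratfun.cong)
qed (use assms in \<open>auto intro: ratfun.intros(1-5)\<close>)

lemma copen_eventually_eq:
  assumes "copen I D" "x \<in> D" "z \<in> I" "\<And>y. y \<in> D \<Longrightarrow> F y = G y"
  shows "\<forall>\<^sub>F t in nhds (x z). F (x(z := t)) = G (x(z := t))"
proof (rule eventually_mono)
  show "\<forall>\<^sub>F t in nhds (x z). x(z := t) \<in> D" using assms(1-3) unfolding copen_def by blast
qed (rule assms(4))

lemma pd_cong:
  assumes "copen I D" "x \<in> D" "z \<in> I" "\<And>y. y \<in> D \<Longrightarrow> F y = G y"
  shows "pd F z x = pd G z x"
  unfolding pd_def by (rule deriv_cong_ev[OF copen_eventually_eq[OF assms] refl])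

text \<open>For each label one rational \<open>G z\<close> serves all points of \<open>D\<close>, so
  the partial derivative is again a function that can be bracketed.\<close>

lemma ratfun_has_derivative:
  assumes "copen I D" "F \<in> ratfun I D"
  shows "\<exists>G. \<forall>z\<in>I. G z \<in> ratfun I D \<and>
    (\<forall>x\<in>D. ((\<lambda>t. F (x(z := t))) has_field_derivative G z x) (at (x z)))"
  using assms(2)
proof induction
  case (const c)
  then show ?case by (intro exI[of _ "\<lambda>z x. 0"]) (auto intro: ratfun.const)
next
  case (coord u)
  show ?case
    by (intro exI[of _ "\<lambda>z x. of_bool (z = u)"]) (auto intro: ratfun.const)
next
  case (add F G)
  then obtain F' G' where "\<forall>z\<in>I. F' z \<in> ratfun I D \<and> (\<forall>x\<in>D. ((\<lambda>t. F (x(z := t))) has_field_derivative F' z x) (at (x z)))"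
    "\<forall>z\<in>I. G' z \<in> ratfun I D \<and> (\<forall>x\<in>D. ((\<lambda>t. G (x(z := t))) has_field_derivative G' z x) (at (x z)))"
    by blast
  then have "\<forall>z\<in>I. (\<lambda>x. F' z x + G' z x) \<in> ratfun I D \<and>
    (\<forall>x\<in>D. ((\<lambda>t. F (x(z := t)) + G (x(z := t))) has_field_derivative F' z x + G' z x) (at (x z)))"
    by (intro ballI conjI ratfun.add DERIV_add) blast+
  then show ?case by (intro exI[of _ "\<lambda>z x. F' z x + G' z x"])
next
  case (mult F G)
  then obtain F' G' where *: "\<forall>z\<in>I. F' z \<in> ratfun I D \<and> (\<forall>x\<in>D. ((\<lambda>t. F (x(z := t))) has_field_derivative F' z x) (at (x z)))"
    "\<forall>z\<in>I. G' z \<in> ratfun I D \<and> (\<forall>x\<in>D. ((\<lambda>t. G (x(z := t))) has_field_derivative G' z x) (at (x z)))"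
    by blast
  have "((\<lambda>t. F (x(z := t)) * G (x(z := t))) has_field_derivative F' z x * G x + F x * G' z x) (at (x z))"
    if "z \<in> I" "x \<in> D" for z x
    using DERIV_mult[of "\<lambda>t. F (x(z := t))" "F' z x" "x z" UNIV "\<lambda>t. G (x(z := t))" "G' z x"] * that
    by (simp add: mult.commute add.commute)
  moreover have "(\<lambda>x. F' z x * G x + F x * G' z x) \<in> ratfun I D" if "z \<in> I" for z
    using * mult.hyps that by (intro ratfun.add ratfun.mult) blast+
  ultimately show ?case by (intro exI[of _ "\<lambda>z x. F' z x * G x + F x * G' z x"]) blast
next
  case (inverse F)
  then obtain F' where *: "\<forall>z\<in>I. F' z \<in> ratfun I D \<and> (\<forall>x\<in>D. ((\<lambda>t. F (x(z := t))) has_field_derivative F' z x) (at (x z)))"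
    by blast
  have "((\<lambda>t. inverse (F (x(z := t)))) has_field_derivative - (F' z x * (inverse (F x) * inverse (F x)))) (at (x z))"
    if "z \<in> I" "x \<in> D" for z x
    using DERIV_inverse_fun[of "\<lambda>t. F (x(z := t))" "F' z x" "x z" UNIV] * that inverse.hyps
    by (simp add: power2_eq_square)
  moreover have "(\<lambda>x. - (F' z x * (inverse (F x) * inverse (F x)))) \<in> ratfun I D" if "z \<in> I" for z
    using * inverse.hyps that by (intro ratfun_uminus ratfun.mult ratfun.inverse) blast+
  ultimately show ?case
    by (intro exI[of _ "\<lambda>z x. - (F' z x * (inverse (F x) * inverse (F x)))"]) blast
next
  case (cong F G)
  then obtain F' where *: "\<forall>z\<in>I. F' z \<in> ratfun I D \<and> (\<forall>x\<in>D. ((\<lambda>t. F (x(z := t))) has_field_derivative F' z x) (at (x z)))"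
    by blast
  have "((\<lambda>t. G (x(z := t))) has_field_derivative F' z x) (at (x z))" if "z \<in> I" "x \<in> D" for z x
  proof -
    have ev: "\<forall>\<^sub>F t in nhds (x z). F (x(z := t)) = G (x(z := t))"
      using copen_eventually_eq[OF assms(1) that(2,1), of F G] cong.hyps(2) by simp
    have "((\<lambda>t. F (x(z := t))) has_field_derivative F' z x) (at (x z))"
      using * that by blast
    then show ?thesis using DERIV_cong_ev[OF refl ev refl] by blast
  qed
  then show ?case using * by blast
qed

lemma ratfun_deriv:
  assumes "copen I D" "F \<in> ratfun I D" "z \<in> I" "x \<in> D"
  shows "((\<lambda>t. F (x(z := t))) has_field_derivative pd F z x) (at (x z))"
proof -
  obtain G where "((\<lambda>t. F (x(z := t))) has_field_derivative G z x) (at (x z))"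
    using ratfun_has_derivative[OF assms(1,2)] assms(3,4) by blast
  then show ?thesis unfolding pd_def by (simp add: DERIV_imp_deriv)
qed

lemma ratfun_pd:
  assumes "copen I D" "F \<in> ratfun I D" "z \<in> I"
  shows "pd F z \<in> ratfun I D"
proof -
  obtain G where "G \<in> ratfun I D" "\<forall>x\<in>D. ((\<lambda>t. F (x(z := t))) has_field_derivative G x) (at (x z))"
    using ratfun_has_derivative[OF assms(1,2)] assms(3) by blast
  then have "G \<in> ratfun I D" "\<And>x. x \<in> D \<Longrightarrow> pd F z x = G x"
    unfolding pd_def by (blast intro: DERIV_imp_deriv)+
  then show ?thesis by (rule ratfun.cong)
qed

lemma pd_const [simp]: "pd (\<lambda>x. c) z x = 0"
  by (simp add: pd_def)

lemma pd_coord [simp]: "pd (\<lambda>x. x u) z x = of_bool (z = u)"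
  unfolding pd_def by (rule DERIV_imp_deriv) (cases "z = u"; simp)

lemma pd_add:
  assumes "copen I D" "F \<in> ratfun I D" "G \<in> ratfun I D" "z \<in> I" "x \<in> D"
  shows "pd (\<lambda>x. F x + G x) z x = pd F z x + pd G z x"
  unfolding pd_def[of "\<lambda>x. F x + G x"]
  by (rule DERIV_imp_deriv[OF DERIV_add[OF ratfun_deriv[OF assms(1,2,4,5)] ratfun_deriv[OF assms(1,3,4,5)]]])

lemma pd_mult:
  assumes "copen I D" "F \<in> ratfun I D" "G \<in> ratfun I D" "z \<in> I" "x \<in> D"
  shows "pd (\<lambda>x. F x * G x) z x = pd F z x * G x + F x * pd G z x"
  unfolding pd_def[of "\<lambda>x. F x * G x"]
  by (simp only: DERIV_imp_deriv[OF DERIV_mult[OF ratfun_deriv[OF assms(1,2,4,5)] ratfun_deriv[OF assms(1,3,4,5)]]]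
      fun_upd_triv) (simp only: add.commute mult.commute)

section \<open>Brackets of functions and their Jacobiator\<close>

definition pbr :: "(nat \<times> nat) set \<Rightarrow> bivec \<Rightarrow> (pt \<Rightarrow> real) \<Rightarrow> (pt \<Rightarrow> real) \<Rightarrow> pt \<Rightarrow> real" where
  "pbr I P F G x = (\<Sum>w\<in>I. \<Sum>z\<in>I. pd F w x * pd G z x * P x w z)"

locale bivector =
  fixes I :: "(nat \<times> nat) set" and D :: "pt set" and P :: bivec
  assumes fin: "finite I" and cop: "copen I D"
    and P_ratfun: "u \<in> I \<Longrightarrow> v \<in> I \<Longrightarrow> (\<lambda>x. P x u v) \<in> ratfun I D"
    and P_skew: "x \<in> D \<Longrightarrow> u \<in> I \<Longrightarrow> v \<in> I \<Longrightarrow> P x v u = - P x u v"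
begin

abbreviation "br \<equiv> pbr I P"
abbreviation "R \<equiv> ratfun I D"

lemma br_ratfun:
  assumes "F \<in> R" "G \<in> R"
  shows "br F G \<in> R"
proof -
  have "br F G = (\<lambda>x. \<Sum>w\<in>I. \<Sum>z\<in>I. pd F w x * pd G z x * P x w z)"
    by (rule ext) (rule pbr_def)
  moreover have "(\<lambda>x. \<Sum>z\<in>I. pd F w x * pd G z x * P x w z) \<in> R" if w: "w \<in> I" for w
  proof (rule ratfun_sum)
    fix z assume z: "z \<in> I"
    show "(\<lambda>x. pd F w x * pd G z x * P x w z) \<in> R"
      by (rule ratfun.mult[OF ratfun.mult[OF ratfun_pd[OF cop assms(1) w] ratfun_pd[OF cop assms(2) z]] P_ratfun[OF w z]])
  qed
  ultimately show ?thesis using ratfun_sum[of I "\<lambda>w x. \<Sum>z\<in>I. pd F w x * pd G z x * P x w z"] by simp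
qed

lemma br_skew:
  assumes "x \<in> D"
  shows "br G F x = - br F G x"
proof -
  have "br G F x = (\<Sum>z\<in>I. \<Sum>w\<in>I. pd G w x * pd F z x * P x w z)"
    unfolding pbr_def by (rule sum.swap)
  also have "\<dots> = (\<Sum>z\<in>I. \<Sum>w\<in>I. - (pd F z x * pd G w x * P x z w))"
  proof (intro sum.cong refl)
    fix z w assume "z \<in> I" "w \<in> I"
    then show "pd G w x * pd F z x * P x w z = - (pd F z x * pd G w x * P x z w)"
      using P_skew[OF assms, of z w] by simp
  qed
  finally show ?thesis by (simp add: pbr_def sum_negf)
qed

lemma br_cong:
  assumes "x \<in> D" "\<And>y. y \<in> D \<Longrightarrow> F y = F' y" "\<And>y. y \<in> D \<Longrightarrow> G y = G' y"
  shows "br F G x = br F' G' x"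
  unfolding pbr_def
  using pd_cong[OF cop assms(1) _ assms(2)] pd_cong[OF cop assms(1) _ assms(3)]
  by (auto intro!: sum.cong)

lemma br_const [simp]: "br F (\<lambda>x. c) x = 0"
  by (simp add: pbr_def)

lemma br_const_left [simp]: "br (\<lambda>x. c) F x = 0"
  by (simp add: pbr_def)

lemma br_coord_left: "u \<in> I \<Longrightarrow> br (\<lambda>x. x u) G x = (\<Sum>z\<in>I. P x u z * pd G z x)"
proof -
  assume "u \<in> I"
  have "br (\<lambda>x. x u) G x = (\<Sum>w\<in>I. if w = u then \<Sum>z\<in>I. P x u z * pd G z x else 0)"
    unfolding pbr_def by (intro sum.cong) (auto intro!: sum.cong)
  then show ?thesis using fin \<open>u \<in> I\<close> by simp
qed

lemma br_coord [simp]: "u \<in> I \<Longrightarrow> v \<in> I \<Longrightarrow> br (\<lambda>x. x u) (\<lambda>x. x v) x = P x u v"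
  using fin by (simp add: br_coord_left of_bool_def if_distrib[of "\<lambda>a. _ * a"] cong: if_cong)

lemma br_add:
  assumes "F \<in> R" "G \<in> R" "x \<in> D"
  shows "br H (\<lambda>x. F x + G x) x = br H F x + br H G x"
  unfolding pbr_def sum.distrib[symmetric]
  by (intro sum.cong) (auto simp: pd_add[OF cop assms(1,2) _ assms(3)] algebra_simps)

lemma br_mult:
  assumes "F \<in> R" "G \<in> R" "x \<in> D"
  shows "br H (\<lambda>x. F x * G x) x = br H F x * G x + F x * br H G x"
  unfolding pbr_def sum_distrib_left sum_distrib_right sum.distrib[symmetric]
  by (intro sum.cong) (auto simp: pd_mult[OF cop assms(1,2) _ assms(3)] algebra_simps)

lemma br_add_left:
  assumes "F \<in> R" "G \<in> R" "x \<in> D"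
  shows "br (\<lambda>x. F x + G x) H x = br F H x + br G H x"
  using br_add[OF assms, of H] by (simp only: br_skew[OF assms(3), of F H] br_skew[OF assms(3), of G H]
      br_skew[OF assms(3), of "\<lambda>x. F x + G x" H] minus_add_distrib)

lemma br_mult_left:
  assumes "F \<in> R" "G \<in> R" "x \<in> D"
  shows "br (\<lambda>x. F x * G x) H x = br F H x * G x + F x * br G H x"
  by (simp only: br_skew[OF assms(3), of F H] br_skew[OF assms(3), of G H]
      br_skew[OF assms(3), of "\<lambda>x. F x * G x" H] br_mult[OF assms]
      minus_add_distrib mult_minus_left mult_minus_right)

definition jac :: "(pt \<Rightarrow> real) \<Rightarrow> (pt \<Rightarrow> real) \<Rightarrow> (pt \<Rightarrow> real) \<Rightarrow> pt \<Rightarrow> real" where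
  "jac F G H x = br F (br G H) x + br G (br H F) x + br H (br F G) x"

lemma jac_cyclic: "jac G H F x = jac F G H x"
  by (simp add: jac_def)

lemma jac_cong:
  assumes "x \<in> D" "\<And>y. y \<in> D \<Longrightarrow> F y = F' y"
  shows "jac F G H x = jac F' G H x"
proof -
  have "br F (br G H) x = br F' (br G H) x"
    by (rule br_cong[OF assms(1) assms(2) refl])
  moreover have "br G (br H F) x = br G (br H F') x"
    by (rule br_cong[OF assms(1) refl]) (rule br_cong[OF _ refl assms(2)])
  moreover have "br H (br F G) x = br H (br F' G) x"
    by (rule br_cong[OF assms(1) refl]) (rule br_cong[OF _ assms(2) refl])
  ultimately show ?thesis by (simp add: jac_def)
qed

lemma jac_add:
  assumes "F \<in> R" "F' \<in> R" "G \<in> R" "H \<in> R" "x \<in> D"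
  shows "jac (\<lambda>x. F x + F' x) G H x = jac F G H x + jac F' G H x"
proof -
  have 1: "br G (br H (\<lambda>x. F x + F' x)) x = br G (\<lambda>x. br H F x + br H F' x) x"
    by (rule br_cong[OF assms(5) refl]) (rule br_add[OF assms(1,2)])
  have 2: "br H (br (\<lambda>x. F x + F' x) G) x = br H (\<lambda>x. br F G x + br F' G x) x"
    by (rule br_cong[OF assms(5) refl]) (rule br_add_left[OF assms(1,2)])
  show ?thesis
    unfolding jac_def 1 2 using assms by (simp add: br_add br_add_left br_ratfun)
qed

text \<open>Mixed products such as {G, F} {H, F'} cancel by skew symmetry, so the Jacobiator is a
  derivation although it is built from nested brackets.\<close>

lemma jac_mult:
  assumes "F \<in> R" "F' \<in> R" "G \<in> R" "H \<in> R" "x \<in> D"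
  shows "jac (\<lambda>x. F x * F' x) G H x = jac F G H x * F' x + F x * jac F' G H x"
proof -
  have 1: "br G (br H (\<lambda>x. F x * F' x)) x = br G (\<lambda>x. br H F x * F' x + F x * br H F' x) x"
    by (rule br_cong[OF assms(5) refl]) (rule br_mult[OF assms(1,2)])
  have 2: "br H (br (\<lambda>x. F x * F' x) G) x = br H (\<lambda>x. br F G x * F' x + F x * br F' G x) x"
    by (rule br_cong[OF assms(5) refl]) (rule br_mult_left[OF assms(1,2)])
  show ?thesis
    unfolding jac_def 1 2 using assms
    by (simp add: br_add br_mult br_mult_left br_ratfun ratfun.mult br_skew[of x F G] br_skew[of x F' G]
        br_skew[of x F H] br_skew[of x F' H] algebra_simps)
qed

lemma jac_const: "x \<in> D \<Longrightarrow> jac (\<lambda>x. c) G H x = 0"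
proof -
  assume x: "x \<in> D"
  have "br H (\<lambda>x. c) = (\<lambda>x. 0)" "br (\<lambda>x. c) G = (\<lambda>x. 0)" by (rule ext, simp)+
  then show ?thesis by (simp add: jac_def)
qed

lemma jac_zero_ratfun:
  assumes "F \<in> R" "G \<in> R" "H \<in> R"
    and "\<And>u x. u \<in> I \<Longrightarrow> x \<in> D \<Longrightarrow> jac (\<lambda>x. x u) G H x = 0"
    and "x \<in> D"
  shows "jac F G H x = 0"
  using assms(1,5)
proof (induction arbitrary: x)
  case (inverse F)
  \<comment> \<open>The Jacobiator of the constant F * (1 / F) vanishes, and the Leibniz rule then
    determines that of 1 / F.\<close>
  have "0 = jac (\<lambda>x. F x * inverse (F x)) G H x"
    using inverse.hyps(2) jac_cong[OF inverse.prems, of "\<lambda>x. F x * inverse (F x)" "\<lambda>x. 1"]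
    by (simp add: jac_const inverse.prems)
  also have "\<dots> = F x * jac (\<lambda>x. inverse (F x)) G H x"
    using inverse assms by (subst jac_mult) (auto intro: ratfun.inverse)
  finally show ?case using inverse by auto
next
  case (cong F F')
  then show ?case using jac_cong[of x F' F G H] by simp
next
  case (const c)
  then show ?case by (rule jac_const)
next
  case (coord u)
  then show ?case by (rule assms(4))
next
  case (add F F')
  then show ?case using jac_add[OF add.hyps assms(2,3) add.prems] by simp
next
  case (mult F F')
  then show ?case using jac_mult[OF mult.hyps assms(2,3) mult.prems] by simp
qed

text \<open>Coordinates are replaced by rational functions one slot at a time, each slot being
  rotated to the front by \<open>jac_cyclic\<close>.\<close>

lemma jac_zero:
  assumes "poisson I D P" "F \<in> R" "G \<in> R" "H \<in> R" "x \<in> D"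
  shows "jac F G H x = 0"
proof -
  have coord: "(\<lambda>x. x u) \<in> R" if "u \<in> I" for u using that by (rule ratfun.coord)
  have *: "br (\<lambda>x. x u) (br (\<lambda>x. x v) (\<lambda>x. x w)) x = (\<Sum>z\<in>I. P x u z * pd (\<lambda>x. P x v w) z x)"
    if "u \<in> I" "v \<in> I" "w \<in> I" for u v w x
  proof -
    have "br (\<lambda>x. x v) (\<lambda>x. x w) = (\<lambda>x. P x v w)"
      by (rule ext) (rule br_coord[OF that(2,3)])
    then show ?thesis by (simp only: br_coord_left[OF that(1)])
  qed
  have 3: "jac (\<lambda>x. x u) (\<lambda>x. x v) (\<lambda>x. x w) x = 0" if "u \<in> I" "v \<in> I" "w \<in> I" "x \<in> D" for u v w x
  proof -
    have "(\<Sum>z\<in>I. P x u z * pd (\<lambda>x. P x v w) z x + P x v z * pd (\<lambda>x. P x w u) z x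
      + P x w z * pd (\<lambda>x. P x u v) z x) = 0"
      using assms(1) that unfolding poisson_def by blast
    then show ?thesis
      unfolding jac_def *[OF that(1-3)] *[OF that(2,3,1)] *[OF that(3,1,2)] by (simp only: sum.distrib)
  qed
  have 2: "jac F (\<lambda>x. x v) (\<lambda>x. x w) x = 0" if "F \<in> R" "v \<in> I" "w \<in> I" "x \<in> D" for F v w x
    using jac_zero_ratfun[OF that(1) coord[OF that(2)] coord[OF that(3)]] 3 that by blast
  have 1: "jac G (\<lambda>x. x w) F x = 0" if "F \<in> R" "G \<in> R" "w \<in> I" "x \<in> D" for F G w x
  proof (rule jac_zero_ratfun[OF that(2) coord[OF that(3)] that(1) _ that(4)])
    show "jac (\<lambda>x. x u) (\<lambda>x. x w) F x = 0" if "u \<in> I" "x \<in> D" for u x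
      using 2[OF \<open>F \<in> R\<close> that(1) \<open>w \<in> I\<close> that(2)] unfolding jac_cyclic[of "\<lambda>x. x u" "\<lambda>x. x w" F] .
  qed
  show ?thesis
  proof (rule jac_zero_ratfun[OF assms(2,3,4) _ assms(5)])
    show "jac (\<lambda>x. x u) G H x = 0" if "u \<in> I" "x \<in> D" for u x
      using 1[OF assms(3,4) that] unfolding jac_cyclic[of "\<lambda>x. x u" G H] .
  qed
qed

end

text \<open>Existence of partial derivatives alone gives no chain rule; for rational functions it
  follows by induction on their construction.\<close>

lemma pd_compose:
  assumes "finite I" "copen I D" "copen I D'" "F \<in> ratfun I D'"
    and B: "\<And>u. u \<in> I \<Longrightarrow> (\<lambda>x. B x u) \<in> ratfun I D" "\<And>x. x \<in> D \<Longrightarrow> B x \<in> D'"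
    and "w \<in> I" "x \<in> D"
  shows "pd (\<lambda>x. F (B x)) w x = (\<Sum>z\<in>I. pd F z (B x) * pd (\<lambda>x. B x z) w x)"
proof -
  have c: "(\<lambda>x. F (B x)) \<in> ratfun I D" if "F \<in> ratfun I D'" for F
    using that B by (rule ratfun_compose)
  \<comment> \<open>An equivalence, since it is read both ways: from right to left for a product,
    and from left to right for an inverse, where the product is constantly 1 and the nonzero factor
    F (B x) cancels.\<close>
  have chain_mult: "pd (\<lambda>x. F (B x) * G (B x)) w x = (\<Sum>z\<in>I. pd (\<lambda>x. F x * G x) z (B x) * pd (\<lambda>x. B x z) w x)
      \<longleftrightarrow> F (B x) * pd (\<lambda>x. G (B x)) w x = F (B x) * (\<Sum>z\<in>I. pd G z (B x) * pd (\<lambda>x. B x z) w x)"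
    if "F \<in> ratfun I D'" "G \<in> ratfun I D'" "pd (\<lambda>x. F (B x)) w x = (\<Sum>z\<in>I. pd F z (B x) * pd (\<lambda>x. B x z) w x)"
    for F G
  proof -
    have "(\<Sum>z\<in>I. pd (\<lambda>x. F x * G x) z (B x) * pd (\<lambda>x. B x z) w x)
        = (\<Sum>z\<in>I. pd F z (B x) * pd (\<lambda>x. B x z) w x) * G (B x)
          + F (B x) * (\<Sum>z\<in>I. pd G z (B x) * pd (\<lambda>x. B x z) w x)"
      unfolding sum_distrib_left sum_distrib_right sum.distrib[symmetric]
      using assms by (intro sum.cong) (auto simp: pd_mult[OF assms(3) that(1,2)] algebra_simps)
    then show ?thesis
      using assms that by (simp add: pd_mult[OF assms(2) c[OF that(1)] c[OF that(2)]])
  qed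
  show ?thesis
    using assms(4)
  proof induction
    case (coord u)
    then show ?case using assms(1) by (simp add: of_bool_def if_distrib[of "\<lambda>a. a * _"] cong: if_cong)
  next
    case (add F G)
    have "(\<Sum>z\<in>I. pd (\<lambda>x. F x + G x) z (B x) * pd (\<lambda>x. B x z) w x)
      = (\<Sum>z\<in>I. pd F z (B x) * pd (\<lambda>x. B x z) w x) + (\<Sum>z\<in>I. pd G z (B x) * pd (\<lambda>x. B x z) w x)"
      unfolding sum.distrib[symmetric] using assms
      by (intro sum.cong) (auto simp: pd_add[OF assms(3) add.hyps] algebra_simps)
    then show ?case
      using add assms by (simp add: pd_add[OF assms(2) c[OF add.hyps(1)] c[OF add.hyps(2)]])
  next
    case (mult F G)
    then show ?case using chain_mult[OF mult.hyps mult.IH(1)] by simp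
  next
    case (inverse F)
    have F: "F (B y) \<noteq> 0" if "y \<in> D" for y using that B inverse by blast
    have "pd (\<lambda>x. F (B x) * inverse (F (B x))) w x = pd (\<lambda>x. 1) w x"
      by (rule pd_cong[OF assms(2,8,7)]) (use F in auto)
    moreover have "pd (\<lambda>x. F x * inverse (F x)) z (B x) = pd (\<lambda>x. 1) z (B x)" if "z \<in> I" for z
      by (rule pd_cong[OF assms(3) _ that]) (use inverse B assms in auto)
    ultimately show ?case
      using chain_mult[OF inverse.hyps(1) ratfun.inverse[OF inverse.hyps] inverse.IH] F assms by auto
  next
    case (cong F G)
    have "pd (\<lambda>x. G (B x)) w x = pd (\<lambda>x. F (B x)) w x"
      by (rule pd_cong[OF assms(2,8,7)]) (use cong B in auto)
    moreover have "pd G z (B x) = pd F z (B x)" if "z \<in> I" for z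
      by (rule pd_cong[OF assms(3) _ that]) (use cong B assms in auto)
    ultimately show ?case using cong by simp
  qed simp
qed

section \<open>Push-forward along a birational map\<close>

locale birational = bivector +
  fixes D' :: "pt set" and B C :: "pt \<Rightarrow> pt"
  assumes cop': "copen I D'"
    and B_ratfun: "u \<in> I \<Longrightarrow> (\<lambda>x. B x u) \<in> ratfun I D"
    and C_ratfun: "u \<in> I \<Longrightarrow> (\<lambda>x. C x u) \<in> ratfun I D'"
    and B_in: "x \<in> D \<Longrightarrow> B x \<in> D'" and C_in: "y \<in> D' \<Longrightarrow> C y \<in> D"
    and CB: "x \<in> D \<Longrightarrow> C (B x) = x" and BC: "y \<in> D' \<Longrightarrow> B (C y) = y"
begin

abbreviation "Q \<equiv> pushfwd I D B P"

lemma inj_B: "inj_on B D"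
  using CB by (metis inj_onI)

lemma image_B: "B ` D = D'"
  using B_in C_in BC by force

lemma pushfwd_eq: "x \<in> D \<Longrightarrow> Q (B x) u v = br (\<lambda>x. B x u) (\<lambda>x. B x v) x"
  by (simp add: pushfwd_def pbr_def the_inv_into_f_f[OF inj_B])

lemma pushfwd_ratfun:
  assumes "u \<in> I" "v \<in> I"
  shows "(\<lambda>y. Q y u v) \<in> ratfun I D'"
proof (rule ratfun.cong)
  show "(\<lambda>y. br (\<lambda>x. B x u) (\<lambda>x. B x v) (C y)) \<in> ratfun I D'"
    using br_ratfun[OF B_ratfun[OF assms(1)] B_ratfun[OF assms(2)]] C_ratfun C_in by (rule ratfun_compose)
  show "Q y u v = br (\<lambda>x. B x u) (\<lambda>x. B x v) (C y)" if "y \<in> D'" for y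
    using pushfwd_eq[OF C_in[OF that]] BC[OF that] by simp
qed

text \<open>By the chain rule, the Jacobi sum of the push-forward at \<open>B x\<close> is the
  Jacobiator at x of three components of \<open>B\<close>, which are rational functions.\<close>

lemma pushfwd_poisson:
  assumes "poisson I D P"
  shows "poisson I D' Q"
proof -
  have skew: "Q y u v = - Q y v u" if "y \<in> D'" for y u v
    using pushfwd_eq[OF C_in[OF that]] br_skew[OF C_in[OF that]] BC[OF that] by metis
  have diff: "(\<lambda>t. Q (y(z := t)) u v) differentiable (at (y z))"
    if "y \<in> D'" "u \<in> I" "v \<in> I" "z \<in> I" for y u v z
    using ratfun_deriv[OF cop' pushfwd_ratfun[OF that(2,3)] that(4,1)] real_differentiable_def by blast
  have ham: "(\<Sum>z\<in>I. Q (B x) u z * pd (\<lambda>y. Q y v w) z (B x))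
      = br (\<lambda>x. B x u) (br (\<lambda>x. B x v) (\<lambda>x. B x w)) x"
    if "x \<in> D" "u \<in> I" "v \<in> I" "w \<in> I" for x u v w
  proof -
    let ?g = "br (\<lambda>x. B x v) (\<lambda>x. B x w)"
    have pd_g: "pd ?g s x = (\<Sum>z\<in>I. pd (\<lambda>y. Q y v w) z (B x) * pd (\<lambda>x. B x z) s x)" if s: "s \<in> I" for s
    proof -
      have "pd ?g s x = pd (\<lambda>x. Q (B x) v w) s x"
        by (rule pd_cong[OF cop \<open>x \<in> D\<close> s]) (simp add: pushfwd_eq)
      also have "\<dots> = (\<Sum>z\<in>I. pd (\<lambda>y. Q y v w) z (B x) * pd (\<lambda>x. B x z) s x)"
        by (rule pd_compose[OF fin cop cop' pushfwd_ratfun[OF \<open>v \<in> I\<close> \<open>w \<in> I\<close>]]) (use B_ratfun B_in s \<open>x \<in> D\<close> in auto)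
      finally show ?thesis .
    qed
    have "(\<Sum>z\<in>I. Q (B x) u z * pd (\<lambda>y. Q y v w) z (B x))
      = (\<Sum>z\<in>I. \<Sum>r\<in>I. \<Sum>s\<in>I. pd (\<lambda>x. B x u) r x * pd (\<lambda>x. B x z) s x * P x r s * pd (\<lambda>y. Q y v w) z (B x))"
      by (simp add: pushfwd_eq[OF that(1)] pbr_def sum_distrib_right)
    also have "\<dots> = (\<Sum>r\<in>I. \<Sum>z\<in>I. \<Sum>s\<in>I. pd (\<lambda>x. B x u) r x * pd (\<lambda>x. B x z) s x * P x r s * pd (\<lambda>y. Q y v w) z (B x))"
      by (rule sum.swap)
    also have "\<dots> = (\<Sum>r\<in>I. \<Sum>s\<in>I. \<Sum>z\<in>I. pd (\<lambda>x. B x u) r x * pd (\<lambda>x. B x z) s x * P x r s * pd (\<lambda>y. Q y v w) z (B x))"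
      by (intro sum.cong refl sum.swap)
    also have "\<dots> = br (\<lambda>x. B x u) ?g x"
      unfolding pbr_def[of I P "\<lambda>x. B x u" ?g]
      by (intro sum.cong refl) (simp add: pd_g sum_distrib_left sum_distrib_right mult_ac)
    finally show ?thesis .
  qed
  have "(\<Sum>z\<in>I. Q y u z * pd (\<lambda>y'. Q y' v w) z y + Q y v z * pd (\<lambda>y'. Q y' w u) z y
      + Q y w z * pd (\<lambda>y'. Q y' u v) z y) = 0" if "y \<in> D'" "u \<in> I" "v \<in> I" "w \<in> I" for y u v w
    using jac_zero[OF assms B_ratfun[OF that(2)] B_ratfun[OF that(3)] B_ratfun[OF that(4)] C_in[OF that(1)]]
      ham[OF C_in[OF that(1)]] that BC[OF that(1)]
    by (simp add: jac_def sum.distrib)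
  then show ?thesis unfolding poisson_def using skew diff by blast
qed

end

text \<open>On a coordinatewise open set, equality passes to partial derivatives. This transfers the
  property to a bracket given by a formula that agrees with a push-forward only on the
  image.\<close>

lemma poisson_cong:
  assumes "copen I D" "\<And>x u v. x \<in> D \<Longrightarrow> u \<in> I \<Longrightarrow> v \<in> I \<Longrightarrow> P x u v = Q x u v" "poisson I D Q"
  shows "poisson I D P"
proof -
  have pd: "pd (\<lambda>y. P y v w) z y = pd (\<lambda>y. Q y v w) z y" if "y \<in> D" "z \<in> I" "v \<in> I" "w \<in> I" for y v w z
    using pd_cong[OF assms(1) that(1,2), of "\<lambda>y. P y v w" "\<lambda>y. Q y v w"] assms(2) that by blast
  have diff: "(\<lambda>t. P (y(z := t)) u v) differentiable (at (y z))"
    if "y \<in> D" "u \<in> I" "v \<in> I" "z \<in> I" for y u v z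
  proof -
    have "(\<lambda>t. Q (y(z := t)) u v) differentiable (at (y z))"
      using assms(3) that unfolding poisson_def by blast
    then obtain d where "((\<lambda>t. Q (y(z := t)) u v) has_field_derivative d) (at (y z))"
      unfolding real_differentiable_def by blast
    moreover have ev: "\<forall>\<^sub>F t in nhds (y z). P (y(z := t)) u v = Q (y(z := t)) u v"
      using copen_eventually_eq[OF assms(1) that(1,4), of "\<lambda>y. P y u v" "\<lambda>y. Q y u v"] assms(2) that by blast
    ultimately have "((\<lambda>t. P (y(z := t)) u v) has_field_derivative d) (at (y z))"
      using DERIV_cong_ev[OF refl ev refl] by blast
    then show ?thesis using real_differentiable_def by blast
  qed
  show ?thesis
    unfolding poisson_def
  proof (intro conjI ballI)
    fix y u v w assume y: "y \<in> D" "u \<in> I" "v \<in> I" "w \<in> I"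
    have "(\<Sum>z\<in>I. P y u z * pd (\<lambda>y'. P y' v w) z y + P y v z * pd (\<lambda>y'. P y' w u) z y
        + P y w z * pd (\<lambda>y'. P y' u v) z y)
      = (\<Sum>z\<in>I. Q y u z * pd (\<lambda>y'. Q y' v w) z y + Q y v z * pd (\<lambda>y'. Q y' w u) z y
        + Q y w z * pd (\<lambda>y'. Q y' u v) z y)"
      using y by (intro sum.cong refl) (simp add: pd assms(2))
    also have "\<dots> = 0" using assms(3) y unfolding poisson_def by blast
    finally show "(\<Sum>z\<in>I. P y u z * pd (\<lambda>y'. P y' v w) z y + P y v z * pd (\<lambda>y'. P y' w u) z y
        + P y w z * pd (\<lambda>y'. P y' u v) z y) = 0" .
  next
    fix y u v assume "y \<in> D" "u \<in> I" "v \<in> I"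
    then show "P y u v = - P y v u" using assms(2,3) unfolding poisson_def by metis
  qed (use diff in blast)
qed

section \<open>The Poisson pencil\<close>

context band begin

text \<open>The bound does not involve u, so it confines the translates of w to a finite window that
  depends on v and w only.\<close>

lemma dker_pker_nonzero:
  assumes "in_band u" "in_band v" "in_band w" "dker L (pker u) v w \<noteq> 0"
  shows "\<bar>fst v - fst w\<bar> \<le> m + 1"
proof -
  obtain c d e f where vw: "v = (c, d)" "w = (e, f)" by (metis surj_pair)
  have in_v: "c \<le> d" "d \<le> c + m" and in_w: "e \<le> f" "f \<le> e + m"
    using assms by (auto simp: in_band_def vw)
  consider "dgn c d e f \<noteq> 0" | "L e d \<noteq> 0" "pker u (c, f) \<noteq> 0" | "L c f \<noteq> 0" "pker u (e, d) \<noteq> 0"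
    using assms(4) unfolding dker_def vw case_prod_conv by (metis add_0 mult_eq_0_iff)
  then show ?thesis
  proof cases
    case 1
    have "e \<le> d" "c \<le> f"
      using 1 in_v in_w by (auto simp: dgn_def swp_def sgn_if split: if_splits)
    then show ?thesis using in_v in_w by (simp add: vw)
  next
    case 2
    have "e - 1 \<le> d" using 2(1) outside by force
    moreover have "c \<le> f" using 2(2) pker_not_in_band[OF assms(1), of "(c, f)"] by (auto simp: in_band_def)
    ultimately show ?thesis using in_v in_w by (simp add: vw)
  next
    case 3
    have "c - 1 \<le> f" using 3(1) outside by force
    moreover have "e \<le> d" using 3(2) pker_not_in_band[OF assms(1), of "(e, d)"] by (auto simp: in_band_def)
    ultimately show ?thesis using in_v in_w by (simp add: vw)
  qed
qed

lemma trl_far: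
  assumes "\<bar>fst v - fst (trl n w)\<bar> \<le> m + 1"
  shows "n \<in> {- (\<bar>fst v - fst w\<bar> + m + 1) .. \<bar>fst v - fst w\<bar> + m + 1}"
  using near_bound[of "fst v" "fst w" n "m + 1"] assms by (cases w) (auto simp: trl_def)

end

context bivector begin

lemma br_cmult: "F \<in> R \<Longrightarrow> x \<in> D \<Longrightarrow> br H (\<lambda>x. c * F x) x = c * br H F x"
  using br_mult[OF ratfun.const[of c], of F x H] by simp

lemma br_sum:
  assumes "finite S" "\<And>i. i \<in> S \<Longrightarrow> F i \<in> R" "x \<in> D"
  shows "br H (\<lambda>x. \<Sum>i\<in>S. F i x) x = (\<Sum>i\<in>S. br H (F i) x)"
  using assms(1,2)
proof (induction S)
  case (insert i S)
  then show ?case using br_add[of "F i" "\<lambda>x. \<Sum>i\<in>S. F i x" x H] ratfun_sum[of S F I D] assms(3) by simp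
qed simp

text \<open>\<open>ker\<close> is quadratic and \<open>dker\<close> is its polarisation, so the
  derivation \<open>br H\<close> acts on it through \<open>dker\<close>.\<close>

lemma br_ker:
  assumes L: "\<And>a b. (\<lambda>x. L x a b) \<in> R" "x \<in> D"
  shows "(\<lambda>x. ker (L x) v w) \<in> R"
    and "br H (\<lambda>x. ker (L x) v w) x = dker (L x) (\<lambda>(a, b). br H (\<lambda>x. L x a b) x) v w"
proof -
  obtain a b c d where vw: "v = (a, b)" "w = (c, d)" by (metis surj_pair)
  have ker: "(\<lambda>x. ker (L x) v w) = (\<lambda>x. dgn a b c d * (L x a b * L x c d) + swp a b c d * (L x a d * L x c b))"
    by (simp add: ker_def vw mult.assoc)
  note r = ratfun.mult[OF L(1)[of a b] L(1)[of c d]] ratfun.mult[OF L(1)[of a d] L(1)[of c b]]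
  note cr = ratfun.mult[OF ratfun.const[of "dgn a b c d"] r(1)] ratfun.mult[OF ratfun.const[of "swp a b c d"] r(2)]
  show "(\<lambda>x. ker (L x) v w) \<in> R"
    unfolding ker by (rule ratfun.add[OF cr])
  show "br H (\<lambda>x. ker (L x) v w) x = dker (L x) (\<lambda>(a, b). br H (\<lambda>x. L x a b) x) v w"
    unfolding ker br_add[OF cr L(2)] br_cmult[OF r(1) L(2)] br_cmult[OF r(2) L(2)]
      br_mult[OF L(1) L(1) L(2)]
    by (simp add: dker_def vw)
qed

end

lemma ratfun_if:
  "F \<in> ratfun I D \<Longrightarrow> G \<in> ratfun I D \<Longrightarrow> (\<lambda>x. if b then F x else G x) \<in> ratfun I D"
  by (cases b) simp_all

lemma finite_idx [simp]: "finite (idx m N)"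
  by (simp add: idx_def)

lemma idx_iff: "(p, k) \<in> idx m N \<longleftrightarrow> p \<le> m \<and> k < N"
  by (auto simp: idx_def)

definition pencil :: "real \<Rightarrow> nat \<Rightarrow> nat \<Rightarrow> real \<Rightarrow> bivec" where
  "pencil \<alpha> m N \<gamma> x u v = PB2 m N x u v + \<gamma> * PB1 \<alpha> m N x u v"

locale brackets =
  fixes \<alpha> :: real and m N :: nat and D :: "pt set"
  assumes m_pos: "1 \<le> m" and N_large: "2 * m + 2 \<le> N" and cop: "copen (idx m N) D"
begin

lemma N_pos: "N > 0" using N_large by simp

lemma co_ratfun: "(\<lambda>x. co m N x p k) \<in> ratfun (idx m N) D"
proof (cases "p \<le> m")
  case True
  then have "(p, k mod N) \<in> idx m N" using N_pos by (simp add: idx_iff)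
  then show ?thesis using True by (simp add: co_def ratfun.coord)
qed (simp add: co_def ratfun.const)

lemma shifted_ratfun: "(\<lambda>x. shifted m N \<gamma> x p k) \<in> ratfun (idx m N) D"
  unfolding shifted_def by (rule ratfun.add[OF co_ratfun ratfun.const])

lemma hfwd_ratfun: "(\<lambda>x. hfwd (shifted m N \<gamma> x) \<beta> N u v) \<in> ratfun (idx m N) D"
proof -
  obtain p k q l where uv: "u = (p, k)" "v = (q, l)" by (metis surj_pair)
  note c = ratfun.const and s = shifted_ratfun[of \<gamma>]
  define d where "d = off N k l"
  have f: "(\<lambda>x. if d \<le> p then shifted m N \<gamma> x (p - d) l else if d = Suc p then \<beta> else 0) \<in> ratfun (idx m N) D"
    by (rule ratfun_if[OF s ratfun_if[OF c c]])
  have "(\<lambda>x. fwd (shifted m N \<gamma> x) \<beta> N (p, k) (q, l)) \<in> ratfun (idx m N) D"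
    unfolding fwd_def Let_def case_prod_conv d_def[symmetric]
    by (rule ratfun.add[OF ratfun.mult[OF ratfun.mult[OF c s] s] ratfun.mult[OF ratfun.mult[OF c s] f]])
  then show ?thesis unfolding hfwd_def uv case_prod_conv by (rule ratfun_if[OF c])
qed

lemma pencil_ratfun:
  assumes "u \<in> idx m N" "v \<in> idx m N"
  shows "(\<lambda>x. pencil \<alpha> m N \<gamma> x u v) \<in> ratfun (idx m N) D"
proof -
  obtain p k q l where uv: "u = (p, k)" "v = (q, l)" by (metis surj_pair)
  have "(\<lambda>x. pencil \<alpha> m N \<gamma> x u v) = (\<lambda>x. hfwd (shifted m N \<gamma> x) (1 + \<gamma> * \<alpha>) N (p, k) (q, l)
      - hfwd (shifted m N \<gamma> x) (1 + \<gamma> * \<alpha>) N (q, l) (p, k))"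
    unfolding pencil_def uv using assms N_large
    by (intro ext PB_pencil_hfwd) (auto simp: uv idx_iff)
  then show ?thesis using ratfun_diff[OF hfwd_ratfun hfwd_ratfun] by simp
qed

lemma pencil_skew:
  assumes "u \<in> idx m N" "v \<in> idx m N"
  shows "pencil \<alpha> m N \<gamma> x v u = - pencil \<alpha> m N \<gamma> x u v"
proof -
  obtain p k q l where uv: "u = (p, k)" "v = (q, l)" by (metis surj_pair)
  show ?thesis
    using assms N_large PB_pencil_hfwd[of p m q k N l x \<gamma> \<alpha>] PB_pencil_hfwd[of q m p l N k x \<gamma> \<alpha>]
    by (simp add: pencil_def uv idx_iff)
qed

lemma bivector_pencil: "bivector (idx m N) D (pencil \<alpha> m N \<gamma>)"
  by unfold_locales (rule finite_idx cop pencil_ratfun pencil_skew; assumption?)+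

lemma pencil_poisson: "poisson (idx m N) D (pencil \<alpha> m N \<gamma>)"
proof -
  interpret bivector "idx m N" D "pencil \<alpha> m N \<gamma>" by (rule bivector_pencil)
  let ?I = "idx m N" and ?P = "pencil \<alpha> m N \<gamma>"
  define L where "L x = lat (shifted m N \<gamma> x) (1 + \<gamma> * \<alpha>) m N" for x
  have band: "band (L x) (int N) (int m)" for x
    unfolding L_def using N_pos by (rule band_lat)
  have zero: "shifted m N \<gamma> x j k = 0" if "j > m" for x j k
    using that by (simp add: shifted_def co_def)
  have P_pker: "?P x u v = band.pker (L x) (int N) (lft u) (lft v)" if "u \<in> ?I" "v \<in> ?I" for x u v
  proof -
    obtain p k q l where uv: "u = (p, k)" "v = (q, l)" by (metis surj_pair)
    have b: "p \<le> m" "q \<le> m" "k < N" "l < N" using that by (auto simp: uv idx_iff)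
    have "pencil \<alpha> m N \<gamma> x (p, k) (q, l) = hfwd (shifted m N \<gamma> x) (1 + \<gamma> * \<alpha>) N (p, k) (q, l)
        - hfwd (shifted m N \<gamma> x) (1 + \<gamma> * \<alpha>) N (q, l) (p, k)"
      unfolding pencil_def by (rule PB_pencil_hfwd[OF b N_large])
    also have "\<dots> = band.pker (L x) (int N) (lft (p, k)) (lft (q, l))"
      unfolding L_def by (rule pker_lat[symmetric]) (use zero b N_large in auto)
    finally show ?thesis by (simp add: uv)
  qed
  have L_ratfun: "(\<lambda>x. L x a b) \<in> R" for a b
    unfolding L_def lat_def by (rule ratfun_if[OF ratfun.const ratfun_if[OF shifted_ratfun ratfun.const]])
  have in_band_lft: "band.in_band (int m) (lft u)" if "u \<in> ?I" for u
    using that by (cases u) (auto simp: band.in_band_def[OF band] lft_def idx_iff)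
  \<comment> \<open>Outside the coordinate band the entry is constant in x and \<open>pker\<close>
    vanishes by tangency; inside, (a, b) is a translate of a lifted coordinate label.\<close>
  have br_L: "br (\<lambda>x. x u) (\<lambda>x. L x a b) x = band.pker (L x) (int N) (lft u) (a, b)"
    if u: "u \<in> ?I" and x: "x \<in> D" for u a b x
  proof -
    interpret band "L x" "int N" "int m" by (rule band)
    show ?thesis
    proof (cases "in_band (a, b)")
      case False
      then have "(\<lambda>x. L x a b) = (\<lambda>_. L x a b)"
        by (auto simp: in_band_def L_def lat_def)
      then have "br (\<lambda>x. x u) (\<lambda>x. L x a b) x = 0" by (metis br_const)
      then show ?thesis using pker_not_in_band[OF in_band_lft[OF u] False] by simp
    next
      case True
      define p' k' where "p' = nat (b - a)" and "k' = nat (a mod int N)"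
      have pk: "(p', k') \<in> ?I"
        using True N_pos by (auto simp: idx_iff in_band_def p'_def k'_def nat_less_iff)
      have Lab: "(\<lambda>x. L x a b) = (\<lambda>x. x (p', k') + (if p' = 0 then \<gamma> else 0))"
        using True pk by (auto simp: L_def lat_def in_band_def p'_def k'_def shifted_def co_def idx_iff)
      have "br (\<lambda>x. x u) (\<lambda>x. L x a b) x = ?P x u (p', k')"
        unfolding Lab using u pk x by (simp add: br_add ratfun.coord ratfun.const)
      also have "\<dots> = pker (lft u) (trl (a div int N) (lft (p', k')))"
        using P_pker[OF u pk] by simp
      also have "trl (a div int N) (lft (p', k')) = (a, b)"
        using True N_pos by (auto simp: trl_def lft_def p'_def k'_def in_band_def)
      finally show ?thesis .
    qed
  qed
  have ham: "(\<Sum>z\<in>?I. ?P x u z * pd (\<lambda>x. ?P x v w) z x)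
      = Sum_any (\<lambda>j. dker (L x) (band.pker (L x) (int N) (lft u)) (lft v) (band.trl (int N) j (lft w)))"
    if x: "x \<in> D" and u: "u \<in> ?I" and v: "v \<in> ?I" and w: "w \<in> ?I" for x u v w
  proof -
    interpret band "L x" "int N" "int m" by (rule band)
    \<comment> \<open>The window is the same for all points, so the sum over translates is a fixed
      finite sum of functions and can be differentiated term by term.\<close>
    define S where "S = {- (\<bar>fst (lft v) - fst (lft w)\<bar> + int m + 1) .. \<bar>fst (lft v) - fst (lft w)\<bar> + int m + 1}"
    have P_sum: "?P y v w = (\<Sum>n\<in>S. ker (L y) (lft v) (trl n (lft w)))" for y
      unfolding P_pker[OF v w] band.pker_def[OF band]
    proof (rule Sum_any.expand_superset)
      show "{n. ker (L y) (lft v) (trl n (lft w)) \<noteq> 0} \<subseteq> S"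
        using band.ker_in_band_nonzero(2)[OF band in_band_lft[OF v]] trl_far unfolding S_def by blast
    qed (simp add: S_def)
    have "(\<Sum>z\<in>?I. ?P x u z * pd (\<lambda>x. ?P x v w) z x)
        = br (\<lambda>x. x u) (\<lambda>x. \<Sum>n\<in>S. ker (L x) (lft v) (trl n (lft w))) x"
      by (simp only: br_coord_left[OF u] P_sum)
    also have "\<dots> = (\<Sum>n\<in>S. br (\<lambda>x. x u) (\<lambda>x. ker (L x) (lft v) (trl n (lft w))) x)"
      by (rule br_sum) (use br_ker(1)[OF L_ratfun x] x in \<open>auto simp: S_def\<close>)
    also have "\<dots> = (\<Sum>n\<in>S. dker (L x) (pker (lft u)) (lft v) (trl n (lft w)))"
      by (simp add: br_ker(2)[OF L_ratfun x] br_L[OF u x])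
    also have "\<dots> = Sum_any (\<lambda>j. dker (L x) (pker (lft u)) (lft v) (trl j (lft w)))"
    proof (rule Sum_any.expand_superset[symmetric])
      show "{j. dker (L x) (pker (lft u)) (lft v) (trl j (lft w)) \<noteq> 0} \<subseteq> S"
      proof clarify
        fix j assume nz: "dker (L x) (pker (lft u)) (lft v) (trl j (lft w)) \<noteq> 0"
        have "in_band (trl j (lft w))" using in_band_lft[OF w] by simp
        from dker_pker_nonzero[OF in_band_lft[OF u] in_band_lft[OF v] this nz]
        show "j \<in> S" unfolding S_def by (rule trl_far)
      qed
    qed (simp add: S_def)
    finally show ?thesis .
  qed
  show ?thesis
    unfolding poisson_def
  proof (intro conjI ballI)
    fix x u v assume "u \<in> ?I" "v \<in> ?I"
    then show "?P x u v = - ?P x v u" using pencil_skew by fastforce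
  next
    fix x u v z assume "x \<in> D" "u \<in> ?I" "v \<in> ?I" "z \<in> ?I"
    then show "(\<lambda>t. ?P (x(z := t)) u v) differentiable (at (x z))"
      using ratfun_deriv[OF cop pencil_ratfun, of u v z x] real_differentiable_def by blast
  next
    fix x u v w assume *: "x \<in> D" "u \<in> ?I" "v \<in> ?I" "w \<in> ?I"
    show "(\<Sum>z\<in>?I. ?P x u z * pd (\<lambda>x. ?P x v w) z x + ?P x v z * pd (\<lambda>x. ?P x w u) z x
        + ?P x w z * pd (\<lambda>x. ?P x u v) z x) = 0"
      unfolding sum.distrib ham[OF *(1,2,3,4)] ham[OF *(1,3,4,2)] ham[OF *(1,4,2,3)]
      by (rule band.pker_jacobi[OF band]) (use in_band_lft * in auto)
  qed
qed

lemma PB_ratfun: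
  assumes "u \<in> idx m N" "v \<in> idx m N"
  shows "(\<lambda>x. PB1 \<alpha> m N x u v) \<in> ratfun (idx m N) D" "(\<lambda>x. PB2 m N x u v) \<in> ratfun (idx m N) D"
proof -
  have "(\<lambda>x. PB2 m N x u v) = (\<lambda>x. pencil \<alpha> m N 0 x u v)"
    "(\<lambda>x. PB1 \<alpha> m N x u v) = (\<lambda>x. pencil \<alpha> m N 1 x u v - pencil \<alpha> m N 0 x u v)"
    by (simp_all add: pencil_def)
  then show "(\<lambda>x. PB1 \<alpha> m N x u v) \<in> ratfun (idx m N) D" "(\<lambda>x. PB2 m N x u v) \<in> ratfun (idx m N) D"
    using pencil_ratfun[OF assms] ratfun_diff[OF pencil_ratfun[OF assms] pencil_ratfun[OF assms]] by simp_all
qed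

lemma PB_skew:
  assumes "u \<in> idx m N" "v \<in> idx m N"
  shows "PB1 \<alpha> m N x v u = - PB1 \<alpha> m N x u v" "PB2 m N x v u = - PB2 m N x u v"
  using pencil_skew[OF assms, of 0 x] pencil_skew[OF assms, of 1 x] by (simp_all add: pencil_def)

lemma bivector_PB: "bivector (idx m N) D (\<lambda>x u v. s * PB1 \<alpha> m N x u v + t * PB2 m N x u v)"
proof
  fix u v assume *: "u \<in> idx m N" "v \<in> idx m N"
  show "(\<lambda>x. s * PB1 \<alpha> m N x u v + t * PB2 m N x u v) \<in> ratfun (idx m N) D"
    by (rule ratfun.add[OF ratfun.mult[OF ratfun.const PB_ratfun(1)[OF *]] ratfun.mult[OF ratfun.const PB_ratfun(2)[OF *]]])
  show "s * PB1 \<alpha> m N x v u + t * PB2 m N x v u = - (s * PB1 \<alpha> m N x u v + t * PB2 m N x u v)" for x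
    unfolding PB_skew[OF *] by simp
qed (use cop in auto)

text \<open>The Jacobiator of \<open>s PB1 + t PB2\<close> is a quadratic form in \<open>(s, t)\<close>; it vanishes
  at \<open>(0, 1)\<close>, \<open>(1, 1)\<close> and \<open>(- 1, 1)\<close>, hence identically.\<close>

lemma PB_poisson: "poisson (idx m N) D (\<lambda>x u v. s * PB1 \<alpha> m N x u v + t * PB2 m N x u v)"
proof -
  let ?I = "idx m N" and ?P = "PB1 \<alpha> m N" and ?Q = "PB2 m N"
  define J where "J = (\<lambda>s t x u v w. \<Sum>z\<in>?I.
      (s * ?P x u z + t * ?Q x u z) * pd (\<lambda>x. s * ?P x v w + t * ?Q x v w) z x
    + (s * ?P x v z + t * ?Q x v z) * pd (\<lambda>x. s * ?P x w u + t * ?Q x w u) z x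
    + (s * ?P x w z + t * ?Q x w z) * pd (\<lambda>x. s * ?P x u v + t * ?Q x u v) z x)"
  have J0: "J \<gamma> 1 x u v w = 0" if "x \<in> D" "u \<in> ?I" "v \<in> ?I" "w \<in> ?I" for \<gamma> x u v w
  proof -
    have "(\<lambda>x u v. \<gamma> * ?P x u v + 1 * ?Q x u v) = pencil \<alpha> m N \<gamma>"
      by (intro ext) (simp add: pencil_def)
    then have "poisson ?I D (\<lambda>x u v. \<gamma> * ?P x u v + 1 * ?Q x u v)"
      using pencil_poisson by simp
    then show ?thesis using that unfolding poisson_def J_def by blast
  qed
  have J: "J s t x u v w = 0" if x: "x \<in> D" and u: "u \<in> ?I" and v: "v \<in> ?I" and w: "w \<in> ?I" for x u v w
  proof -
    have pd: "pd (\<lambda>x. s * ?P x u v + t * ?Q x u v) z x = s * pd (\<lambda>x. ?P x u v) z x + t * pd (\<lambda>x. ?Q x u v) z x"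
      if "u \<in> ?I" "v \<in> ?I" "z \<in> ?I" for s t u v z
      using pd_add[OF cop ratfun.mult[OF ratfun.const[of s] PB_ratfun(1)[OF that(1,2)]]
          ratfun.mult[OF ratfun.const[of t] PB_ratfun(2)[OF that(1,2)]] that(3) x]
        pd_mult[OF cop ratfun.const[of s] PB_ratfun(1)[OF that(1,2)] that(3) x]
        pd_mult[OF cop ratfun.const[of t] PB_ratfun(2)[OF that(1,2)] that(3) x] by simp
    define a where "a = (\<lambda>P Q :: bivec. \<Sum>z\<in>?I. P x u z * pd (\<lambda>x. Q x v w) z x
      + P x v z * pd (\<lambda>x. Q x w u) z x + P x w z * pd (\<lambda>x. Q x u v) z x)"
    have quad: "J s t x u v w = s * s * a ?P ?P + s * t * (a ?P ?Q + a ?Q ?P) + t * t * a ?Q ?Q" for s t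
      unfolding J_def a_def sum.distrib[symmetric] sum_distrib_left
    proof (rule sum.cong[OF refl])
      fix z assume z: "z \<in> ?I"
      note pds = pd[OF u v z] pd[OF v w z] pd[OF w u z]
      show "(s * ?P x u z + t * ?Q x u z) * pd (\<lambda>x. s * ?P x v w + t * ?Q x v w) z x
        + (s * ?P x v z + t * ?Q x v z) * pd (\<lambda>x. s * ?P x w u + t * ?Q x w u) z x
        + (s * ?P x w z + t * ?Q x w z) * pd (\<lambda>x. s * ?P x u v + t * ?Q x u v) z x
        = s * s * (?P x u z * pd (\<lambda>x. ?P x v w) z x + ?P x v z * pd (\<lambda>x. ?P x w u) z x
          + ?P x w z * pd (\<lambda>x. ?P x u v) z x)
        + s * t * (?P x u z * pd (\<lambda>x. ?Q x v w) z x + ?P x v z * pd (\<lambda>x. ?Q x w u) z x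
          + ?P x w z * pd (\<lambda>x. ?Q x u v) z x
          + (?Q x u z * pd (\<lambda>x. ?P x v w) z x + ?Q x v z * pd (\<lambda>x. ?P x w u) z x
          + ?Q x w z * pd (\<lambda>x. ?P x u v) z x))
        + t * t * (?Q x u z * pd (\<lambda>x. ?Q x v w) z x + ?Q x v z * pd (\<lambda>x. ?Q x w u) z x
          + ?Q x w z * pd (\<lambda>x. ?Q x u v) z x)"
        unfolding pds by (simp only: algebra_simps)
    qed
    have "a ?Q ?Q = 0" "a ?P ?P = 0" "a ?P ?Q + a ?Q ?P = 0"
      using J0[OF x u v w, of 0] J0[OF x u v w, of 1] J0[OF x u v w, of "- 1"] by (simp_all add: quad)
    then show ?thesis by (simp add: quad)
  qed
  interpret bivector ?I D "\<lambda>x u v. s * PB1 \<alpha> m N x u v + t * PB2 m N x u v" by (rule bivector_PB)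
  show ?thesis
    unfolding poisson_def
  proof (intro conjI ballI)
    fix x u v assume "x \<in> D" "u \<in> ?I" "v \<in> ?I"
    then show "s * ?P x u v + t * ?Q x u v = - (s * ?P x v u + t * ?Q x v u)" using P_skew by fastforce
  next
    fix x u v z assume "x \<in> D" "u \<in> ?I" "v \<in> ?I" "z \<in> ?I"
    then show "(\<lambda>ta. s * ?P (x(z := ta)) u v + t * ?Q (x(z := ta)) u v) differentiable (at (x z))"
      using ratfun_deriv[OF cop P_ratfun, of u v z x] real_differentiable_def by blast
  next
    fix x u v w assume "x \<in> D" "u \<in> ?I" "v \<in> ?I" "w \<in> ?I"
    from J[OF this] show "(\<Sum>z\<in>?I.
      (s * ?P x u z + t * ?Q x u z) * pd (\<lambda>x. s * ?P x v w + t * ?Q x v w) z x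
    + (s * ?P x v z + t * ?Q x v z) * pd (\<lambda>x. s * ?P x w u + t * ?Q x w u) z x
    + (s * ?P x w z + t * ?Q x w z) * pd (\<lambda>x. s * ?P x u v + t * ?Q x u v) z x) = 0"
      by (simp only: J_def)
  qed
qed

end

section \<open>The domain and the inverse of the change of variables\<close>

lemma copen_Dom: "copen (idx m N) (Dom \<alpha> m N)"
  unfolding copen_def
proof (intro ballI)
  fix x z assume x: "x \<in> Dom \<alpha> m N" and z: "z \<in> idx m N"
  show "\<forall>\<^sub>F t in nhds (x z). x(z := t) \<in> Dom \<alpha> m N"
  proof (cases "fst z = 0")
    case True
    have "((\<lambda>t. 1 - \<alpha> * t) \<longlongrightarrow> 1 - \<alpha> * x z) (nhds (x z))"
      by (intro tendsto_intros filterlim_ident)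
    moreover have "1 - \<alpha> * x z \<noteq> 0" using x z True by (cases z) (auto simp: Dom_def idx_iff)
    ultimately have "\<forall>\<^sub>F t in nhds (x z). 1 - \<alpha> * t \<noteq> 0"
      by (rule tendsto_imp_eventually_ne)
    then show ?thesis
      by (rule eventually_mono) (use x z in \<open>auto simp: Dom_def\<close>)
  next
    case False
    then have "x(z := t) \<in> Dom \<alpha> m N" for t using x z by (auto simp: Dom_def)
    then show ?thesis by simp
  qed
qed

lemma Dom_nz: "x \<in> Dom \<alpha> m N \<Longrightarrow> k < N \<Longrightarrow> 1 - \<alpha> * x (0, k) \<noteq> 0"
  by (simp add: Dom_def)

lemma Bmap_0: "k < N \<Longrightarrow> Bmap \<alpha> m N x (0, k) = x (0, k) / (1 - \<alpha> * x (0, k))"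
  by (simp add: Bmap_def)

lemma Bmap_pos: "1 \<le> p \<Longrightarrow> p \<le> m \<Longrightarrow> k < N \<Longrightarrow>
    Bmap \<alpha> m N x (p, k) = x (p, k) / (\<Prod>i\<in>{0..p}. (1 - \<alpha> * x (0, (k + i) mod N)))"
  by (simp add: Bmap_def)

text \<open>Since 1 + \<alpha> d_k and 1 - \<alpha> b_k are reciprocal, the inverse is the same map
  with - \<alpha>, and the image is the domain for - \<alpha>.\<close>

lemma Bmap_factor:
  assumes "x \<in> Dom \<alpha> m N" "k < N"
  shows "1 + \<alpha> * Bmap \<alpha> m N x (0, k) = 1 / (1 - \<alpha> * x (0, k))"
  using Dom_nz[OF assms] assms(2) by (simp add: Bmap_0 field_simps)

lemma Bmap_in:
  assumes "x \<in> Dom \<alpha> m N"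
  shows "Bmap \<alpha> m N x \<in> Dom (- \<alpha>) m N"
  unfolding Dom_def
proof (intro CollectI conjI allI impI)
  fix u assume "u \<notin> idx m N"
  then show "Bmap \<alpha> m N x u = 0" by (cases u) (auto simp: Bmap_def idx_iff)
next
  fix k assume "k < N"
  then show "1 - - \<alpha> * Bmap \<alpha> m N x (0, k) \<noteq> 0"
    using Bmap_factor[OF assms] Dom_nz[OF assms] by simp
qed

lemma Bmap_inverse:
  assumes "x \<in> Dom \<alpha> m N"
  shows "Bmap (- \<alpha>) m N (Bmap \<alpha> m N x) = x"
proof (rule ext, clarify)
  fix p k
  show "Bmap (- \<alpha>) m N (Bmap \<alpha> m N x) (p, k) = x (p, k)"
  proof (cases "p \<le> m \<and> k < N")
    case False
    then have "x (p, k) = 0" using assms by (simp add: Dom_def idx_iff)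
    then show ?thesis using False by (auto simp: Bmap_def)
  next
    case True
    then have "N > 0" by auto
    show ?thesis
    proof (cases "p = 0")
      case p: True
      then show ?thesis
        using True Bmap_factor[OF assms, of k] Dom_nz[OF assms, of k]
        by (simp add: Bmap_0[of k N "- \<alpha>"]) (simp add: Bmap_0)
    next
      case False
      have "(\<Prod>i\<in>{0..p}. (1 - - \<alpha> * Bmap \<alpha> m N x (0, (k + i) mod N)))
          = (\<Prod>i\<in>{0..p}. inverse (1 - \<alpha> * x (0, (k + i) mod N)))"
        using Bmap_factor[OF assms] \<open>N > 0\<close> by (intro prod.cong) (auto simp: divide_inverse)
      also have "\<dots> = inverse (\<Prod>i\<in>{0..p}. (1 - \<alpha> * x (0, (k + i) mod N)))"
        by (rule prod_inversef[unfolded comp_def])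
      finally have *: "(\<Prod>i\<in>{0..p}. (1 - - \<alpha> * Bmap \<alpha> m N x (0, (k + i) mod N)))
          = inverse (\<Prod>i\<in>{0..p}. (1 - \<alpha> * x (0, (k + i) mod N)))" .
      have "(\<Prod>i\<in>{0..p}. (1 - \<alpha> * x (0, (k + i) mod N))) \<noteq> 0"
        using Dom_nz[OF assms] \<open>N > 0\<close> by auto
      then show ?thesis
        using True False Bmap_pos[of p m k N "- \<alpha>" "Bmap \<alpha> m N x"] Bmap_pos[of p m k N \<alpha> x] unfolding *
        by simp
    qed
  qed
qed

lemma Bmap_ratfun:
  assumes "u \<in> idx m N"
  shows "(\<lambda>x. Bmap \<alpha> m N x u) \<in> ratfun (idx m N) (Dom \<alpha> m N)"
proof -
  obtain p k where u: "u = (p, k)" "p \<le> m" "k < N" using assms by (cases u) (auto simp: idx_iff)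
  have f: "(\<lambda>x. 1 - \<alpha> * x (0, i)) \<in> ratfun (idx m N) (Dom \<alpha> m N)" if "i < N" for i
    using that by (intro ratfun_diff ratfun.const ratfun.mult ratfun.coord) (simp add: idx_iff)
  show ?thesis
  proof (cases "p = 0")
    case True
    show ?thesis
      unfolding u(1) True Bmap_0[OF u(3)]
      using ratfun_divide[OF ratfun.coord f[OF u(3)], of "(0, k)"] Dom_nz u by (simp add: idx_iff)
  next
    case False
    have "(\<lambda>x. x (p, k) / (\<Prod>i\<in>{0..p}. (1 - \<alpha> * x (0, (k + i) mod N)))) \<in> ratfun (idx m N) (Dom \<alpha> m N)"
    proof (rule ratfun_divide)
      show "(\<lambda>x. \<Prod>i\<in>{0..p}. (1 - \<alpha> * x (0, (k + i) mod N))) \<in> ratfun (idx m N) (Dom \<alpha> m N)"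
        using u(3) by (intro ratfun_prod f) auto
      show "(\<Prod>i\<in>{0..p}. (1 - \<alpha> * x (0, (k + i) mod N))) \<noteq> 0" if "x \<in> Dom \<alpha> m N" for x
        using Dom_nz[OF that] u(3) by auto
    qed (use assms u in \<open>simp add: ratfun.coord\<close>)
    then show ?thesis using False u Bmap_pos[of p m k N \<alpha>] by simp
  qed
qed

section \<open>The change of variables\<close>

context bivector begin

lemma br_inverse:
  assumes "F \<in> R" "\<And>y. y \<in> D \<Longrightarrow> F y \<noteq> 0" "x \<in> D"
  shows "br H (\<lambda>x. inverse (F x)) x = - br H F x * (inverse (F x))\<^sup>2"
proof -
  have "0 = br H (\<lambda>x. F x * inverse (F x)) x"
    using br_cong[OF assms(3), of H H "\<lambda>x. F x * inverse (F x)" "\<lambda>x. 1"] assms(2) by simp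
  also have "\<dots> = br H F x * inverse (F x) + F x * br H (\<lambda>x. inverse (F x)) x"
    by (rule br_mult[OF assms(1) ratfun.inverse[OF assms(1,2)] assms(3)])
  finally show ?thesis
    using assms(2,3) by (simp add: field_simps power2_eq_square)
qed

end

text \<open>In the new variables this factor is 1 + \<alpha> d_i.\<close>

definition rho :: "real \<Rightarrow> nat \<Rightarrow> nat \<Rightarrow> pt \<Rightarrow> real" where
  "rho \<alpha> N i x = inverse (1 - \<alpha> * x (0, i mod N))"

definition rhos :: "real \<Rightarrow> nat \<Rightarrow> nat \<Rightarrow> nat \<Rightarrow> pt \<Rightarrow> real" where
  "rhos \<alpha> N j k x = (\<Prod>i\<in>{0..j}. rho \<alpha> N (k + i) x)"

lemma rho_mod [simp]: "rho \<alpha> N (i mod N) x = rho \<alpha> N i x"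
  by (simp add: rho_def)

lemma rho_cong: "i mod N = j mod N \<Longrightarrow> rho \<alpha> N i x = rho \<alpha> N j x"
  by (simp add: rho_def)

lemma rhos_cong: "k mod N = l mod N \<Longrightarrow> rhos \<alpha> N j k x = rhos \<alpha> N j l x"
  unfolding rhos_def by (intro prod.cong refl rho_cong) (metis mod_add_left_eq)

lemma rhos_0: "rhos \<alpha> N 0 k x = rho \<alpha> N k x"
  by (simp add: rhos_def)

lemma rhos_Suc: "rhos \<alpha> N (Suc j) k x = rhos \<alpha> N j k x * rho \<alpha> N (k + Suc j) x"
  by (simp add: rhos_def prod.atLeast0_atMost_Suc)

lemma rhos_add: "rhos \<alpha> N (j + d) k x = (\<Prod>i<d. rho \<alpha> N (k + i) x) * rhos \<alpha> N j (k + d) x"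
proof (induction j)
  case 0
  show ?case
    by (simp add: rhos_def lessThan_Suc_atMost[symmetric] atLeast0AtMost)
next
  case (Suc j)
  then show ?case using rhos_Suc[of \<alpha> N "j + d" k x] rhos_Suc[of \<alpha> N j "k + d" x]
    by (simp add: ac_simps)
qed

lemma rhos_Suc_left: "rhos \<alpha> N (Suc j) k x = rho \<alpha> N k x * rhos \<alpha> N j (Suc k) x"
  using rhos_add[of \<alpha> N j 1 k x] by simp

lemma co_mod [simp]: "co m N x p (k mod N) = co m N x p k"
  by (simp add: co_def)

lemma co_eq: "p \<le> m \<Longrightarrow> k < N \<Longrightarrow> co m N x p k = x (p, k)"
  by (simp add: co_def)

lemma co_Bmap_0:
  assumes "x \<in> Dom \<alpha> m N" "N > 0"
  shows "1 + \<alpha> * co m N (Bmap \<alpha> m N x) 0 k = rho \<alpha> N k x"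
  using Bmap_factor[OF assms(1), of "k mod N"] assms(2) by (simp add: co_def rho_def inverse_eq_divide)

lemma co_Bmap:
  assumes "1 \<le> j" "N > 0"
  shows "co m N (Bmap \<alpha> m N x) j k = co m N x j k * rhos \<alpha> N j k x"
proof (cases "j \<le> m")
  case True
  have "(\<Prod>i\<in>{0..j}. (1 - \<alpha> * x (0, (k mod N + i) mod N))) = inverse (rhos \<alpha> N j k x)"
    unfolding rhos_def rho_def prod_inversef[unfolded comp_def] inverse_inverse_eq
    by (simp add: mod_add_left_eq)
  then show ?thesis
    using Bmap_pos[of j m "k mod N" N \<alpha> x] assms True by (simp add: co_def divide_inverse)
qed (simp add: co_def)

lemma off_eq_iff:
  assumes "k < N" "l < N" "i < N"
  shows "off N k l = i \<longleftrightarrow> (k + i) mod N = l"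
proof -
  have "(k + i) mod N = (if k + i < N then k + i else k + i - N)"
    using assms by (simp add: mod_if)
  then show ?thesis using assms by (auto simp: off_cases)
qed

lemma off_add:
  assumes "k < N" "l < N" "q < N"
  shows "off N k ((l + q) mod N) = (off N k l + q) mod N"
proof -
  have "(l + q) mod N < N" "(off N k l + q) mod N < N" using assms by auto
  moreover have "(k + (off N k l + q) mod N) mod N = ((k + off N k l) mod N + q) mod N"
    by (simp add: mod_add_left_eq mod_add_right_eq add.assoc)
  moreover have "(k + off N k l) mod N = l"
    using off_eq_iff[of k N l "off N k l"] assms off_less[of N k l] by simp
  ultimately show ?thesis using off_eq_iff assms(1) by auto
qed

text \<open>As p < N, the arc k, ..., k + p meets each residue at most once.\<close>

lemma sum_hit:
  assumes "k < N" "l < N" "p < N"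
  shows "(\<Sum>i\<in>{0..p}. of_bool ((k + i) mod N = l) :: real) = of_bool (off N k l \<le> p)"
proof -
  have "(\<Sum>i\<in>{0..p}. of_bool ((k + i) mod N = l) :: real) = (\<Sum>i\<in>{0..p}. if i = off N k l then 1 else 0)"
  proof (rule sum.cong[OF refl])
    fix i assume "i \<in> {0..p}"
    then show "(of_bool ((k + i) mod N = l) :: real) = (if i = off N k l then 1 else 0)"
      using off_eq_iff[OF assms(1,2), of i] assms(3) by auto
  qed
  then show ?thesis by simp
qed

text \<open>\<open>P\<close> stays open because it is instantiated by the first bracket, by the
  combination in (i) and by arbitrary combinations of the two brackets.\<close>

locale map_bracket = bivector "idx m N" "Dom \<alpha> m N" P for \<alpha> m N P +
  assumes m_pos: "1 \<le> m" and N_large: "2 * m + 2 \<le> N" and \<alpha>_nz: "\<alpha> \<noteq> 0"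
begin

abbreviation "B \<equiv> Bmap \<alpha> m N"
abbreviation "r \<equiv> rho \<alpha> N"
abbreviation "rs \<equiv> rhos \<alpha> N"

sublocale birational "idx m N" "Dom \<alpha> m N" P "Dom (- \<alpha>) m N" "Bmap \<alpha> m N" "Bmap (- \<alpha>) m N"
proof
  show "copen (idx m N) (Dom (- \<alpha>) m N)" by (rule copen_Dom)
  show "u \<in> idx m N \<Longrightarrow> (\<lambda>x. Bmap \<alpha> m N x u) \<in> ratfun (idx m N) (Dom \<alpha> m N)" for u by (rule Bmap_ratfun)
  show "u \<in> idx m N \<Longrightarrow> (\<lambda>x. Bmap (- \<alpha>) m N x u) \<in> ratfun (idx m N) (Dom (- \<alpha>) m N)" for u by (rule Bmap_ratfun)
  show "x \<in> Dom \<alpha> m N \<Longrightarrow> Bmap \<alpha> m N x \<in> Dom (- \<alpha>) m N" for x by (rule Bmap_in)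
  show "y \<in> Dom (- \<alpha>) m N \<Longrightarrow> Bmap (- \<alpha>) m N y \<in> Dom \<alpha> m N" for y using Bmap_in[of y "- \<alpha>" m N] by simp
  show "x \<in> Dom \<alpha> m N \<Longrightarrow> Bmap (- \<alpha>) m N (Bmap \<alpha> m N x) = x" for x by (rule Bmap_inverse)
  show "y \<in> Dom (- \<alpha>) m N \<Longrightarrow> Bmap \<alpha> m N (Bmap (- \<alpha>) m N y) = y" for y using Bmap_inverse[of y "- \<alpha>" m N] by simp
qed

lemma N_pos: "N > 0" using N_large by simp

lemma zero_idx: "(0, k mod N) \<in> idx m N"
  using N_pos by (simp add: idx_iff)

lemma beta_ratfun: "(\<lambda>x. 1 - \<alpha> * x (0, k mod N)) \<in> R"
  by (rule ratfun_diff[OF ratfun.const ratfun.mult[OF ratfun.const ratfun.coord[OF zero_idx]]])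

lemma beta_nz: "x \<in> Dom \<alpha> m N \<Longrightarrow> 1 - \<alpha> * x (0, k mod N) \<noteq> 0"
  using Dom_nz[of x \<alpha> m N "k mod N"] N_pos by simp

lemma r_ratfun: "r i \<in> R"
proof -
  have "r i = (\<lambda>x. inverse (1 - \<alpha> * x (0, i mod N)))" by (rule ext) (rule rho_def)
  moreover have "(\<lambda>x. inverse (1 - \<alpha> * x (0, i mod N))) \<in> R"
    by (rule ratfun.inverse[OF beta_ratfun]) (erule beta_nz)
  ultimately show ?thesis by (simp only:)
qed

lemma rs_ratfun: "rs j k \<in> R"
proof -
  have "rs j k = (\<lambda>x. \<Prod>i\<in>{0..j}. r (k + i) x)" by (rule ext) (rule rhos_def)
  then show ?thesis using ratfun_prod[of "{0..j}" "\<lambda>i. r (k + i)"] r_ratfun by simp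
qed

lemma r_nz: "x \<in> Dom \<alpha> m N \<Longrightarrow> r i x \<noteq> 0"
  using beta_nz by (simp add: rho_def)

lemma br_r:
  assumes "x \<in> Dom \<alpha> m N"
  shows "br H (r i) x = \<alpha> * (r i x)\<^sup>2 * br H (\<lambda>x. x (0, i mod N)) x"
proof -
  have c: "(\<lambda>x. x (0, i mod N)) \<in> R" by (rule ratfun.coord[OF zero_idx])
  have "br H (\<lambda>x. 1 - \<alpha> * x (0, i mod N)) x = br H (\<lambda>x. 1 + (- \<alpha>) * x (0, i mod N)) x" by simp
  also have "\<dots> = - \<alpha> * br H (\<lambda>x. x (0, i mod N)) x"
    unfolding br_add[OF ratfun.const ratfun.mult[OF ratfun.const c] assms] br_cmult[OF c assms] by simp
  finally have *: "br H (\<lambda>x. 1 - \<alpha> * x (0, i mod N)) x = - \<alpha> * br H (\<lambda>x. x (0, i mod N)) x" .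
  have "r i = (\<lambda>x. inverse (1 - \<alpha> * x (0, i mod N)))" by (rule ext) (rule rho_def)
  moreover have "br H (\<lambda>x. inverse (1 - \<alpha> * x (0, i mod N))) x
      = - br H (\<lambda>x. 1 - \<alpha> * x (0, i mod N)) x * (inverse (1 - \<alpha> * x (0, i mod N)))\<^sup>2"
    by (rule br_inverse, rule beta_ratfun, erule beta_nz, rule assms)
  ultimately show ?thesis using * by simp
qed

text \<open>Logarithmic derivative of a product whose factors satisfy {H, ln r} = \<alpha> r {H,
  b}.\<close>

lemma br_rs:
  assumes "x \<in> Dom \<alpha> m N"
  shows "br H (rs j k) x = rs j k x * (\<alpha> * (\<Sum>i\<in>{0..j}. r (k + i) x * br H (\<lambda>x. x (0, (k + i) mod N)) x))"
proof (induction j)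
  case 0
  have "rs 0 k = r k" by (rule ext) (rule rhos_0)
  then show ?case by (simp add: br_r[OF assms] power2_eq_square)
next
  case (Suc j)
  have "rs (Suc j) k = (\<lambda>x. rs j k x * r (k + Suc j) x)" by (rule ext) (rule rhos_Suc)
  then have "br H (rs (Suc j) k) x = br H (rs j k) x * r (k + Suc j) x + rs j k x * br H (r (k + Suc j)) x"
    using br_mult[OF rs_ratfun r_ratfun assms] by simp
  then show ?case
    unfolding Suc br_r[OF assms] rhos_Suc sum.atLeast0_atMost_Suc by (simp add: power2_eq_square algebra_simps)
qed

lemma br_B_0:
  assumes "x \<in> Dom \<alpha> m N" "k < N"
  shows "br H (\<lambda>x. B x (0, k)) x = (r k x)\<^sup>2 * br H (\<lambda>x. x (0, k)) x"
proof -
  \<comment> \<open>The variable d_k is affine in \<open>r k\<close>, which reduces its brackets to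
    \<open>br_r\<close>.\<close>
  have "B y (0, k) = (1 / \<alpha>) * r k y + - 1 / \<alpha>" if "y \<in> Dom \<alpha> m N" for y
  proof -
    define d where "d = 1 - \<alpha> * y (0, k)"
    have y: "y (0, k) = (1 - d) / \<alpha>" and d: "d \<noteq> 0"
      using Dom_nz[OF that assms(2)] \<alpha>_nz by (simp_all add: d_def)
    have e: "B y (0, k) = y (0, k) / d" "r k y = 1 / d"
      using assms(2) by (simp_all add: Bmap_0 rho_def d_def inverse_eq_divide)
    show ?thesis unfolding e y using d \<alpha>_nz by (simp add: field_simps)
  qed
  then have "br H (\<lambda>x. B x (0, k)) x = br H (\<lambda>x. (1 / \<alpha>) * r k x + - 1 / \<alpha>) x"
    by (intro br_cong[OF assms(1)]) auto
  also have "\<dots> = (1 / \<alpha>) * br H (r k) x"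
    using br_add[OF ratfun.mult[OF ratfun.const[of "1 / \<alpha>"] r_ratfun[of k]] ratfun.const[of "- 1 / \<alpha>"] assms(1), of H]
      br_cmult[OF r_ratfun assms(1), of H "1 / \<alpha>" k] by simp
  finally show ?thesis using \<alpha>_nz assms(2) by (simp add: br_r[OF assms(1)])
qed

lemma B_pos:
  assumes "1 \<le> p" "p \<le> m" "k < N"
  shows "B x (p, k) = x (p, k) * rs p k x"
  using co_Bmap[OF assms(1) N_pos, of m \<alpha> x k] assms by (simp add: co_eq)

lemma br_B_pos:
  assumes "x \<in> Dom \<alpha> m N" "1 \<le> p" "p \<le> m" "k < N"
  shows "br H (\<lambda>x. B x (p, k)) x = br H (\<lambda>x. x (p, k)) x * rs p k x
    + \<alpha> * B x (p, k) * (\<Sum>i\<in>{0..p}. r (k + i) x * br H (\<lambda>x. x (0, (k + i) mod N)) x)"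
proof -
  have "(\<lambda>x. x (p, k)) \<in> R" by (rule ratfun.coord) (use assms in \<open>simp add: idx_iff\<close>)
  then show ?thesis
    using br_mult[OF _ rs_ratfun assms(1), of "\<lambda>x. x (p, k)" H p k]
    by (simp add: B_pos[OF assms(2-4)] br_rs[OF assms(1)] mult_ac)
qed

end

section \<open>The push-forward of the pencil member without lower diagonal\<close>

text \<open>In the member of the pencil without lower diagonal, the logarithms of \<open>1 - \<alpha> b_s\<close> and
  \<open>a_l^(q)\<close> have bracket \<open>\<alpha> ([s = l] - [s = l + q])\<close>; \<open>hits\<close> sums this bracket over the arc
  \<open>s = k, ..., k + p\<close>, with \<open>d\<close> the offset of \<open>l\<close> from \<open>k\<close>.\<close>

definition hits :: "nat \<Rightarrow> nat \<Rightarrow> nat \<Rightarrow> nat \<Rightarrow> real" where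
  "hits N p q d = of_bool (d \<le> p) - of_bool ((d + q) mod N \<le> p)"

text \<open>By N \<ge> 2 * m + 2 at most one of the two arcs starts inside the other. In each
  position the net count is twice the net coefficient of the product term, which is why the scaling
  factors reverse the sign of that term.\<close>

lemma hits_dgf:
  assumes "p \<le> m" "q \<le> m" "2 * m + 2 \<le> N" "0 < d" "d < N"
  shows "hits N q p (N - d) - hits N p q d = 2 * dgf p q d - 2 * dgf q p (N - d)"
proof -
  consider "d \<le> p" | "p < d" "N - d \<le> q" | "p < d" "q < N - d" by linarith
  then show ?thesis
  proof cases
    case 1
    then have "(d + q) mod N = d + q" "(N - d + p) mod N = p - d" "q < N - d"
      using assms by (auto simp: mod_if)
    then show ?thesis using 1 assms swf_dgf_cases(4)[of q "N - d" p]
      by (auto simp: hits_def dgf_def swf_def)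
  next
    case 2
    then have "(d + q) mod N = q - (N - d)" "(N - d + p) mod N = N - d + p"
      using assms by (auto simp: mod_if)
    then show ?thesis using 2 assms swf_dgf_cases(4)[of p d q]
      by (auto simp: hits_def dgf_def swf_def)
  next
    case 3
    then have "(d + q) mod N = d + q" "(N - d + p) mod N = N - d + p"
      using assms by (auto simp: mod_if)
    then show ?thesis using 3 assms swf_dgf_cases(4)[of p d q] swf_dgf_cases(4)[of q "N - d" p]
      by (auto simp: hits_def)
  qed
qed

lemma sum_hits:
  assumes "k < N" "l < N" "p < N" "q < N"
  shows "(\<Sum>i\<in>{0..p}. of_bool ((k + i) mod N = l) - of_bool ((k + i) mod N = (l + q) mod N)) = hits N p q (off N k l)"
proof -
  have "(l + q) mod N < N" using assms by simp
  then show ?thesis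
    using sum_hit[OF assms(1,2,3)] sum_hit[OF assms(1) _ assms(3), of "(l + q) mod N"]
    by (simp add: sum_subtractf hits_def off_add[OF assms(1,2,4)])
qed

text \<open>Without a lower diagonal the exchange term at d = 1 is gone: diagonal entries commute
  and act on the other entries by scaling.\<close>

lemma hfwd_zero_left:
  assumes "k < N" "l < N"
  shows "1 \<le> q \<Longrightarrow> hfwd A 0 N (0, k) (q, l) = (if k = l then - (A 0 k * A q l) else 0)"
    and "hfwd A 0 N (0, k) (0, l) = 0"
proof -
  define d where "d = off N k l"
  have d: "d = 0 \<longleftrightarrow> k = l" using assms by (auto simp: d_def off_cases)
  show "hfwd A 0 N (0, k) (q, l) = (if k = l then - (A 0 k * A q l) else 0)" if "1 \<le> q"
    using d that swf_dgf_cases(4)[of 0 d q] swf_dgf_cases(5)[of 0 q]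
    unfolding hfwd_def fwd_def Let_def case_prod_conv d_def[symmetric] by auto
  show "hfwd A 0 N (0, k) (0, l) = 0"
    using swf_dgf_cases(4)[of 0 d 0]
    unfolding hfwd_def fwd_def Let_def case_prod_conv d_def[symmetric] by auto
qed

lemma hfwd_zero_right:
  assumes "1 \<le> q"
  shows "hfwd A 0 N (q, l) (0, k) = (if off N l k = q then - (A q l * A 0 k) else 0)"
proof -
  define d where "d = off N l k"
  consider "d = 0" | "0 < d" "d < q" | "d = q" | "q < d" by linarith
  then show ?thesis
    unfolding hfwd_def fwd_def Let_def case_prod_conv d_def[symmetric]
  proof cases
    case 2
    then show "(if d = 0 \<and> 0 \<le> q then 0 else dgf q 0 d * A q l * A 0 k + swf q 0 d * A (0 + d) l *
        (if d \<le> q then A (q - d) k else if d = Suc q then 0 else 0)) = (if d = q then - (A q l * A 0 k) else 0)"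
      using swf_dgf_cases(1)[of d 0 q] by simp
  next
    case 3
    then show "(if d = 0 \<and> 0 \<le> q then 0 else dgf q 0 d * A q l * A 0 k + swf q 0 d * A (0 + d) l *
        (if d \<le> q then A (q - d) k else if d = Suc q then 0 else 0)) = (if d = q then - (A q l * A 0 k) else 0)"
      using swf_dgf_cases(2)[of d 0 q] assms by simp
  qed (use assms swf_dgf_cases(4)[of q d 0] in auto)
qed

text \<open>The arcs [k, k + p] and [k + d, k + d + q] cover the same residues, with multiplicity,
  as [k, k + d + q] and [k + d, k + p].\<close>

lemma rhos_exchange:
  assumes "d \<le> p" "l mod N = (k + d) mod N"
  shows "rhos \<alpha> N p k x * rhos \<alpha> N q l x = rhos \<alpha> N (q + d) k x * rhos \<alpha> N (p - d) l x"
  using rhos_add[of \<alpha> N "p - d" d k x] rhos_add[of \<alpha> N q d k x] rhos_cong[OF assms(2)] assms(1)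
  by (simp add: ac_simps)

text \<open>Both monomials acquire the same factors. The value 0 for \<beta> is essential, as a
  constant lower diagonal would not scale.\<close>

lemma hfwd_scale:
  assumes "k < N" "l < N"
    and C: "\<And>j i. C j i = A j i * rhos \<alpha> N j i x"
  shows "hfwd C 0 N (p, k) (q, l) = hfwd A 0 N (p, k) (q, l) * (rhos \<alpha> N p k x * rhos \<alpha> N q l x)"
proof -
  define d where "d = off N k l"
  have kd: "l mod N = (k + d) mod N"
    using off_eq_iff[of k N l d] assms(1,2) off_less[of N k l] by (simp add: d_def)
  have "fwd C 0 N (p, k) (q, l) = fwd A 0 N (p, k) (q, l) * (rhos \<alpha> N p k x * rhos \<alpha> N q l x)"
  proof (cases "d \<le> p")
    case True
    have "C (q + d) k * C (p - d) l = A (q + d) k * A (p - d) l * (rhos \<alpha> N p k x * rhos \<alpha> N q l x)"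
      unfolding rhos_exchange[OF True kd] by (simp add: C)
    moreover have "C p k * C q l = A p k * A q l * (rhos \<alpha> N p k x * rhos \<alpha> N q l x)"
      by (simp add: C)
    ultimately show ?thesis
      using True by (simp add: fwd_def d_def[symmetric] distrib_right mult.assoc)
  next
    case False
    then show ?thesis by (simp add: fwd_def d_def[symmetric] C)
  qed
  then show ?thesis by (simp add: hfwd_def)
qed

context map_bracket
begin

lemma br_coord_B_0:
  assumes "x \<in> Dom \<alpha> m N" "u \<in> idx m N" "k < N"
  shows "br (\<lambda>x. x u) (\<lambda>x. B x (0, k)) x = (r k x)\<^sup>2 * P x u (0, k)"
  using assms by (simp add: br_B_0 idx_iff)

lemma br_coord_B_pos:
  assumes "x \<in> Dom \<alpha> m N" "u \<in> idx m N" "1 \<le> p" "p \<le> m" "k < N"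
  shows "br (\<lambda>x. x u) (\<lambda>x. B x (p, k)) x
    = P x u (p, k) * rs p k x + \<alpha> * B x (p, k) * (\<Sum>i\<in>{0..p}. r (k + i) x * P x u (0, (k + i) mod N))"
  using assms zero_idx by (simp add: br_B_pos idx_iff)

lemma pushfwd_0:
  assumes "x \<in> Dom \<alpha> m N" "k < N"
  shows "Q (B x) (0, k) v = (r k x)\<^sup>2 * br (\<lambda>x. x (0, k)) (\<lambda>x. B x v) x"
  unfolding pushfwd_eq[OF assms(1)]
  using br_B_0[OF assms, of "\<lambda>x. B x v"] br_skew[OF assms(1), of "\<lambda>x. B x v" "\<lambda>x. B x (0, k)"]
    br_skew[OF assms(1), of "\<lambda>x. B x v" "\<lambda>x. x (0, k)"] by simp

lemma pushfwd_skew: "x \<in> Dom \<alpha> m N \<Longrightarrow> Q (B x) v u = - Q (B x) u v"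
  unfolding pushfwd_eq by (rule br_skew)

text \<open>Each c is its a times a product of factors r; the Leibniz rule in both slots leaves
  brackets a-a, r-a, a-r and r-r.\<close>

lemma pushfwd_pos:
  assumes x: "x \<in> Dom \<alpha> m N" and p: "1 \<le> p" "p \<le> m" "k < N" and q: "1 \<le> q" "q \<le> m" "l < N"
  shows "Q (B x) (p, k) (q, l) = (P x (p, k) (q, l) * rs p k x
      + \<alpha> * B x (p, k) * (\<Sum>i\<in>{0..p}. r (k + i) x * P x (0, (k + i) mod N) (q, l))) * rs q l x
    - \<alpha> * B x (q, l) * (\<Sum>j\<in>{0..q}. r (l + j) x * (P x (0, (l + j) mod N) (p, k) * rs p k x
      + \<alpha> * B x (p, k) * (\<Sum>i\<in>{0..p}. r (k + i) x * P x (0, (l + j) mod N) (0, (k + i) mod N))))"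
proof -
  have I: "(p, k) \<in> idx m N" "(q, l) \<in> idx m N" using p q by (auto simp: idx_iff)
  have 1: "br (\<lambda>x. B x (p, k)) (\<lambda>x. x (q, l)) x = P x (p, k) (q, l) * rs p k x
      + \<alpha> * B x (p, k) * (\<Sum>i\<in>{0..p}. r (k + i) x * P x (0, (k + i) mod N) (q, l))"
    unfolding br_skew[OF x, of "\<lambda>x. B x (p, k)" "\<lambda>x. x (q, l)"] br_coord_B_pos[OF x I(2) p]
      P_skew[OF x I] P_skew[OF x zero_idx I(2)]
    by (simp add: sum_negf)
  have 2: "br (\<lambda>x. B x (p, k)) (\<lambda>x. x (0, j mod N)) x = - (P x (0, j mod N) (p, k) * rs p k x
      + \<alpha> * B x (p, k) * (\<Sum>i\<in>{0..p}. r (k + i) x * P x (0, j mod N) (0, (k + i) mod N)))" for j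
    unfolding br_skew[OF x, of "\<lambda>x. B x (p, k)" "\<lambda>x. x (0, j mod N)"] br_coord_B_pos[OF x zero_idx p] ..
  show ?thesis
    unfolding pushfwd_eq[OF x] br_B_pos[OF x q] 1 2
    by (simp only: mult_minus_right sum_negf diff_conv_add_uminus)
qed

lemma pushfwd_is_PB2a:
  assumes P: "\<And>x u v. P x u v = PB1 \<alpha> m N x u v - \<alpha> * PB2 m N x u v"
    and x: "x \<in> Dom \<alpha> m N" and u: "u \<in> idx m N" and v: "v \<in> idx m N"
  shows "Q (B x) u v = PB2a \<alpha> m N (B x) u v"
proof -
  define A where "A = shifted m N (- 1 / \<alpha>) x"
  \<comment> \<open>The combination is - \<alpha> times the pencil member with \<gamma> = - 1 /
    \<alpha>, for which 1 + \<gamma> * \<alpha> = 0.\<close>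
  have R: "P x (p, k) (q, l) = - \<alpha> * (hfwd A 0 N (p, k) (q, l) - hfwd A 0 N (q, l) (p, k))"
    if "p \<le> m" "q \<le> m" "k < N" "l < N" for p k q l
    using PB_pencil_hfwd[OF that N_large, of x "- 1 / \<alpha>" \<alpha>] \<alpha>_nz
    by (simp add: P A_def field_simps)
  have A0: "A 0 k = - (1 - \<alpha> * x (0, k)) / \<alpha>" if "k < N" for k
    using that \<alpha>_nz by (simp add: A_def shifted_def co_def field_simps)
  have Apos: "A q l = x (q, l)" if "1 \<le> q" "q \<le> m" "l < N" for q l
    using that by (simp add: A_def shifted_def co_def)
  have R00: "P x (0, k) (0, l) = 0" if "k < N" "l < N" for k l
    using R[of 0 0 k l] that by (simp add: hfwd_zero_left)
  have R0: "r k x * P x (0, k) (q, l) = - x (q, l) * (of_bool (k = l) - of_bool (k = (l + q) mod N))"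
    if "k < N" "l < N" "1 \<le> q" "q \<le> m" for k q l
  proof -
    have off: "off N l k = q \<longleftrightarrow> k = (l + q) mod N"
      using off_eq_iff[of l N k q] that N_large by auto
    define b where "b = 1 - \<alpha> * x (0, k)"
    have "r k x * b = 1"
      using Dom_nz[OF x \<open>k < N\<close>] that by (simp add: rho_def b_def)
    moreover have "r k x * P x (0, k) (q, l)
        = r k x * b * (- x (q, l) * (of_bool (k = l) - of_bool (k = (l + q) mod N)))"
      unfolding R[OF le0 \<open>q \<le> m\<close> \<open>k < N\<close> \<open>l < N\<close>] hfwd_zero_left(1)[OF that(1-3)]
        hfwd_zero_right[OF that(3)] off A0[OF that(1)] Apos[OF that(3,4,2)] b_def[symmetric]
      using \<alpha>_nz by simp
    ultimately show ?thesis by simp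
  qed
  have zero_pos: "Q (B x) (0, k) (q, l) = PB2a \<alpha> m N (B x) (0, k) (q, l)"
    if "k < N" "l < N" "1 \<le> q" "q \<le> m" for k q l
  proof -
    have I: "(0, k) \<in> idx m N" using that by (simp add: idx_iff)
    have "Q (B x) (0, k) (q, l) = r k x * (r k x * P x (0, k) (q, l)) * rs q l x"
      using pushfwd_0[OF x that(1)] br_coord_B_pos[OF x I that(3,4,2)] R00[OF that(1)] N_pos
      by (simp add: power2_eq_square)
    also have "\<dots> = - r k x * B x (q, l) * (of_bool (k = l) - of_bool (k = (l + q) mod N))"
      unfolding R0[OF that] B_pos[OF that(3,4,2)] by simp
    also have "\<dots> = PB2a \<alpha> m N (B x) (0, k) (q, l)"
    proof -
      have c0: "1 + \<alpha> * co m N (B x) 0 k = r k x" by (rule co_Bmap_0[OF x N_pos])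
      have off: "off N l k = q \<longleftrightarrow> k = (l + q) mod N" "off N k l = 0 \<longleftrightarrow> k = l"
        using off_eq_iff[of l N k q] off_eq_iff[of k N l 0] that N_large by auto
      show ?thesis
        unfolding PB_oval(3)[OF le0 that(4,1,2) N_large] rule2a.simps Let_def c0 off
        using that co_eq[of q m l N "B x"] by (auto simp: algebra_simps)
    qed
    finally show ?thesis .
  qed
  have zero_zero: "Q (B x) (0, k) (0, l) = PB2a \<alpha> m N (B x) (0, k) (0, l)" if "k < N" "l < N" for k l
  proof -
    have "Q (B x) (0, k) (0, l) = 0"
      using pushfwd_0[OF x that(1)] br_coord_B_0[OF x _ that(2), of "(0, k)"] R00[OF that] that
      by (simp add: idx_iff)
    moreover have "PB2a \<alpha> m N (B x) (0, k) (0, l) = 0"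
      using PB_oval(3)[OF le0 le0 that N_large, of \<alpha> "B x"] by (simp add: rule2a.simps Let_def)
    ultimately show ?thesis by simp
  qed
  have pos_pos: "Q (B x) (p, k) (q, l) = PB2a \<alpha> m N (B x) (p, k) (q, l)"
    if p: "1 \<le> p" "p \<le> m" "k < N" and q: "1 \<le> q" "q \<le> m" "l < N" for p k q l
  proof -
    \<comment> \<open>The scaled band matrix: the diagonal - (1 - \<alpha> b) / \<alpha> times its
      factor 1 / (1 - \<alpha> b) is the constant - 1 / \<alpha>.\<close>
    define C where "C = (\<lambda>j i. if j = 0 then - 1 / \<alpha> else co m N (B x) j i)"
    have pN: "p < N" "q < N" using p q N_large by auto
    have S: "(\<Sum>i\<in>{0..p}. r (k + i) x * P x (0, (k + i) mod N) (q, l)) = - x (q, l) * hits N p q (off N k l)"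
      if "1 \<le> p" "p \<le> m" "k < N" "1 \<le> q" "q \<le> m" "l < N" for p k q l
    proof -
      have "r (k + i) x * P x (0, (k + i) mod N) (q, l)
        = - x (q, l) * (of_bool ((k + i) mod N = l) - of_bool ((k + i) mod N = (l + q) mod N))" for i
        using R0[of "(k + i) mod N" l q] that N_pos by simp
      then show ?thesis
        using sum_hits[of k N l p q] that N_large by (simp only: sum_distrib_left[symmetric])
    qed
    have C: "C j i = A j i * rs j i x" for j i
    proof (cases "j = 0")
      case True
      define b where "b = 1 - \<alpha> * x (0, i mod N)"
      have "A 0 i = A 0 (i mod N)" by (simp add: A_def shifted_def)
      also have "\<dots> = - b / \<alpha>" using A0[of "i mod N"] N_pos by (simp add: b_def)
      finally have "A 0 i * r i x = - b / \<alpha> * inverse b" by (simp only: rho_def b_def)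
      moreover have "b \<noteq> 0" unfolding b_def by (rule beta_nz[OF x])
      ultimately have "A 0 i * r i x = - 1 / \<alpha>" by simp
      then show ?thesis using True by (simp add: C_def rhos_0)
    next
      case False
      then show ?thesis using co_Bmap[of j N m \<alpha> x i] N_pos by (simp add: C_def A_def shifted_def)
    qed
    have Cu: "C p k = B x (p, k)" "C q l = B x (q, l)" using p q by (simp_all add: C_def co_eq)
    \<comment> \<open>The first part is the scaled bracket; the second collects the brackets of the
      factors of one entry with the other entry. The factors commute among themselves by
      \<open>R00\<close>.\<close>
    have "Q (B x) (p, k) (q, l) = - \<alpha> * (hfwd C 0 N (p, k) (q, l) - hfwd C 0 N (q, l) (p, k))
        + \<alpha> * B x (p, k) * B x (q, l) * (hits N q p (off N l k) - hits N p q (off N k l))"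
    proof -
      have z: "r (l + j) x * (P x (0, (l + j) mod N) (p, k) * rs p k x
          + \<alpha> * B x (p, k) * (\<Sum>i\<in>{0..p}. r (k + i) x * P x (0, (l + j) mod N) (0, (k + i) mod N)))
        = r (l + j) x * P x (0, (l + j) mod N) (p, k) * rs p k x" for j
        using R00 N_pos by simp
      have "Q (B x) (p, k) (q, l) = P x (p, k) (q, l) * (rs p k x * rs q l x)
          - \<alpha> * B x (p, k) * (x (q, l) * rs q l x) * hits N p q (off N k l)
          + \<alpha> * B x (q, l) * (x (p, k) * rs p k x) * hits N q p (off N l k)"
        unfolding pushfwd_pos[OF x p q] z S[OF p q] sum_distrib_right[symmetric] S[OF q p]
        by (simp add: algebra_simps)
      then show ?thesis
        unfolding B_pos[OF p, symmetric] B_pos[OF q, symmetric] R[OF p(2) q(2) p(3) q(3)]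
          hfwd_scale[OF p(3) q(3) C] hfwd_scale[OF q(3) p(3) C]
        by (simp add: algebra_simps)
    qed
    also have "\<dots> = PB2a \<alpha> m N (B x) (p, k) (q, l)"
    \<comment> \<open>At k = l both offsets are 0, where \<open>hits_dgf\<close> does not apply; the
      two parts cancel, and \<open>rule2a\<close> lists no bracket between two c at the same
      position.\<close>
    proof (cases "k = l")
      case True
      have off: "off N l l = 0" using q by (simp add: off_cases)
      have "oval (rule2a \<alpha> m N (B x) (p, l) (q, l)) = 0" "oval (rule2a \<alpha> m N (B x) (q, l) (p, l)) = 0"
        using p q by (simp_all add: off)
      then have "PB2a \<alpha> m N (B x) (p, k) (q, l) = 0"
        unfolding PB_oval(3)[OF p(2) q(2) p(3) q(3) N_large] using True by simp
      moreover have "hits N a b 0 = 1 - of_bool (b \<le> a)" if "b < N" for a b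
        using that by (simp add: hits_def)
      moreover have "hfwd C 0 N (a, l) (b, l) = (if b \<le> a then 0 else - (C a l * C b l))" for a b
        using swf_dgf_cases(5)[of a b] by (simp add: hfwd_def fwd_def off)
      ultimately show ?thesis using pN Cu True by (auto simp: off)
    next
      case False
      have d: "off N k l > 0" "off N k l < N" "off N l k = N - off N k l" "off N l k \<noteq> 0"
        using False p q by (auto simp: off_cases)
      have h: "hits N q p (off N l k) - hits N p q (off N k l)
          = 2 * dgf p q (off N k l) - 2 * dgf q p (off N l k)"
        unfolding d(3) by (rule hits_dgf[OF p(2) q(2) N_large d(1,2)])
      show ?thesis
        unfolding h PB_oval(3)[OF p(2) q(2) p(3) q(3) N_large]
          rule2a_hfwd[OF p(1) q(1) p(2) q(2) p(3) q(3) \<alpha>_nz C_def refl]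
          rule2a_hfwd[OF q(1) p(1) q(2) p(2) q(3) p(3) \<alpha>_nz C_def refl]
        using d(1,4) by (simp add: Cu algebra_simps)
    qed
    finally show ?thesis .
  qed
  have skew2a: "PB2a \<alpha> m N y (p, k) (q, l) = - PB2a \<alpha> m N y (q, l) (p, k)"
    if "p \<le> m" "q \<le> m" "k < N" "l < N" for y p k q l
    unfolding PB_oval(3)[OF that N_large] PB_oval(3)[OF that(2,1,4,3) N_large] by simp
  obtain p k q l where uv: "u = (p, k)" "v = (q, l)" by (metis surj_pair)
  have b: "p \<le> m" "q \<le> m" "k < N" "l < N" using u v by (auto simp: uv idx_iff)
  show ?thesis
  proof (cases "p = 0")
    case True
    then show ?thesis using zero_zero[of k l] zero_pos[of k l q] b by (cases "q = 0") (auto simp: uv)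
  next
    case p: False
    show ?thesis
    proof (cases "q = 0")
      case True
      have "Q (B x) (p, k) (0, l) = - Q (B x) (0, l) (p, k)" by (rule pushfwd_skew[OF x])
      also have "\<dots> = - PB2a \<alpha> m N (B x) (0, l) (p, k)" using zero_pos[of l k p] p b by simp
      also have "\<dots> = PB2a \<alpha> m N (B x) (p, k) (0, l)" using skew2a[of p 0 k l "B x"] b by simp
      finally show ?thesis using True by (simp add: uv)
    next
      case False
      then show ?thesis using pos_pos[of p k q l] p b by (simp add: uv)
    qed
  qed
qed

end

section \<open>The Hamiltonian system\<close>

lemma sum_off_left:
  fixes f :: "nat \<Rightarrow> real"
  assumes "l < N" "d < N"
  shows "(\<Sum>k<N. of_bool (off N k l = d) * f k) = f ((l + N - d) mod N)"
proof -
  have "off N k l = d \<longleftrightarrow> k = (l + N - d) mod N" if "k < N" for k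
    using assms that by (auto simp: off_cases mod_if)
  then have "(\<Sum>k<N. of_bool (off N k l = d) * f k) = (\<Sum>k<N. if k = (l + N - d) mod N then f k else 0)"
    by (intro sum.cong) auto
  then show ?thesis using assms by simp
qed

lemma sum_off_right:
  fixes f :: "nat \<Rightarrow> real"
  assumes "l < N" "d < N"
  shows "(\<Sum>k<N. of_bool (off N l k = d) * f k) = f ((l + d) mod N)"
proof -
  have "off N l k = d \<longleftrightarrow> k = (l + d) mod N" if "k < N" for k
    using off_eq_iff[OF assms(1) that assms(2)] by auto
  then have "(\<Sum>k<N. of_bool (off N l k = d) * f k) = (\<Sum>k<N. if k = (l + d) mod N then f k else 0)"
    by (intro sum.cong) auto
  then show ?thesis using assms by simp
qed

lemma sum_cyclic_telescope:
  fixes f :: "nat \<Rightarrow> real"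
  assumes "\<And>i. f (i mod N) = f i" "N > 0"
  shows "(\<Sum>i\<in>{0..p}. f (l + i) - f (l + i + N - 1)) = f (l + p) - f (l + N - 1)"
proof (induction p)
  case (Suc p)
  have "f (l + Suc p + N - 1) = f (l + p)"
    using assms(1)[of "l + Suc p + N - 1"] assms(1)[of "l + p"] by simp
  then show ?case using Suc by (simp add: sum.atLeast0_atMost_Suc)
qed simp

context map_bracket
begin

lemma PB1_zero_zero:
  assumes "k < N" "l < N"
  shows "PB1 \<alpha> m N x (0, k) (0, l)
    = of_bool (off N k l = 1) * (- \<alpha> * co m N x 1 k) + of_bool (off N l k = 1) * (\<alpha> * co m N x 1 l)"
  unfolding PB_oval(1)[OF le0 le0 assms N_large] rule1.simps Let_def by simp

lemma PB1_zero_pos: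
  assumes "k < N" "l < N" "1 \<le> p" "p \<le> m"
  shows "PB1 \<alpha> m N x (0, k) (p, l)
    = of_bool (off N k l = 0) * (- co m N x p k) + of_bool (off N k l = 1) * (- \<alpha> * co m N x (p + 1) k)
      + of_bool (off N l k = p) * co m N x p l + of_bool (off N l k = p + 1) * (\<alpha> * co m N x (p + 1) l)"
  unfolding PB_oval(1)[OF le0 assms(4,1,2) N_large] rule1.simps Let_def using assms(3) by simp

text \<open>The square keeps the logarithm meaningful where \<open>1 + \<alpha> d_k < 0\<close>.\<close>

definition energy :: "pt \<Rightarrow> real" where
  "energy y = (\<Sum>k<N. ln ((1 + \<alpha> * y (0, k))\<^sup>2)) / (2 * \<alpha>\<^sup>2)"

lemma energy_deriv:
  assumes "y \<in> Dom (- \<alpha>) m N"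
  shows "((\<lambda>t. energy (y(z := t))) has_field_derivative
    (\<Sum>k<N. of_bool (z = (0, k)) / (\<alpha> * (1 + \<alpha> * y (0, k))))) (at (y z))"
proof -
  have "((\<lambda>t. ln ((1 + \<alpha> * (y(z := t)) (0, k))\<^sup>2) / (2 * \<alpha>\<^sup>2)) has_field_derivative
      of_bool (z = (0, k)) / (\<alpha> * (1 + \<alpha> * y (0, k)))) (at (y z))" if "k < N" for k
  proof (cases "z = (0, k)")
    case True
    have nz: "1 + \<alpha> * y (0, k) \<noteq> 0" using Dom_nz[OF assms that] by simp
    define g where "g = 1 + \<alpha> * y (0, k)"
    have "((\<lambda>t. (1 + \<alpha> * t)\<^sup>2) has_field_derivative 2 * g * \<alpha>) (at (y (0, k)))"
      unfolding g_def by (auto intro!: derivative_eq_intros)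
    then have "((\<lambda>t. ln ((1 + \<alpha> * t)\<^sup>2)) has_field_derivative inverse (g\<^sup>2) * (2 * g * \<alpha>)) (at (y (0, k)))"
      unfolding g_def by (rule DERIV_chain2[where f = ln, OF DERIV_ln, rotated]) (use nz in simp)
    then have "((\<lambda>t. ln ((1 + \<alpha> * t)\<^sup>2) / (2 * \<alpha>\<^sup>2)) has_field_derivative
        inverse (g\<^sup>2) * (2 * g * \<alpha>) / (2 * \<alpha>\<^sup>2)) (at (y (0, k)))"
      by (rule DERIV_cdivide)
    also have "inverse (g\<^sup>2) * (2 * g * \<alpha>) / (2 * \<alpha>\<^sup>2) = 1 / (\<alpha> * g)"
      using nz \<alpha>_nz unfolding g_def[symmetric] by (simp add: power2_eq_square field_simps)
    finally have "((\<lambda>t. ln ((1 + \<alpha> * t)\<^sup>2) / (2 * \<alpha>\<^sup>2)) has_field_derivative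
        1 / (\<alpha> * (1 + \<alpha> * y (0, k)))) (at (y (0, k)))" by (simp only: g_def)
    then show ?thesis using True by simp
  qed simp
  then show ?thesis
    unfolding energy_def sum_divide_distrib by (intro DERIV_sum) auto
qed

lemma pd_energy:
  assumes "x \<in> Dom \<alpha> m N"
  shows "pd energy z (B x) = (\<Sum>k<N. of_bool (z = (0, k)) / (\<alpha> * r k x))"
proof -
  have "pd energy z (B x) = (\<Sum>k<N. of_bool (z = (0, k)) / (\<alpha> * (1 + \<alpha> * B x (0, k))))"
    unfolding pd_def by (rule DERIV_imp_deriv[OF energy_deriv[OF Bmap_in[OF assms]]])
  also have "\<dots> = (\<Sum>k<N. of_bool (z = (0, k)) / (\<alpha> * r k x))"
  proof (intro sum.cong refl)
    fix k assume "k \<in> {..<N}"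
    then have "1 + \<alpha> * B x (0, k) = r k x"
      using co_Bmap_0[OF assms N_pos, of k] by (simp add: co_eq)
    then show "of_bool (z = (0, k)) / (\<alpha> * (1 + \<alpha> * B x (0, k))) = of_bool (z = (0, k)) / (\<alpha> * r k x)"
      by simp
  qed
  finally show ?thesis .
qed

text \<open>The square of r from \<open>pushfwd_0\<close> meets 1 / (\<alpha> r) from the gradient,
  which leaves a single factor r and divides by \<alpha>.\<close>

lemma energy_field:
  assumes "x \<in> Dom \<alpha> m N" "u \<in> idx m N"
  shows "(\<Sum>z\<in>idx m N. Q (B x) z u * pd energy z (B x))
    = (\<Sum>k<N. r k x * br (\<lambda>x. x (0, k)) (\<lambda>x. B x u) x) / \<alpha>"
proof -
  have "(\<Sum>z\<in>idx m N. Q (B x) z u * pd energy z (B x))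
      = (\<Sum>z\<in>idx m N. \<Sum>k<N. if z = (0, k) then Q (B x) (0, k) u / (\<alpha> * r k x) else 0)"
    unfolding pd_energy[OF assms(1)] sum_distrib_left by (intro sum.cong refl) auto
  also have "\<dots> = (\<Sum>k<N. \<Sum>z\<in>idx m N. if z = (0, k) then Q (B x) (0, k) u / (\<alpha> * r k x) else 0)"
    by (rule sum.swap)
  also have "\<dots> = (\<Sum>k<N. Q (B x) (0, k) u / (\<alpha> * r k x))"
    by (intro sum.cong refl) (simp add: idx_iff)
  also have "\<dots> = (\<Sum>k<N. r k x * br (\<lambda>x. x (0, k)) (\<lambda>x. B x u) x / \<alpha>)"
    using r_nz[OF assms(1)] \<alpha>_nz
    by (intro sum.cong refl) (simp add: pushfwd_0[OF assms(1)] power2_eq_square field_simps)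
  finally show ?thesis by (simp add: sum_divide_distrib)
qed

lemma energy_generates_Xfield:
  assumes P: "\<And>x u v. P x u v = PB1 \<alpha> m N x u v"
    and x: "x \<in> Dom \<alpha> m N" and u: "u \<in> idx m N"
  shows "(\<Sum>z\<in>idx m N. Q (B x) z u * pd energy z (B x)) = Xfield \<alpha> m N (B x) u"
proof -
  define c where "c = co m N (B x)"
  define a where "a = co m N x"
  have c0: "c 0 k = (r k x - 1) / \<alpha>" for k
    using co_Bmap_0[OF x N_pos, of k] \<alpha>_nz by (simp add: c_def field_simps)
  have c: "c j k = a j k * rs j k x" if "1 \<le> j" for j k
    unfolding c_def a_def by (rule co_Bmap[OF that N_pos])
  have c1: "c 1 k = a 1 k * (r k x * r (Suc k) x)" for k
    using c[of 1 k] by (simp add: rhos_Suc rhos_0 One_nat_def)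
  have N1: "1 < N" using N_large by simp
  \<comment> \<open>Only the neighbours l - 1 and l + 1 contribute, and the factor
    \<open>r l x\<close> completes both terms to c^(1). The index \<open>l + N - 1\<close> stands
    for l - 1.\<close>
  have W: "r l x * (\<Sum>k<N. r k x * PB1 \<alpha> m N x (0, k) (0, l)) = \<alpha> * (c 1 l - c 1 (l + N - 1))"
    if l: "l < N" for l
  proof -
    have pred: "r (Suc (l + N - 1)) x = r l x" by (rule rho_cong) (use N_pos in simp)
    have "(\<Sum>k<N. r k x * PB1 \<alpha> m N x (0, k) (0, l))
        = (\<Sum>k<N. of_bool (off N k l = 1) * (r k x * (- \<alpha> * a 1 k)))
          + (\<Sum>k<N. of_bool (off N l k = 1) * (r k x * (\<alpha> * a 1 l)))"
      unfolding sum.distrib[symmetric] a_def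
      by (intro sum.cong refl) (simp add: PB1_zero_zero[OF _ l] algebra_simps)
    also have "\<dots> = r (l + N - 1) x * (- \<alpha> * a 1 (l + N - 1)) + r (Suc l) x * (\<alpha> * a 1 l)"
      unfolding sum_off_left[OF l N1] sum_off_right[OF l N1] by (simp add: a_def)
    finally have "r l x * (\<Sum>k<N. r k x * PB1 \<alpha> m N x (0, k) (0, l))
        = r l x * (r (l + N - 1) x * (- \<alpha> * a 1 (l + N - 1)) + r (Suc l) x * (\<alpha> * a 1 l))" by simp
    then show ?thesis unfolding c1 pred by (simp add: algebra_simps)
  qed
  obtain p l where pl: "u = (p, l)" by (metis surj_pair)
  have p: "p \<le> m" and l: "l < N" using u by (auto simp: pl idx_iff)
  have field: "(\<Sum>z\<in>idx m N. Q (B x) z (p, l) * pd energy z (B x))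
      = (\<Sum>k<N. r k x * br (\<lambda>x. x (0, k)) (\<lambda>x. B x (p, l)) x) / \<alpha>"
    using energy_field[OF x u] by (simp only: pl)
  have c_mod: "c j (i mod N) = c j i" for j i by (simp add: c_def)
  show ?thesis
  proof (cases "p = 0")
    case True
    have "(\<Sum>k<N. r k x * br (\<lambda>x. x (0, k)) (\<lambda>x. B x (0, l)) x)
        = r l x * (r l x * (\<Sum>k<N. r k x * PB1 \<alpha> m N x (0, k) (0, l)))"
      unfolding sum_distrib_left
      by (intro sum.cong refl) (simp add: br_coord_B_0[OF x _ l] idx_iff P power2_eq_square)
    then show ?thesis
      unfolding pl field[unfolded True] True W[OF l] Xfield_def Let_def case_prod_conv c_def[symmetric] c_mod
      using \<alpha>_nz by (simp add: c0)
  next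
    case False
    then have p1: "1 \<le> p" by simp
    have pN: "p < N" "p + 1 < N" "0 < N" using p N_large by auto
    \<comment> \<open>Multiplying by \<open>rs p l x\<close> extends the factors of a^(p + 1) by one
      index at the right or the left end, completing them to c^(p + 1) at l and at l - 1.\<close>
    have V: "rs p l x * (\<Sum>k<N. r k x * PB1 \<alpha> m N x (0, k) (p, l))
        = c p l * (r (l + p) x - r l x) + \<alpha> * (c (p + 1) l - c (p + 1) (l + N - 1))"
    proof -
      have pred: "rs p (Suc (l + N - 1)) x = rs p l x" by (rule rhos_cong) (use N_pos in simp)
      have "(\<Sum>k<N. r k x * PB1 \<alpha> m N x (0, k) (p, l))
        = (\<Sum>k<N. of_bool (off N k l = 0) * (r k x * (- a p k)))
          + (\<Sum>k<N. of_bool (off N k l = 1) * (r k x * (- \<alpha> * a (p + 1) k)))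
          + (\<Sum>k<N. of_bool (off N l k = p) * (r k x * a p l))
          + (\<Sum>k<N. of_bool (off N l k = p + 1) * (r k x * (\<alpha> * a (p + 1) l)))"
        unfolding sum.distrib[symmetric] a_def
        by (intro sum.cong refl) (simp add: PB1_zero_pos[OF _ l p1 p] algebra_simps)
      also have "\<dots> = r l x * (- a p l) + r (l + N - 1) x * (- \<alpha> * a (p + 1) (l + N - 1))
          + r (l + p) x * a p l + r (l + (p + 1)) x * (\<alpha> * a (p + 1) l)"
        unfolding sum_off_left[OF l pN(3)] sum_off_left[OF l N1] sum_off_right[OF l pN(1)] sum_off_right[OF l pN(2)]
        by (simp add: a_def)
      finally have "rs p l x * (\<Sum>k<N. r k x * PB1 \<alpha> m N x (0, k) (p, l))
        = rs p l x * (r l x * (- a p l) + r (l + N - 1) x * (- \<alpha> * a (p + 1) (l + N - 1))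
          + r (l + p) x * a p l + r (l + (p + 1)) x * (\<alpha> * a (p + 1) l))" by simp
      moreover have "c (p + 1) l = a (p + 1) l * (rs p l x * r (l + (p + 1)) x)"
        using c[of "p + 1" l] by (simp add: rhos_Suc)
      moreover have "c (p + 1) (l + N - 1) = a (p + 1) (l + N - 1) * (r (l + N - 1) x * rs p l x)"
        using c[of "p + 1" "l + N - 1"] pred by (simp add: rhos_Suc_left del: Suc_pred)
      ultimately show ?thesis unfolding c[OF p1] by (simp only: algebra_simps)
    qed
    have "(\<Sum>k<N. r k x * br (\<lambda>x. x (0, k)) (\<lambda>x. B x (p, l)) x)
        = (\<Sum>k<N. r k x * PB1 \<alpha> m N x (0, k) (p, l) * rs p l x)
          + (\<Sum>k<N. \<Sum>i\<in>{0..p}. \<alpha> * B x (p, l) * (r (l + i) x * (r k x * PB1 \<alpha> m N x (0, k) (0, (l + i) mod N))))"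
      unfolding sum.distrib[symmetric]
      by (intro sum.cong refl)
        (simp add: br_coord_B_pos[OF x _ p1 p l] idx_iff P algebra_simps sum_distrib_left)
    also have "(\<Sum>k<N. \<Sum>i\<in>{0..p}. \<alpha> * B x (p, l) * (r (l + i) x * (r k x * PB1 \<alpha> m N x (0, k) (0, (l + i) mod N))))
        = (\<Sum>i\<in>{0..p}. \<Sum>k<N. \<alpha> * B x (p, l) * (r (l + i) x * (r k x * PB1 \<alpha> m N x (0, k) (0, (l + i) mod N))))"
      by (rule sum.swap)
    also have "\<dots> = \<alpha> * B x (p, l) * (\<Sum>i\<in>{0..p}. r (l + i) x * (\<Sum>k<N. r k x * PB1 \<alpha> m N x (0, k) (0, (l + i) mod N)))"
      by (simp only: sum_distrib_left)
    also have "(\<Sum>i\<in>{0..p}. r (l + i) x * (\<Sum>k<N. r k x * PB1 \<alpha> m N x (0, k) (0, (l + i) mod N)))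
        = (\<Sum>i\<in>{0..p}. \<alpha> * (c 1 (l + i) - c 1 (l + i + N - 1)))"
    proof (intro sum.cong refl)
      fix i
      have "c 1 ((l + i) mod N + N - 1) = c 1 (l + i + N - 1)"
      proof -
        have "((l + i) mod N + (N - 1)) mod N = (l + i + (N - 1)) mod N" by (rule mod_add_left_eq)
        then have "((l + i) mod N + N - 1) mod N = (l + i + N - 1) mod N" using N_pos by simp
        then show ?thesis using c_mod by metis
      qed
      then show "r (l + i) x * (\<Sum>k<N. r k x * PB1 \<alpha> m N x (0, k) (0, (l + i) mod N))
          = \<alpha> * (c 1 (l + i) - c 1 (l + i + N - 1))"
        using W[of "(l + i) mod N"] N_pos by (simp add: c_mod)
    qed
    \<comment> \<open>The scaling factors of c_l^(p) contribute the sum of \<open>W\<close> over the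
      arc l, ..., l + p, of which only the two ends remain.\<close>
    also have "\<dots> = \<alpha> * (c 1 (l + p) - c 1 (l + N - 1))"
      unfolding sum_distrib_left[symmetric] sum_cyclic_telescope[of "c 1", OF c_mod N_pos] ..
    also have "(\<Sum>k<N. r k x * PB1 \<alpha> m N x (0, k) (p, l) * rs p l x)
        = c p l * (r (l + p) x - r l x) + \<alpha> * (c (p + 1) l - c (p + 1) (l + N - 1))"
      unfolding sum_distrib_right[symmetric] V[symmetric] by (rule mult.commute)
    also have "B x (p, l) = c p l" using p l by (simp add: c_def co_eq)
    finally have sum: "(\<Sum>k<N. r k x * br (\<lambda>x. x (0, k)) (\<lambda>x. B x (p, l)) x)
        = c p l * (r (l + p) x - r l x) + \<alpha> * (c (p + 1) l - c (p + 1) (l + N - 1))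
          + \<alpha> * c p l * (\<alpha> * (c 1 (l + p) - c 1 (l + N - 1)))" .
    show ?thesis
      unfolding pl field sum Xfield_def Let_def case_prod_conv c_def[symmetric] c_mod
      using \<alpha>_nz False by (simp add: c0 field_simps)
  qed
qed

end

text \<open>Together with \<open>pushfwd_linear\<close>, this makes every combination of the two
  push-forwards a push-forward of a combination of \<open>PB1\<close> and \<open>PB2\<close>, so
  that compatibility reduces to \<open>PB_poisson\<close>.\<close>

lemma PB_linear: "s * PB1 \<alpha> m N x u v + t * (PB1 \<alpha> m N x u v - \<alpha> * PB2 m N x u v)
    = (s + t) * PB1 \<alpha> m N x u v + (- \<alpha> * t) * PB2 m N x u v"
  by (simp add: algebra_simps)

lemma pushfwd_linear:
  "pushfwd I D B (\<lambda>x u v. s * P x u v + t * R x u v) y u v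
    = s * pushfwd I D B P y u v + t * pushfwd I D B R y u v"
  unfolding pushfwd_def Let_def sum_distrib_left sum.distrib[symmetric]
  by (intro sum.cong refl) (simp add: algebra_simps)

theorem mainTheorem18:
  fixes N m :: nat and \<alpha> :: real
  assumes "m \<ge> 1" and "N \<ge> 2 * m + 2" and "\<alpha> \<noteq> 0"
  shows "inj_on (Bmap \<alpha> m N) (Dom \<alpha> m N) \<and>
    (\<forall>y\<in>Bmap \<alpha> m N ` Dom \<alpha> m N. \<forall>u\<in>idx m N. \<forall>v\<in>idx m N.
       pushfwd (idx m N) (Dom \<alpha> m N) (Bmap \<alpha> m N)
         (\<lambda>x u v. PB1 \<alpha> m N x u v - \<alpha> * PB2 m N x u v) y u v = PB2a \<alpha> m N y u v) \<and>
    poisson (idx m N) (Bmap \<alpha> m N ` Dom \<alpha> m N) (PB3 \<alpha> m N) \<and>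
    compatible (idx m N) (Bmap \<alpha> m N ` Dom \<alpha> m N) (PB3 \<alpha> m N) (PB2a \<alpha> m N) \<and>
    hamiltonian (idx m N) (Bmap \<alpha> m N ` Dom \<alpha> m N) (PB3 \<alpha> m N) (Xfield \<alpha> m N)"
proof -
  let ?I = "idx m N" and ?D = "Dom \<alpha> m N" and ?B = "Bmap \<alpha> m N"
  let ?push = "pushfwd ?I ?D ?B"
  let ?comb = "\<lambda>s t x u v. s * PB1 \<alpha> m N x u v + t * PB2 m N x u v"
  interpret brackets \<alpha> m N ?D
    using assms copen_Dom by (simp add: brackets_def)
  have mb: "map_bracket \<alpha> m N (?comb s t)" for s t
    unfolding map_bracket_def map_bracket_axioms_def using bivector_PB assms by blast
  have one: "?comb 1 0 = PB1 \<alpha> m N"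
    by (intro ext) simp
  have diff: "?comb 1 (- \<alpha>) = (\<lambda>x u v. PB1 \<alpha> m N x u v - \<alpha> * PB2 m N x u v)"
    by (intro ext) simp
  have m1: "map_bracket \<alpha> m N (PB1 \<alpha> m N)" using mb[of 1 0] unfolding one .
  have m2: "map_bracket \<alpha> m N (\<lambda>x u v. PB1 \<alpha> m N x u v - \<alpha> * PB2 m N x u v)"
    using mb[of 1 "- \<alpha>"] unfolding diff .
  interpret B: map_bracket \<alpha> m N "PB1 \<alpha> m N" by (rule m1)
  have image: "?B ` ?D = Dom (- \<alpha>) m N" by (rule B.image_B)
  have poisson: "poisson ?I (?B ` ?D) (?push (?comb s t))" for s t
  proof -
    interpret C: map_bracket \<alpha> m N "?comb s t" by (rule mb)
    show ?thesis unfolding image by (rule C.pushfwd_poisson[OF PB_poisson])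
  qed
  have i: "?push (\<lambda>x u v. PB1 \<alpha> m N x u v - \<alpha> * PB2 m N x u v) y u v = PB2a \<alpha> m N y u v"
    if "y \<in> ?B ` ?D" "u \<in> ?I" "v \<in> ?I" for y u v
    using map_bracket.pushfwd_is_PB2a[OF m2 refl] that by blast
  have "poisson ?I (?B ` ?D) (PB3 \<alpha> m N)"
    using poisson[of 1 0] unfolding one PB3_def .
  moreover have "compatible ?I (?B ` ?D) (PB3 \<alpha> m N) (PB2a \<alpha> m N)"
    unfolding compatible_def
  proof (intro allI)
    fix s t :: real
    show "poisson ?I (?B ` ?D) (\<lambda>y u v. s * PB3 \<alpha> m N y u v + t * PB2a \<alpha> m N y u v)"
    proof (rule poisson_cong)
      show "copen ?I (?B ` ?D)" unfolding image by (rule copen_Dom)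
      show "poisson ?I (?B ` ?D) (?push (?comb (s + t) (- \<alpha> * t)))" by (rule poisson)
      show "s * PB3 \<alpha> m N y u v + t * PB2a \<alpha> m N y u v = ?push (?comb (s + t) (- \<alpha> * t)) y u v"
        if "y \<in> ?B ` ?D" "u \<in> ?I" "v \<in> ?I" for y u v
        unfolding PB_linear[symmetric] pushfwd_linear i[OF that] PB3_def ..
    qed
  qed
  moreover have "hamiltonian ?I (?B ` ?D) (PB3 \<alpha> m N) (Xfield \<alpha> m N)"
    unfolding hamiltonian_def
  proof (intro exI[of _ B.energy] conjI ballI)
    fix y z assume "y \<in> ?B ` ?D" "z \<in> ?I"
    then show "(\<lambda>t. B.energy (y(z := t))) differentiable at (y z)"
      using B.energy_deriv[of y z] unfolding image real_differentiable_def by blast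
  next
    fix y u assume "y \<in> ?B ` ?D" and u: "u \<in> ?I"
    then obtain x where x: "x \<in> ?D" and y: "y = ?B x" by blast
    show "Xfield \<alpha> m N y u = (\<Sum>z\<in>?I. PB3 \<alpha> m N y z u * pd B.energy z y)"
      unfolding PB3_def y by (rule B.energy_generates_Xfield[OF refl x u, symmetric])
  qed
  ultimately show ?thesis using B.inj_B i by blast
qed

end
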